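(* Let $S$ be a self-avoiding, planefilling and symmetric folding string coding an $m$-fold, with $r$ boundary points. Let $\mathcal{T}_S$ be the tile generated by $S$, with topological boundary $\partial\mathcal{T}_S$. Then $$\dim_{\rm H}(\partial \mathcal{T}_S)=\frac{2\log(r)-\log(4)}{\log(m)},$$ where $\dim_{\rm H}$ denotes Hausdorff dimension.
   Context: A folding string is a finite word $S=a_1\ldots a_{m-1}$ ($m\ge 2$) over $\{D,U\}$ with first letter $a_1=D$; such an $S$ codes an $m$-fold. $\overline{S}$ is the word obtained from $S$ by reversing it and exchanging $D$ and $U$; $S$ is symmetric if $S=\overline S$. For $S=a_1\ldots a_{s-1}$ and $T=b_1\ldots b_{t-1}$ the folding convolution is $S*T=S\,b_1\,\overline{S}\,b_2\,S\,b_3\,\overline{S}\cdots b_{t-1}X$, in which $t$ blocks alternate between $S$ and $\overline S$ beginning with $S$ (so $X=\overline S$ if $t$ is even, $X=S$ if $t$ is odd). This operation is associative; $S^{*1}=S$, $S^{*(n+1)}=S^{*n}*S$. Since $S^{*n}$ is a prefix of $S^{*(n+1)}$, there is an infinite sequence $S^{*\infty}$ having all $S^{*n}$ as prefixes. Let $A=\{a,b,c,d\}$. $\sigma$ is the morphism of $A^*$ with $\sigma(a)=b,\sigma(b)=c,\sigma(c)=d,\sigma(d)=a$, and $\tau$ is the reversal of words in $A^*$. Let $w:\{D,U\}^*\to\mathbb{Z}$ be the homomorphism with $w(D)=1$, $w(U)=-1$. The folding morphism $\theta=\theta_S:A^*\to A^*$ associated to $S$ is the morphism commuting with $\sigma\tau$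 such that $\theta(a)=e_0\ldots e_{m-1}$ with $e_0=a$ and $e_i=\sigma^{w(a_1\ldots a_i)}(a)$ for $1\le i\le m-1$; thus $\theta(b)=\sigma\tau\theta(a)$, $\theta(c)=\sigma^2\theta(a)$, $\theta(d)=\sigma^3\tau\theta(a)$. Let $f:A^*\to\mathbb{C}$ be the homomorphism (concatenation to addition) with $f(a)=1,f(b)=i,f(c)=-1,f(d)=-i$. A finite or infinite word $u_0u_1u_2\ldots$ over $A$ determines a lattice path starting at $p_0=0$ with $p_{j+1}=p_j+f(u_j)$, traversing successively the unit segments $[p_j,p_{j+1}]$; $K[u]$ denotes this curve (as a set, the union of these segments). The curve associated to an infinite sequence $a_1a_2a_3\ldots$ over $\{D,U\}$ is the path of the infinite word $e_0e_1e_2\ldots$ with $e_0=a$, $e_i=\sigma^{w(a_1\ldots a_i)}(a)$. Grid points are the Gaussian integers. $S$ is self-avoiding if the curve associated to $S^{*\infty}$ does not traverse any unit segment twice (in either direction). $S$ is planefilling if for arbitrarily large $R>0$ there is a disc of radius $R$ such that this curve passes twice through each grid point in the disc. The boundary points of $S$ are the Gaussian integers visited exactly once by the curve $K[\theta(a)]$ (its start and end points included). Let $L_\theta:\mathbb{C}\to\mathbb{C}$ be multiplication by $z=f(\theta(a))$. The tile $\mathcal{T}_S$ generated by $S$ is the compact set that is the limit (in the Hausdorff metric) of the sets $L_\theta^{-n}(K[\theta^n(abcd)])$ as $n\to\infty$; this limit exists. *)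

theory Defs
  imports "HOL-Analysis.Analysis"
begin

section \<open>Hausdorff dimension and Hausdorff limits\<close>

text \<open>The power \<open>(diam X)^s\<close> with the conventions needed at \<open>s = 0\<close>
  (where \<open>powr\<close> would give \<open>0 powr 0 = 0\<close>): nonempty sets count 1, the empty set counts 0.\<close>

definition diam_power :: "real \<Rightarrow> 'a::metric_space set \<Rightarrow> ennreal" where
  "diam_power s X =
     (if X = {} then 0 else if s = 0 then 1 else ennreal (diameter X powr s))"

text \<open>Boundedness is required because \<^const>\<open>diameter\<close> is unspecified for unbounded sets.\<close>

definition delta_covers :: "real \<Rightarrow> 'a::metric_space set \<Rightarrow> (nat \<Rightarrow> 'a set) set" where
  "delta_covers \<delta> E =
     {X. E \<subseteq> (\<Union>i. X i) \<and> (\<forall>i. bounded (X i) \<and> diameter (X i) \<le> \<delta>)}"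

definition hausdorff_premeasure :: "real \<Rightarrow> real \<Rightarrow> 'a::metric_space set \<Rightarrow> ennreal" where
  "hausdorff_premeasure s \<delta> E = (INF X\<in>delta_covers \<delta> E. \<Sum>i. diam_power s (X i))"

definition hausdorff_measure :: "real \<Rightarrow> 'a::metric_space set \<Rightarrow> ennreal" where
  "hausdorff_measure s E = (SUP \<delta>\<in>{0<..}. hausdorff_premeasure s \<delta> E)"

definition hausdorff_dim :: "'a::metric_space set \<Rightarrow> ereal" where
  "hausdorff_dim E = Inf {ereal s | s. 0 \<le> s \<and> hausdorff_measure s E = 0}"

text \<open>Meaningful for nonempty bounded sets only.\<close>

definition hausdorff_dist :: "'a::metric_space set \<Rightarrow> 'a set \<Rightarrow> real" where
  "hausdorff_dist X Y = max (SUP x\<in>X. infdist x Y) (SUP y\<in>Y. infdist y X)"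

definition hausdorff_limit :: "(nat \<Rightarrow> 'a::metric_space set) \<Rightarrow> 'a set \<Rightarrow> bool" where
  "hausdorff_limit X T \<longleftrightarrow>
     compact T \<and> T \<noteq> {} \<and> (\<lambda>n. hausdorff_dist (X n) T) \<longlonglongrightarrow> 0"

section \<open>Folding strings\<close>

datatype crease = D | U

fun flip :: "crease \<Rightarrow> crease" where
  "flip D = U"
| "flip U = D"

definition folding_string :: "crease list \<Rightarrow> bool" where
  "folding_string S \<longleftrightarrow> S \<noteq> [] \<and> hd S = D"

definition bar :: "crease list \<Rightarrow> crease list" where
  "bar S = map flip (rev S)"

definition symmetric_string :: "crease list \<Rightarrow> bool" where
  "symmetric_string S \<longleftrightarrow> bar S = S"

text \<open>\<open>S b\<^sub>1 (bar S) b\<^sub>2 S b\<^sub>3 \<dots>\<close>, where \<open>b\<^sub>i\<^sub>+\<^sub>1 = T ! i\<close>.\<close>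

definition fold_conv :: "crease list \<Rightarrow> crease list \<Rightarrow> crease list" where
  "fold_conv S T =
     S @ concat (map (\<lambda>i. T ! i # (if even i then bar S else S)) [0..<length T])"

text \<open>The empty string is a left unit of the convolution, so it can serve as the zeroth power.\<close>

fun conv_power :: "crease list \<Rightarrow> nat \<Rightarrow> crease list" where
  "conv_power S 0 = []"
| "conv_power S (Suc n) = fold_conv (conv_power S n) S"

text \<open>The infinite sequence, indexed from 0. Entry \<open>i\<close> is read off from the power with
  exponent \<open>i + 1\<close>, whose length exceeds \<open>i\<close>; see \<open>conv_power_inf_prefix\<close> below.\<close>

definition conv_power_inf :: "crease list \<Rightarrow> nat \<Rightarrow> crease" where
  "conv_power_inf S i = conv_power S (Suc i) ! i"

lemma conv_power_1: "conv_power S (Suc 0) = S"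
proof -
  have "(\<lambda>i. S ! i # (if even i then bar [] else [])) = (\<lambda>i. [S ! i])"
    by (auto simp: bar_def)
  then show ?thesis
    by (simp add: fold_conv_def concat_map_singleton map_nth)
qed

lemma length_conv_power_ge:
  assumes "S \<noteq> []"
  shows "n \<le> length (conv_power S n)"
proof (induction n)
  case (Suc n)
  obtain k where k: "length S = Suc k"
    using assms by (cases S) auto
  then show ?case
    using Suc by (simp add: fold_conv_def upt_rec[of 0 "Suc k"])
qed simp

lemma conv_power_prefix:
  assumes "i < length (conv_power S n)" "n \<le> k"
  shows "i < length (conv_power S k) \<and> conv_power S k ! i = conv_power S n ! i"
  using assms(2)
proof (induction k rule: dec_induct)
  case (step k)
  then show ?case by (simp add: fold_conv_def nth_append)
qed (use assms in simp)

lemma conv_power_inf_prefix: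
  assumes "S \<noteq> []" "i < length (conv_power S n)"
  shows "conv_power_inf S i = conv_power S n ! i"
proof -
  have "i < length (conv_power S (Suc i))"
    using length_conv_power_ge[OF assms(1), of "Suc i"] by simp
  then show ?thesis
    using assms(2) conv_power_prefix[of i S "Suc i" n] conv_power_prefix[of i S n "Suc i"]
    unfolding conv_power_inf_def by (cases "Suc i \<le> n") auto
qed

section \<open>Words over the four directions and the folding morphism\<close>

datatype letter = La | Lb | Lc | Ld

fun sigma :: "letter \<Rightarrow> letter" where
  "sigma La = Lb"
| "sigma Lb = Lc"
| "sigma Lc = Ld"
| "sigma Ld = La"

text \<open>Integer powers of \<^const>\<open>sigma\<close>, a permutation of order 4.\<close>

definition sigma_pow :: "int \<Rightarrow> letter \<Rightarrow> letter" where
  "sigma_pow k = sigma ^^ nat (k mod 4)"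

lemma sigma_pow_0: "sigma_pow 0 x = x"
  by (simp add: sigma_pow_def)

lemma sigma_pow_add_1: "sigma_pow (k + 1) x = sigma (sigma_pow k x)"
proof -
  have "k mod 4 = 0 \<or> k mod 4 = 1 \<or> k mod 4 = 2 \<or> k mod 4 = 3" by presburger
  moreover have "(k + 1) mod 4 = (k mod 4 + 1) mod 4" by (simp add: mod_add_left_eq)
  ultimately show ?thesis
    by (cases x) (auto simp: sigma_pow_def numeral_eq_Suc)
qed

fun crease_weight :: "crease \<Rightarrow> int" where
  "crease_weight D = 1"
| "crease_weight U = - 1"

definition weight :: "crease list \<Rightarrow> int" where
  "weight S = sum_list (map crease_weight S)"

definition direction_word :: "crease list \<Rightarrow> letter list" where
  "direction_word S = map (\<lambda>i. sigma_pow (weight (take i S)) La) [0..<Suc (length S)]"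

definition direction_seq :: "(nat \<Rightarrow> crease) \<Rightarrow> nat \<Rightarrow> letter" where
  "direction_seq s i = sigma_pow (weight (map s [0..<i])) La"

fun theta_letter :: "crease list \<Rightarrow> letter \<Rightarrow> letter list" where
  "theta_letter S La = direction_word S"
| "theta_letter S Lb = map sigma (rev (direction_word S))"
| "theta_letter S Lc = map (sigma ^^ 2) (direction_word S)"
| "theta_letter S Ld = map (sigma ^^ 3) (rev (direction_word S))"

definition theta :: "crease list \<Rightarrow> letter list \<Rightarrow> letter list" where
  "theta S u = concat (map (theta_letter S) u)"

lemma theta_commutes: "theta S (map sigma (rev u)) = map sigma (rev (theta S u))"
proof -
  have "sigma (sigma (sigma (sigma x))) = x" for x by (cases x) auto
  then have "theta_letter S (sigma x) = map sigma (rev (theta_letter S x))" for x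
    by (cases x) (simp_all add: numeral_eq_Suc rev_map comp_def)
  then show ?thesis
    by (simp add: theta_def rev_map rev_concat map_concat comp_def)
qed

section \<open>Lattice curves\<close>

fun step :: "letter \<Rightarrow> complex" where
  "step La = 1"
| "step Lb = \<i>"
| "step Lc = - 1"
| "step Ld = - \<i>"

definition displacement :: "letter list \<Rightarrow> complex" where
  "displacement u = sum_list (map step u)"

definition vertex :: "letter list \<Rightarrow> nat \<Rightarrow> complex" where
  "vertex u j = displacement (take j u)"

definition seq_vertex :: "(nat \<Rightarrow> letter) \<Rightarrow> nat \<Rightarrow> complex" where
  "seq_vertex e j = displacement (map e [0..<j])"

definition curve :: "letter list \<Rightarrow> complex set" where
  "curve u = (\<Union>j<length u. closed_segment (vertex u j) (vertex u (Suc j)))"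

definition grid_points :: "complex set" where
  "grid_points = {g. Re g \<in> \<int> \<and> Im g \<in> \<int>}"

definition inf_curve_vertex :: "crease list \<Rightarrow> nat \<Rightarrow> complex" where
  "inf_curve_vertex S = seq_vertex (direction_seq (conv_power_inf S))"

text \<open>A segment is compared as a set, hence independently of the direction of traversal.\<close>

definition self_avoiding :: "crease list \<Rightarrow> bool" where
  "self_avoiding S \<longleftrightarrow>
     inj (\<lambda>j. closed_segment (inf_curve_vertex S j) (inf_curve_vertex S (Suc j)))"

definition planefilling :: "crease list \<Rightarrow> bool" where
  "planefilling S \<longleftrightarrow>
     (\<forall>B>0. \<exists>R>B. \<exists>c. \<forall>g\<in>grid_points \<inter> cball c R. card {j. inf_curve_vertex S j = g} = 2)"

definition boundary_points :: "crease list \<Rightarrow> complex set" where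
  "boundary_points S =
     (let u = theta S [La] in
      {g\<in>grid_points. card {j. j \<le> length u \<and> vertex u j = g} = 1})"

section \<open>The tile\<close>

definition scaling :: "crease list \<Rightarrow> complex" where
  "scaling S = displacement (theta S [La])"

definition tile_approx :: "crease list \<Rightarrow> nat \<Rightarrow> complex set" where
  "tile_approx S n = (\<lambda>x. x / scaling S ^ n) ` curve ((theta S ^^ n) [La, Lb, Lc, Ld])"

definition tile :: "crease list \<Rightarrow> complex set" where
  "tile S = (THE T. hausdorff_limit (tile_approx S) T)"

end

theory Submission
  imports Defs "HOL-Real_Asymp.Real_Asymp"
begin

text \<open>
  Why the formula holds. Orient the unit segments of the grid like a checkerboard: horizontal
  segments start at points with even coordinate sum, vertical ones at points with odd sum. A
  folding curve follows this orientation, and for symmetric \<open>S\<close> the folding morphism becomes a map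
  on oriented segments (arcs): an arc \<open>e\<close> is replaced by \<open>m\<close> arcs forming a copy of the
  path of \<open>\<theta>(a)\<close>, turned into the direction of \<open>e\<close> and starting at \<open>z\<close> times the start of \<open>e\<close>.
  Self-avoidance and planefilling of the infinite curve transfer by translation to the whole grid:
  every arc of the grid lies in the image of exactly one arc (\<open>bij_betw_child\<close>). Counting arcs in
  large discs then gives \<open>\<bar>z\<bar>\<^sup>2 = m\<close> (\<open>norm_z\<close>).

  The frontier is controlled by corners: pairs of arcs \<open>e\<close>, \<open>turn t e\<close> which are consecutive around
  a unit face. A corner is a side of a set of arcs if exactly one of its two arcs belongs to the set.
  The key point is planar: two arcs whose images meet at a corner are themselves the two arcs
  of a corner (\<open>adjacent_parents\<close>). Hence the sides of the image of a set \<open>A\<close> are the disjoint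
  union, over the sides of \<open>A\<close>, of the corners between the images of the two arcs. Their number
  is \<open>r/2\<close> for each corner (\<open>card_child_corners\<close>): each vertex of the path that is visited only once
  and is passed with a turn to the other side contributes one, the common end point one more, and
  the reflection of the palindromic path exchanges left and right turns.

  The planar statement is proved with winding numbers of closed sets of arcs. Such a winding number
  jumps by one across each arc of the set and nowhere else, so it is constant along the image of an arc
  that is wholly inside or wholly outside the set; on the images of faces it behaves like
  the winding number of the boundary of a single face (\<open>face_parent\<close>). That opposite sides of a face
  have no touching images follows by cutting the boundary of the face at the touching point and
  comparing with the situation rotated by a quarter turn (\<open>children_no_opposite_corner\<close>).

  After \<open>n\<close> steps the four arcs around a face have \<open>8 (r/2)^n\<close> sides. Scaled by \<open>z^(-n)\<close>, the
  frontier of the tile lies within a constant times \<open>\<bar>z\<bar>^(-n)\<close> of these sides and comes that close to each of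
  them (\<open>frontier_near_side\<close>, \<open>side_near_frontier\<close>); the second fact uses that large images contain
  discs, because \<open>r/2 < m\<close>. Covering by balls around the sides bounds the dimension from above by
  \<open>ln (r/2) / ln \<bar>z\<bar>\<close>. The same number is a lower bound since a set of diameter \<open>\<bar>z\<bar>^(-k)\<close> is close
  only to boundedly many sides of step \<open>k\<close>, hence to at most a constant times \<open>(r/2)^(n-k)\<close> sides of step \<open>n\<close>
  (\<open>hausdorff_measure_0_imp_dim_le\<close>).
\<close>


section \<open>Arcs of the oriented square grid\<close>

definition units :: "complex set" where
  "units = {1, \<i>, - 1, - \<i>}"

definition even_point :: "complex \<Rightarrow> bool" where
  "even_point p \<longleftrightarrow> even (\<lfloor>Re p\<rfloor> + \<lfloor>Im p\<rfloor>)"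

type_synonym arc = "complex \<times> complex"

text \<open>
  The checkerboard orientation: each unit segment of the grid underlies exactly one arc
  \<open>(p, d)\<close> from \<open>p\<close> to \<open>p + d\<close>, the four arcs of a unit
  face run around it in one sense, and a path that makes a quarter turn at every vertex never
  leaves this set of arcs.
\<close>

definition arcs :: "arc set" where
  "arcs = {(p, d). p \<in> grid_points \<and> d \<in> units \<and> (even_point p \<longleftrightarrow> d \<in> {1, - 1})}"

definition head :: "arc \<Rightarrow> complex" where
  "head e = fst e + snd e"

text \<open>
  The arc that follows \<open>e\<close> after the turn \<open>t\<close>, where \<open>t =
  \<i>\<close> is a left and \<open>t = - \<i>\<close> a right turn.
\<close>

definition turn :: "complex \<Rightarrow> arc \<Rightarrow> arc" where
  "turn t e = (head e, t * snd e)"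

text \<open>
  The centre of the unit face on the left (\<open>t = \<i>\<close>) or right (\<open>t = -
  \<i>\<close>) of \<open>e\<close>; the turn \<open>t\<close> keeps to the boundary of this
  face.
\<close>

definition face :: "complex \<Rightarrow> arc \<Rightarrow> complex" where
  "face t e = fst e + snd e * (1 + t) / 2"

definition quarter_turns :: "complex set" where
  "quarter_turns = {\<i>, - \<i>}"

lemma grid_point_cases:
  assumes "p \<in> grid_points"
  obtains a b :: int where "p = Complex (of_int a) (of_int b)"
  using assms by (metis (no_types, lifting) Ints_cases complex.collapse grid_points_def mem_Collect_eq)

lemma Complex_in_grid [simp]: "Complex (of_int a) (of_int b) \<in> grid_points"
  by (simp add: grid_points_def)

lemma even_point_Complex [simp]: "even_point (Complex (of_int a) (of_int b)) \<longleftrightarrow> even (a + b)"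
  by (simp add: even_point_def)

lemma grid_0 [simp]: "0 \<in> grid_points" and grid_1 [simp]: "1 \<in> grid_points"
  and grid_i [simp]: "\<i> \<in> grid_points"
  by (auto simp: grid_points_def)

lemma grid_add [simp, intro]: "p \<in> grid_points \<Longrightarrow> q \<in> grid_points \<Longrightarrow> p + q \<in> grid_points"
  and grid_diff [simp, intro]: "p \<in> grid_points \<Longrightarrow> q \<in> grid_points \<Longrightarrow> p - q \<in> grid_points"
  and grid_minus [simp, intro]: "p \<in> grid_points \<Longrightarrow> - p \<in> grid_points"
  and grid_mult [simp, intro]: "p \<in> grid_points \<Longrightarrow> q \<in> grid_points \<Longrightarrow> p * q \<in> grid_points"
  by (auto simp: grid_points_def)

lemma grid_sum [intro]: "(\<And>x. x \<in> X \<Longrightarrow> f x \<in> grid_points) \<Longrightarrow> sum f X \<in> grid_points"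
  by (induction X rule: infinite_finite_induct) auto

lemma grid_of_int [simp]: "of_int k \<in> grid_points"
  by (auto simp: grid_points_def)

lemma units_grid: "d \<in> units \<Longrightarrow> d \<in> grid_points"
  by (auto simp: units_def)

lemma units_mult: "c \<in> units \<Longrightarrow> d \<in> units \<Longrightarrow> c * d \<in> units"
  by (auto simp: units_def)

lemma norm_unit [simp]: "d \<in> units \<Longrightarrow> cmod d = 1"
  by (auto simp: units_def)

lemma unit_nonzero: "d \<in> units \<Longrightarrow> d \<noteq> 0"
  by (auto simp: units_def)

lemma even_point_add:
  assumes "p \<in> grid_points" "q \<in> grid_points"
  shows "even_point (p + q) \<longleftrightarrow> (even_point p \<longleftrightarrow> even_point q)"
proof -
  obtain a b c d :: int where "p = Complex a b" "q = Complex c d"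
    using assms by (metis grid_point_cases)
  then have "p + q = Complex (of_int (a + c)) (of_int (b + d))" by (simp add: complex_eq_iff)
  then show ?thesis using \<open>p = _\<close> \<open>q = _\<close> by (simp only: even_point_Complex) auto
qed

lemma even_point_mult:
  assumes "p \<in> grid_points" "q \<in> grid_points"
  shows "even_point (p * q) \<longleftrightarrow> even_point p \<or> even_point q"
proof -
  obtain a b c d :: int where "p = Complex a b" "q = Complex c d"
    using assms by (metis grid_point_cases)
  then have "p * q = Complex (of_int (a * c - b * d)) (of_int (a * d + b * c))"
    by (simp add: complex_eq_iff)
  then show ?thesis using \<open>p = _\<close> \<open>q = _\<close> by (simp only: even_point_Complex) auto
qed

lemma even_point_unit: "d \<in> units \<Longrightarrow> \<not> even_point d"
proof -
  have "\<lfloor>- 1 :: real\<rfloor> = - 1" using floor_of_int[of "- 1"] by simp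
  then show "d \<in> units \<Longrightarrow> \<not> even_point d" by (auto simp: units_def even_point_def)
qed

lemma even_point_minus: "p \<in> grid_points \<Longrightarrow> even_point (- p) \<longleftrightarrow> even_point p"
  using even_point_mult[of "- 1" p] even_point_unit[of "- 1"] by (simp add: units_def)

lemma even_point_0 [simp]: "even_point 0"
  by (simp add: even_point_def)

lemma arcsD:
  assumes "e \<in> arcs"
  shows "fst e \<in> grid_points" "snd e \<in> units" "snd e \<noteq> 0" "cmod (snd e) = 1"
    "even_point (fst e) \<longleftrightarrow> snd e \<in> {1, - 1}"
  using assms unit_nonzero norm_unit by (auto simp: arcs_def)

lemma quarter_turn_square: "t \<in> quarter_turns \<Longrightarrow> t * t = - 1"
  and quarter_turn_minus: "t \<in> quarter_turns \<Longrightarrow> - t \<in> quarter_turns"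
  and quarter_turn_unit: "t \<in> quarter_turns \<Longrightarrow> t \<in> units"
  and quarter_turn_nonzero: "t \<in> quarter_turns \<Longrightarrow> t \<noteq> 0"
  by (auto simp: quarter_turns_def units_def)

lemma quarter_turn_twice: "t \<in> quarter_turns \<Longrightarrow> t * (t * x) = - x"
  using quarter_turn_square by (metis mult.assoc mult_minus1)

lemma head_grid: "e \<in> arcs \<Longrightarrow> head e \<in> grid_points"
  using arcsD(1,2)[of e] units_grid by (auto simp: head_def)

lemma even_point_head:
  "e \<in> arcs \<Longrightarrow> even_point (head e) \<longleftrightarrow> \<not> even_point (fst e)"
  using arcsD(1,2)[of e] units_grid even_point_unit by (auto simp: head_def even_point_add)

lemma turn_arc:
  assumes "e \<in> arcs" "t \<in> quarter_turns"
  shows "turn t e \<in> arcs"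
proof -
  have "snd e \<in> units" "even_point (fst e) \<longleftrightarrow> snd e \<in> {1, - 1}" using arcsD[OF assms(1)] by auto
  moreover have "head e \<in> grid_points" "even_point (head e) \<longleftrightarrow> \<not> even_point (fst e)"
    using assms head_grid even_point_head by auto
  moreover have "t * snd e \<in> units" using assms arcsD(2) units_mult quarter_turn_unit by blast
  moreover have "t * snd e \<in> {1, - 1} \<longleftrightarrow> snd e \<notin> {1, - 1}"
    using \<open>snd e \<in> units\<close> assms(2) by (auto simp: units_def quarter_turns_def complex_eq_iff)
  ultimately show ?thesis by (auto simp: turn_def arcs_def)
qed

lemma turn_inj: "t \<noteq> 0 \<Longrightarrow> turn t e = turn t e' \<Longrightarrow> e = e'"
  by (auto simp: turn_def head_def prod_eq_iff)

lemma turn4: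
  assumes "t \<in> quarter_turns"
  shows "turn t (turn t (turn t (turn t e))) = e"
proof -
  note t2 = quarter_turn_twice[OF assms]
  show ?thesis by (simp add: turn_def head_def prod_eq_iff t2)
qed

lemma face_turn:
  assumes "t \<in> quarter_turns"
  shows "face t (turn t e) = face t e"
proof -
  note t2 = quarter_turn_twice[OF assms]
  show ?thesis by (simp add: turn_def head_def face_def field_simps t2)
qed

lemma face_eq_cases:
  assumes "e \<in> arcs" "e' \<in> arcs" "t \<in> quarter_turns" "face t e = face t e'"
  shows "e' \<in> {e, turn t e, turn t (turn t e), turn t (turn t (turn t e))}"
proof -
  obtain p d q f where e: "e = (p, d)" "e' = (q, f)" by fastforce
  have u: "d \<in> units" "f \<in> units" using assms arcsD(2) e by auto
  have q: "q = p + d * (1 + t) / 2 - f * (1 + t) / 2"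
    using assms(4) e by (simp add: face_def algebra_simps)
  note t2' = quarter_turn_twice[OF assms(3)]
  consider "f = d" | "f = t * d" | "f = - d" | "f = - t * d"
    using u assms(3) by (auto simp: units_def quarter_turns_def)
  then show ?thesis
  proof cases
    case 1
    then have "e' = e" using q e by simp
    then show ?thesis by simp
  next
    case 2
    then have "4 * q = 4 * (p + d)" using q by (simp add: field_simps t2')
    then have "q = p + d" by (simp only: mult_cancel_left) simp
    then have "e' = turn t e" using 2 e by (simp add: turn_def head_def)
    then show ?thesis by simp
  next
    case 3
    then have "4 * q = 4 * (p + d + t * d)" using q by (simp add: field_simps t2')
    then have "q = p + d + t * d" by (simp only: mult_cancel_left) simp
    then have "e' = turn t (turn t e)" using 3 e by (simp add: turn_def head_def t2')
    then show ?thesis by simp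
  next
    case 4
    then have "4 * q = 4 * (p + t * d)" using q by (simp add: field_simps t2')
    then have "q = p + t * d" by (simp only: mult_cancel_left) simp
    then have "e' = turn t (turn t (turn t e))" using 4 e by (simp add: turn_def head_def t2')
    then show ?thesis by simp
  qed
qed

lemma unit_distinct: "\<i> \<noteq> - \<i>" "- \<i> \<noteq> \<i>" "(1::complex) \<noteq> - 1" "(- 1::complex) \<noteq> 1"
  "\<i> \<noteq> - 1" "- \<i> \<noteq> 1" "1 \<noteq> \<i>" "- 1 \<noteq> \<i>" "1 \<noteq> - \<i>" "- \<i> \<noteq> - 1" "- 1 \<noteq> - \<i>"
  by (auto simp: complex_eq_iff)

lemma units_perpendicular:
  assumes "d \<in> units" "f \<in> units" "f \<in> {1, - 1} \<longleftrightarrow> d \<notin> {1, - 1}"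
  shows "f = \<i> * d \<or> f = - \<i> * d"
  using assms unfolding units_def by (elim insertE emptyE) (simp_all add: unit_distinct)

lemma successor_arc:
  assumes "e \<in> arcs" "e' \<in> arcs" "head e = fst e'"
  shows "e' = turn \<i> e \<or> e' = turn (- \<i>) e"
proof -
  obtain p d q f where e: "e = (p, d)" "e' = (q, f)" by fastforce
  have "q = p + d" using assms e by (simp add: head_def)
  moreover have "even_point q \<longleftrightarrow> \<not> even_point p" using assms e even_point_head[of e] by simp
  ultimately have "f = \<i> * d \<or> f = - \<i> * d"
    using arcsD(2,5)[OF assms(1)] arcsD(2,5)[OF assms(2)] e by (intro units_perpendicular) auto
  then show ?thesis using e \<open>q = p + d\<close> by (auto simp: turn_def head_def)
qed

section \<open>Winding numbers of cyclic sets of arcs\<close>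

definition arc_flux :: "(complex \<Rightarrow> int) \<Rightarrow> arc set \<Rightarrow> int" where
  "arc_flux h C = (\<Sum>e\<in>C. h (head e) - h (fst e))"

text \<open>
  Closedness expressed through potentials: for a closed path the sum telescopes to 0. Unlike a
  path, a set closed in this sense needs no ordering of its arcs, and fluxes of disjoint pieces
  simply add up.
\<close>

definition cyclic :: "arc set \<Rightarrow> bool" where
  "cyclic C \<longleftrightarrow> finite C \<and> C \<subseteq> arcs \<and> (\<forall>h. arc_flux h C = 0)"

text \<open>
  The signed crossing of the horizontal ray from \<open>c\<close> to the right with the arc;
  upward arcs count 1.
\<close>

definition ray_crossing :: "complex \<Rightarrow> arc \<Rightarrow> int" where
  "ray_crossing c e =
     (if Re (fst e) > Re c \<and> snd e = \<i> \<and> Im (fst e) < Im c \<and> Im c < Im (fst e) + 1 then 1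
      else if Re (fst e) > Re c \<and> snd e = - \<i> \<and> Im (fst e) - 1 < Im c \<and> Im c < Im (fst e) then - 1
      else 0)"

definition winding :: "arc set \<Rightarrow> complex \<Rightarrow> int" where
  "winding C c = (\<Sum>e\<in>C. ray_crossing c e)"

text \<open>
  Face centres in integer coordinates. The constant stays folded, so that the computation below
  takes place in the integers.
\<close>

definition cell :: "int \<Rightarrow> int \<Rightarrow> complex" where
  "cell x y = Complex (of_int x + 1 / 2) (of_int y + 1 / 2)"

lemma ray_crossing_int:
  "ray_crossing (cell x y) (Complex (of_int u) (of_int v), d) =
     (if u > x \<and> d = \<i> \<and> v = y then 1 else if u > x \<and> d = - \<i> \<and> v = y + 1 then - 1 else 0)"
proof -
  have "real_of_int x + 1 / 2 < real_of_int u \<longleftrightarrow> x < u" by linarith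
  moreover have "real_of_int v < real_of_int y + 1 / 2 \<and> real_of_int y + 1/2 < real_of_int v + 1 \<longleftrightarrow> v = y"
    by linarith
  moreover have "real_of_int v - 1 < real_of_int y + 1 / 2 \<and> real_of_int y + 1/2 < real_of_int v \<longleftrightarrow> v = y + 1"
    by linarith
  ultimately show ?thesis by (simp add: ray_crossing_def cell_def)
qed

lemma face_int:
  "face \<i> (Complex (of_int x) (of_int y), 1) = cell x y"
  "face (- \<i>) (Complex (of_int x) (of_int y), 1) = cell x (y - 1)"
  "face \<i> (Complex (of_int x) (of_int y), \<i>) = cell (x - 1) y"
  "face (- \<i>) (Complex (of_int x) (of_int y), \<i>) = cell x y"
  "face \<i> (Complex (of_int x) (of_int y), - 1) = cell (x - 1) (y - 1)"
  "face (- \<i>) (Complex (of_int x) (of_int y), - 1) = cell (x - 1) y"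
  "face \<i> (Complex (of_int x) (of_int y), - \<i>) = cell x (y - 1)"
  "face (- \<i>) (Complex (of_int x) (of_int y), - \<i>) = cell (x - 1) (y - 1)"
  by (simp_all add: face_def cell_def complex_eq_iff)

text \<open>
  The rays from the two faces next to a vertical arc \<open>e\<close> differ by a single unit
  segment, which only \<open>e\<close> itself can traverse: the reversed segment is not an arc.
  For horizontal \<open>e\<close> the rays run in adjacent rows. The difference of the crossings
  is then, up to the contribution of \<open>e\<close>, the flux of the potential that indicates
  the half line between the two rays, and this flux is 0.
\<close>

lemma winding_jump:
  assumes "cyclic C" "e \<in> arcs"
  shows "winding C (face \<i> e) - winding C (face (- \<i>) e) = of_bool (e \<in> C)"
proof -
  have fin: "finite C" and sub: "C \<subseteq> arcs" and flux: "arc_flux h C = 0" for h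
    using assms by (auto simp: cyclic_def)
  obtain q f where e: "e = (q, f)" by fastforce
  obtain x y :: int where q: "q = Complex x y" using arcsD(1)[OF assms(2)] e grid_point_cases by auto
  have par: "even (x + y) \<longleftrightarrow> f \<in> {1, - 1}" using arcsD(5)[OF assms(2)] e q by simp
  have f: "f \<in> units" using arcsD(2)[OF assms(2)] e by simp
  \<comment> \<open>For horizontal \<open>e\<close>, the half line to the right of \<open>e\<close>; its left end is chosen
    such that \<open>e\<close> itself enters or leaves it, with the sign opposite to \<open>g\<close>.\<close>
  define h :: "complex \<Rightarrow> int" where
    "h p = (if f = 1 then of_bool (Im p = y \<and> Re p > x)
            else if f = - 1 then of_bool (Im p = y \<and> Re p \<ge> x) else 0)" for p
  define g :: int where "g = (if f = - 1 then 1 else - 1)"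
  have "ray_crossing (face \<i> e) a - ray_crossing (face (- \<i>) e) a
      = of_bool (a = e) + g * (h (head a) - h (fst a))" if "a \<in> C" for a
  proof -
    have a: "a \<in> arcs" using that sub by auto
    obtain p d where a': "a = (p, d)" by fastforce
    obtain u v :: int where p: "p = Complex u v" using arcsD(1)[OF a] a' grid_point_cases by auto
    have par': "even (u + v) \<longleftrightarrow> d \<in> {1, - 1}" using arcsD(5)[OF a] a' p by simp
    have d: "d \<in> units" using arcsD(2)[OF a] a' by simp
    have cmp: "real_of_int x < real_of_int u + 1 \<longleftrightarrow> x < u + 1"
      "real_of_int x \<le> real_of_int u + 1 \<longleftrightarrow> x \<le> u + 1"
      "real_of_int x < real_of_int u - 1 \<longleftrightarrow> x < u - 1"
      "real_of_int x \<le> real_of_int u - 1 \<longleftrightarrow> x \<le> u - 1"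
      "real_of_int v + 1 = real_of_int y \<longleftrightarrow> v + 1 = y"
      "real_of_int v - 1 = real_of_int y \<longleftrightarrow> v - 1 = y" by linarith+
    note simps = e q a' p g_def h_def face_int ray_crossing_int head_def unit_distinct
    from f d par par' show ?thesis
      unfolding units_def
      by (elim insertE emptyE; simp add: simps cmp; (auto simp: of_bool_def; presburger?)?)
  qed
  then have "winding C (face \<i> e) - winding C (face (- \<i>) e)
      = (\<Sum>a\<in>C. of_bool (a = e) + g * (h (head a) - h (fst a)))"
    by (simp add: winding_def flip: sum_subtractf)
  also have "\<dots> = (\<Sum>a\<in>C. of_bool (a = e))"
    using flux[of h] unfolding arc_flux_def by (simp add: sum.distrib flip: sum_distrib_left)
  also have "\<dots> = of_bool (e \<in> C)" using fin by (simp add: of_bool_def sum.delta)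
  finally show ?thesis .
qed

lemma winding_far:
  assumes "\<And>e. e \<in> C \<Longrightarrow> \<bar>Im (fst e)\<bar> + 1 \<le> \<bar>Im c\<bar>"
  shows "winding C c = 0"
proof -
  have "ray_crossing c e = 0" if "e \<in> C" for e
    using assms[OF that] by (auto simp: ray_crossing_def)
  then show ?thesis by (simp add: winding_def)
qed

definition orientation :: "complex \<Rightarrow> int" where
  "orientation t = (if t = \<i> then 1 else - 1)"

lemma winding_jump':
  assumes "cyclic C" "e \<in> arcs" "t \<in> quarter_turns"
  shows "winding C (face t e) = winding C (face (- t) e) + orientation t * of_bool (e \<in> C)"
  using winding_jump[OF assms(1,2)] assms(3)
  by (auto simp: quarter_turns_def orientation_def unit_distinct)

lemma arc_flux_union:
  assumes "finite A" "finite B" "A \<inter> B = {}"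
  shows "arc_flux h (A \<union> B) = arc_flux h A + arc_flux h B"
  unfolding arc_flux_def by (rule sum.union_disjoint[OF assms])

section \<open>Replacing arcs by copies of a palindromic path\<close>

definition turtle :: "(nat \<Rightarrow> complex) \<Rightarrow> nat \<Rightarrow> complex" where
  "turtle \<delta> j = (\<Sum>l<j. \<delta> l)"

text \<open>
  Arc number \<open>j\<close> of the path that replaces \<open>e\<close>: the grid is first
  multiplied by the end point of the path, which makes \<open>e\<close> a segment as long as the
  chord of the path, and the path is then turned into the direction of \<open>e\<close>.
\<close>

definition child :: "(nat \<Rightarrow> complex) \<Rightarrow> nat \<Rightarrow> arc \<Rightarrow> nat \<Rightarrow> arc" where
  "child \<delta> m e j = (turtle \<delta> m * fst e + snd e * turtle \<delta> j, snd e * \<delta> j)"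

definition spin :: "complex \<Rightarrow> complex \<Rightarrow> arc \<Rightarrow> arc" where
  "spin t c a = (t * fst a + (1 - t) * c, t * snd a)"

lemma spin_turn: "turn t (spin t c a) = spin t c (turn t a)"
  by (simp add: spin_def turn_def head_def algebra_simps)

lemma face_spin: "face t (spin t c a) = t * face t a + (1 - t) * c"
  by (simp add: spin_def face_def field_simps)

lemma spin_inj: "t \<noteq> 0 \<Longrightarrow> spin t c a = spin t c b \<longleftrightarrow> a = b"
  by (auto simp: spin_def prod_eq_iff)

text \<open>
  The path of \<open>\<theta>(a)\<close> for a symmetric string: quarter turns at all inner
  vertices, and the same sequence of directions in both senses, so that the path is centrally
  symmetric.
\<close>

locale folding_path =
  fixes m :: nat and \<delta> :: "nat \<Rightarrow> complex"
  assumes two_le: "2 \<le> m"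
    and first_dir: "\<delta> 0 = 1"
    and dir_turn: "\<And>j. Suc j < m \<Longrightarrow> \<delta> (Suc j) = \<i> * \<delta> j \<or> \<delta> (Suc j) = - \<i> * \<delta> j"
    and palindrome: "\<And>j. j < m \<Longrightarrow> \<delta> (m - 1 - j) = \<delta> j"
begin

abbreviation "v \<equiv> turtle \<delta>"
abbreviation "z \<equiv> turtle \<delta> m"
abbreviation "ch \<equiv> child \<delta> m"

definition children :: "arc \<Rightarrow> arc set" where
  "children e = ch e ` {..<m}"

definition pt :: "arc \<Rightarrow> nat \<Rightarrow> complex" where
  "pt e j = z * fst e + snd e * v j"

lemma m_pos [simp]: "0 < m" using two_le by simp

lemma dir_unit: "j < m \<Longrightarrow> \<delta> j \<in> units"
proof (induction j)
  case 0
  then show ?case by (simp add: first_dir units_def)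
next
  case (Suc j)
  then have "\<delta> j \<in> units" by simp
  then show ?case using dir_turn[OF Suc.prems] by (auto simp: units_def)
qed

lemma last_dir: "\<delta> (m - Suc 0) = 1"
  using palindrome[of 0] first_dir by simp

lemma v_0 [simp]: "v 0 = 0" and v_Suc: "v (Suc j) = v j + \<delta> j"
  by (simp_all add: turtle_def)

lemma v_grid: "j \<le> m \<Longrightarrow> v j \<in> grid_points"
  unfolding turtle_def by (intro grid_sum units_grid dir_unit) auto

lemma even_point_v: "j \<le> m \<Longrightarrow> even_point (v j) \<longleftrightarrow> even j"
proof (induction j)
  case (Suc j)
  then have "even_point (v j) \<longleftrightarrow> even j" "v j \<in> grid_points" "\<delta> j \<in> units"
    using v_grid dir_unit by auto
  then show ?case by (simp add: v_Suc even_point_add units_grid even_point_unit)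
qed simp

text \<open>
  A palindrome of even length would repeat its middle letter, but every step turns.
\<close>

lemma odd_m: "odd m"
proof
  assume "even m"
  then obtain k where k: "m = 2 * k" by auto
  then obtain l where l: "k = Suc l" using two_le by (cases k) auto
  have "\<delta> (Suc l) = \<delta> l" using palindrome[of l] k l by simp
  moreover have "\<delta> l \<in> units" using dir_unit[of l] k l by simp
  ultimately show False using dir_turn[of l] k l unfolding units_def
    by (elim insertE emptyE) (simp_all add: unit_distinct)
qed

lemma z_grid: "z \<in> grid_points" and z_odd: "\<not> even_point z"
  using v_grid even_point_v odd_m by auto

lemma z_nonzero: "z \<noteq> 0"
  using z_odd by auto

lemma fst_ch: "fst (ch e j) = pt e j" and snd_ch: "snd (ch e j) = snd e * \<delta> j"
  and head_ch: "head (ch e j) = pt e (Suc j)"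
  by (simp_all add: child_def pt_def head_def v_Suc algebra_simps)

lemma pt_0 [simp]: "pt e 0 = z * fst e" and pt_m [simp]: "pt e m = z * head e"
  by (simp_all add: pt_def head_def algebra_simps)

lemma ch_step:
  assumes "Suc j < m" "t \<in> quarter_turns"
  shows "ch e (Suc j) = turn t (ch e j) \<or> ch e (Suc j) = turn (- t) (ch e j)"
proof -
  have "\<delta> (Suc j) = t * \<delta> j \<or> \<delta> (Suc j) = - t * \<delta> j"
    using dir_turn[OF assms(1)] assms(2) by (auto simp: quarter_turns_def)
  then show ?thesis by (auto simp: turn_def prod_eq_iff fst_ch snd_ch head_ch)
qed

text \<open>
  The replacing paths begin and end in the direction of the replaced arc. Hence consecutive arcs
  with turn \<open>t\<close> are replaced by paths that are joined by the same turn.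
\<close>

lemma ch_join: "turn t (ch e (m - Suc 0)) = ch (turn t e) 0"
  using last_dir by (simp add: turn_def prod_eq_iff fst_ch snd_ch head_ch first_dir)

lemma ch_arc:
  assumes "e \<in> arcs"
  shows "j < m \<Longrightarrow> ch e j \<in> arcs"
proof (induction j)
  case 0
  have "even_point (z * fst e) \<longleftrightarrow> even_point (fst e)" "z * fst e \<in> grid_points"
    using even_point_mult z_grid z_odd arcsD(1)[OF assms] by auto
  then show ?case using arcsD(2,5)[OF assms] by (auto simp: child_def first_dir arcs_def)
next
  case (Suc j)
  have i: "\<i> \<in> quarter_turns" "- \<i> \<in> quarter_turns" by (auto simp: quarter_turns_def)
  have "ch e j \<in> arcs" using Suc by simp
  then show ?case using ch_step[OF Suc.prems i(1), of e] turn_arc i by metis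
qed

text \<open>
  The vertices of the path that are visited only once, given by their index; for
  \<open>\<theta>(a)\<close> these are the boundary points.
\<close>

definition simple_vertices :: "nat set" where
  "simple_vertices = {j. j \<le> m \<and> (\<forall>k\<le>m. v k = v j \<longrightarrow> k = j)}"

end

text \<open>
  Bijectivity says that the images of all arcs of the grid, taken together, traverse each arc of
  the grid exactly once.
\<close>

locale grid_substitution = folding_path +
  assumes child_bij: "bij_betw (\<lambda>(e, j). child \<delta> m e j) (arcs \<times> {..<m}) arcs"
begin

lemma ch_inj:
  assumes "ch e j = ch e' j'" "e \<in> arcs" "e' \<in> arcs" "j < m" "j' < m"
  shows "e = e' \<and> j = j'"
  using bij_betw_imp_inj_on[OF child_bij] assms unfolding inj_on_def by fastforce

lemma ch_surj:
  assumes "a \<in> arcs"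
  obtains e j where "e \<in> arcs" "j < m" "a = ch e j"
  using bij_betw_imp_surj_on[OF child_bij] assms by force

text \<open>
  The images of the four arcs around a face are rotated copies of each other about the scaled
  centre of that face.
\<close>

lemma ch_turn_spin:
  assumes "t \<in> quarter_turns"
  shows "ch (turn t e) j = spin t (z * face t e) (ch e j)"
proof -
  note t2 = quarter_turn_twice[OF assms]
  show ?thesis
    by (simp add: child_def turn_def head_def spin_def face_def field_simps t2)
qed

lemma children_arcs: "e \<in> arcs \<Longrightarrow> children e \<subseteq> arcs"
  using ch_arc by (simp add: children_def image_subset_iff)

lemma children_disjoint:
  "e \<in> arcs \<Longrightarrow> e' \<in> arcs \<Longrightarrow> e \<noteq> e' \<Longrightarrow> children e \<inter> children e' = {}"
  using ch_inj unfolding children_def by blast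

lemma ch_mem_children: "e \<in> arcs \<Longrightarrow> e' \<in> arcs \<Longrightarrow> j < m \<Longrightarrow> ch e j \<in> children e' \<longleftrightarrow> e = e'"
  using ch_inj unfolding children_def by blast

lemma finite_children [simp]: "finite (children e)"
  by (simp add: children_def)

lemma arc_flux_ch:
  assumes "e \<in> arcs" "i \<le> k" "k \<le> m"
  shows "arc_flux h (ch e ` {i..<k}) = h (pt e k) - h (pt e i)"
proof -
  have "inj_on (ch e) {i..<k}" using assms ch_inj[of e _ e]
    by (intro inj_onI) (metis atLeastLessThan_iff order_less_le_trans)
  then have "arc_flux h (ch e ` {i..<k}) = (\<Sum>j\<in>{i..<k}. h (pt e (Suc j)) - h (pt e j))"
    by (simp add: arc_flux_def sum.reindex fst_ch head_ch)
  then show ?thesis using sum_Suc_diff'[of i k "\<lambda>j. h (pt e j)"] assms by simp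
qed

lemma arc_flux_children: "e \<in> arcs \<Longrightarrow> arc_flux h (children e) = h (z * head e) - h (z * fst e)"
  using arc_flux_ch[of e 0 m h] by (simp add: children_def atLeast0LessThan)

text \<open>
  Consecutive arcs of the path have a face in common: the one on side \<open>t\<close>, or the
  one on side \<open>- t\<close>. In the latter case the winding number makes the same jump at
  both arcs, since both or neither belong to \<open>C\<close>.
\<close>

lemma winding_along:
  assumes C: "cyclic C" and e: "e \<in> arcs" and t: "t \<in> quarter_turns"
    and "i \<le> k" "k < m"
    and mem: "\<And>j. i \<le> j \<Longrightarrow> j \<le> k \<Longrightarrow> ch e j \<in> C \<longleftrightarrow> b"
  shows "winding C (face t (ch e k)) = winding C (face t (ch e i))"
  using \<open>i \<le> k\<close> \<open>k < m\<close> mem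
proof (induction k rule: dec_induct)
  case (step k)
  let ?a = "ch e k" and ?b = "ch e (Suc k)"
  have arcs: "?a \<in> arcs" "?b \<in> arcs" using e ch_arc step.prems(1) by auto
  have "?b \<in> C \<longleftrightarrow> ?a \<in> C" using step.prems(2)[of k] step.prems(2)[of "Suc k"] step.hyps by auto
  moreover have "face t ?b = face t ?a \<or> face (- t) ?b = face (- t) ?a"
    using ch_step[OF step.prems(1) t, of e] face_turn t quarter_turn_minus by metis
  ultimately have "winding C (face t ?b) = winding C (face t ?a)"
    using winding_jump'[OF C arcs(1) t] winding_jump'[OF C arcs(2) t] by auto
  then show ?case using step by simp
qed simp

lemma face_join:
  assumes "t \<in> quarter_turns"
  shows "face t (ch (turn t e) 0) = face t (ch e (m - Suc 0))"
  using ch_join face_turn[OF assms] by metis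

end

section \<open>Only neighbouring arcs have touching images\<close>

context grid_substitution begin

lemma exists_arc: "(0, 1) \<in> arcs"
  by (simp add: arcs_def units_def)

lemma turn_neq:
  assumes "e \<in> arcs" "t \<in> quarter_turns"
  shows "turn t e \<noteq> e" "turn t (turn t e) \<noteq> e" "turn t (turn t (turn t e)) \<noteq> e"
proof -
  have "snd e \<in> units" using arcsD(2)[OF assms(1)] .
  then have "t * snd e \<noteq> snd e \<and> t * (t * snd e) \<noteq> snd e \<and> t * (t * (t * snd e)) \<noteq> snd e"
    using assms(2) unfolding units_def quarter_turns_def
    by (elim insertE emptyE) (simp_all add: unit_distinct)
  then show "turn t e \<noteq> e" "turn t (turn t e) \<noteq> e" "turn t (turn t (turn t e)) \<noteq> e"
    by (auto simp: turn_def prod_eq_iff)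
qed

text \<open>
  Let \<open>C\<close> be the image of the boundary of the face of \<open>e\<close> on side
  \<open>t\<close>. Its winding number \<open>W s g\<close>, read on side \<open>s\<close> along
  the image of an arc \<open>g\<close>, depends neither on the arc of the image nor on the
  choice of \<open>g\<close> among the four arcs of a face on side \<open>s\<close>. Apart from
  the jump at the boundary of the chosen face it is therefore constant on the whole grid, and it
  vanishes far away. So on side \<open>t\<close> it is nonzero exactly along the images of the
  four arcs of the chosen face, and a common small face forces equal values.
\<close>

lemma face_parent:
  assumes "e \<in> arcs" "e' \<in> arcs" "i < m" "j < m" and t: "t \<in> quarter_turns"
    and eq: "face t (ch e i) = face t (ch e' j)"
  shows "face t e = face t e'"
proof -
  define q where "q = [e, turn t e, turn t (turn t e), turn t (turn t (turn t e))]"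
  define C where "C = (\<Union>g\<in>set q. children g)"
  have q_arcs: "set q \<subseteq> arcs" using assms turn_arc by (simp add: q_def)
  have q_turn: "turn t g \<in> set q \<longleftrightarrow> g \<in> set q" for g
    using turn4[OF t, of g] turn4[OF t, of e] unfolding q_def
    by (simp only: list.set insert_iff empty_iff) metis
  have "distinct q"
    using turn_neq[OF \<open>e \<in> arcs\<close> t] turn_inj[OF quarter_turn_nonzero[OF t], of e]
      turn_inj[OF quarter_turn_nonzero[OF t], of "turn t e"]
    unfolding q_def by (simp only: distinct.simps list.set insert_iff empty_iff) metis
  have cyc: "cyclic C"
    unfolding cyclic_def
  proof (intro conjI allI)
    show "finite C" by (simp add: C_def)
    show "C \<subseteq> arcs" using q_arcs children_arcs by (auto simp: C_def)
    fix h
    have "arc_flux h C = (\<Sum>g\<in>set q. arc_flux h (children g))"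
      unfolding C_def arc_flux_def
      by (intro sum.UNION_disjoint ballI impI) (simp_all, metis q_arcs children_disjoint subset_iff)
    also have "\<dots> = (\<Sum>g\<in>set q. h (z * head g) - h (z * fst g))"
      using q_arcs by (intro sum.cong) (auto simp: arc_flux_children subset_iff)
    also have "\<dots> = (\<Sum>g\<leftarrow>q. h (z * head g) - h (z * fst g))"
      by (rule sum_list_distinct_conv_sum_set[OF \<open>distinct q\<close>, symmetric])
    also have "\<dots> = 0"
    proof -
      have h: "fst (turn t g) = head g" for g by (simp add: turn_def)
      have "fst e = head (turn t (turn t (turn t e)))" using turn4[OF t, of e] h by metis
      then show ?thesis by (simp add: q_def h)
    qed
    finally show "arc_flux h C = 0" .
  qed
  have memC: "ch g l \<in> C \<longleftrightarrow> g \<in> set q" if "g \<in> arcs" "l < m" for g l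
    using that q_arcs ch_mem_children[OF that(1) _ that(2)] unfolding C_def by blast
  define W where "W s g = winding C (face s (ch g 0))" for s g
  have W_along: "winding C (face s (ch g l)) = W s g"
    if "g \<in> arcs" "l < m" "s \<in> quarter_turns" for s g l
    unfolding W_def using winding_along[OF cyc that(1,3), of 0 l "g \<in> set q"] that memC by auto
  have W_turn: "W s (turn s g) = W s g" if "g \<in> arcs" "s \<in> quarter_turns" for s g
    using W_along[of g "m - Suc 0" s] face_join[of s g] that by (simp add: W_def)
  have W_jump: "W t g = W (- t) g + orientation t * of_bool (g \<in> set q)" if "g \<in> arcs" for g
    unfolding W_def using winding_jump'[OF cyc ch_arc[OF that m_pos] t] memC[OF that m_pos] by simp
  \<comment> \<open>Without the jump, both kinds of turns preserve the value; alternating them translates an arc.\<close>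
  have U: "W (- t) (turn t g) = W (- t) g" "W (- t) (turn (- t) g) = W (- t) g" if "g \<in> arcs" for g
    using W_jump[OF that] W_jump[OF turn_arc[OF that t]] W_turn[OF that t] q_turn[of g]
      W_turn[OF that quarter_turn_minus[OF t]] by auto
  note t2 = quarter_turn_twice[OF t]
  have shift: "(fst g + of_nat n * ((1 + t) * snd g), snd g) \<in> arcs \<and>
      W (- t) (fst g + of_nat n * ((1 + t) * snd g), snd g) = W (- t) g" if "g \<in> arcs" for g n
  proof (induction n)
    case 0
    then show ?case using that by simp
  next
    case (Suc n)
    let ?g = "(fst g + of_nat n * ((1 + t) * snd g), snd g)"
    have g: "?g \<in> arcs" "W (- t) ?g = W (- t) g" using Suc by auto
    have "turn (- t) (turn t ?g) = (fst g + of_nat (Suc n) * ((1 + t) * snd g), snd g)"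
      by (simp add: turn_def head_def algebra_simps t2)
    moreover have "W (- t) (turn (- t) (turn t ?g)) = W (- t) g"
      using U(2)[OF turn_arc[OF g(1) t]] U(1)[OF g(1)] g(2) by simp
    moreover have "turn (- t) (turn t ?g) \<in> arcs" using g(1) t turn_arc quarter_turn_minus by blast
    ultimately show ?case by simp
  qed
  have W_0: "W (- t) g = 0" if g: "g \<in> arcs" for g
  proof -
    \<comment> \<open>The translations move diagonally. Since \<open>z\<close> is an odd point, their images are never horizontal,
      so the arc leaves the rows that \<open>C\<close> meets.\<close>
    define b where "b = Im (z * ((1 + t) * snd g))"
    define a where "a = Im (face (- t) (ch g 0))"
    have "snd g \<in> units" using arcsD(2)[OF g] .
    obtain x y :: int where xy: "z = Complex x y" using z_grid grid_point_cases by auto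
    have "odd (x + y)" using z_odd xy by simp
    then have "x + y \<noteq> 0" "x - y \<noteq> 0" by presburger+
    then have "real_of_int x + real_of_int y \<noteq> 0" "real_of_int x - real_of_int y \<noteq> 0"
      by (metis of_int_add of_int_eq_0_iff) (metis \<open>x - y \<noteq> 0\<close> of_int_diff of_int_eq_0_iff)
    then have "real_of_int y - real_of_int x \<noteq> 0" "- real_of_int x - real_of_int y \<noteq> 0" by linarith+
    note nz = this \<open>real_of_int x + real_of_int y \<noteq> 0\<close> \<open>real_of_int x - real_of_int y \<noteq> 0\<close>
    have "b = x + y \<or> b = x - y \<or> b = y - x \<or> b = - x - y"
      using \<open>snd g \<in> units\<close> t unfolding b_def xy units_def quarter_turns_def
      by (elim insertE emptyE) simp_all
    then have b: "b \<noteq> 0" using nz by force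
    have "finite ((\<lambda>e. \<bar>Im (fst e)\<bar>) ` C)" using cyc by (simp add: cyclic_def)
    then obtain B where B: "\<And>e. e \<in> C \<Longrightarrow> \<bar>Im (fst e)\<bar> \<le> B"
      by (meson finite_nat_set_iff_bounded_le bdd_above_finite bdd_above.E image_eqI)
    obtain n where n: "B + 1 + \<bar>a\<bar> < real n * \<bar>b\<bar>"
      using b reals_Archimedean3[of "\<bar>b\<bar>"] by auto
    let ?g = "(fst g + of_nat n * ((1 + t) * snd g), snd g)"
    have "face (- t) (ch ?g 0) = face (- t) (ch g 0) + of_nat n * (z * ((1 + t) * snd g))"
      by (simp add: face_def child_def algebra_simps)
    then have "Im (face (- t) (ch ?g 0)) = a + real n * b"
      by (simp add: a_def b_def)
    moreover have "B + 1 \<le> \<bar>a + real n * b\<bar>"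
      using n abs_mult[of "real n" b] by linarith
    ultimately have "W (- t) ?g = 0"
      unfolding W_def using B by (intro winding_far) fastforce
    then show ?thesis using shift[OF g, of n] by simp
  qed
  have "W t e = W t e'"
    using W_along[of e i t] W_along[of e' j t] assms eq by simp
  moreover have "W t e = orientation t" using W_jump[of e] W_0[of e] assms by (simp add: q_def)
  moreover have "W t e' = orientation t * of_bool (e' \<in> set q)" using W_jump[of e'] W_0[of e'] assms by simp
  ultimately have "e' \<in> set q" by (auto simp: orientation_def split: if_splits)
  then show ?thesis
    unfolding q_def list.set by (elim insertE emptyE) (simp_all add: face_turn[OF t])
qed

text \<open>
  Let \<open>e, b, c, d\<close> be the arcs around a face and suppose that the images of
  \<open>e\<close> and \<open>c\<close> touch inside it. The part of the image of the boundary
  from the touching point through the image of \<open>b\<close> back to the touching point is a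
  closed set of arcs; its winding number on side \<open>t\<close> differs by one between the
  images of \<open>b\<close> and \<open>d\<close>. But a quarter turn about the centre of the
  scaled face takes the touching point of \<open>e\<close> and \<open>c\<close> to one of
  \<open>b\<close> and \<open>d\<close>, where both images see the same small face.
\<close>

lemma children_no_opposite_corner:
  assumes e: "e \<in> arcs" and "i < m" "j < m" and t: "t \<in> quarter_turns"
  shows "turn t (ch e i) \<noteq> ch (turn t (turn t e)) j"
proof
  define b where "b = turn t e"
  define c where "c = turn t b"
  define d where "d = turn t c"
  have td: "turn t d = e" using turn4[OF t, of e] by (simp add: b_def c_def d_def)
  have arcs: "b \<in> arcs" "c \<in> arcs" "d \<in> arcs" using e t turn_arc by (auto simp: b_def c_def d_def)
  have mt: "- t \<in> quarter_turns" using t by (rule quarter_turn_minus)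
  have neq: "b \<noteq> e" "c \<noteq> e" "d \<noteq> e" "c \<noteq> b" "d \<noteq> b" "d \<noteq> c"
    using turn_neq[OF e t] turn_neq[OF arcs(1) t] turn_neq[OF arcs(2) t] by (auto simp: b_def c_def d_def)
  assume "turn t (ch e i) = ch (turn t (turn t e)) j"
  then have touch: "turn t (ch e i) = ch c j" by (simp add: b_def c_def)
  have i: "Suc i < m"
  proof (rule ccontr)
    assume "\<not> Suc i < m"
    then have "i = m - Suc 0" using \<open>i < m\<close> by simp
    then have "ch b 0 = ch c j" using touch ch_join[of t e] by (simp add: b_def)
    then show False using ch_inj[of b 0 c j] arcs neq \<open>j < m\<close> by simp
  qed
  have next_i: "ch e (Suc i) = turn (- t) (ch e i)"
  proof -
    have "ch e (Suc i) \<noteq> turn t (ch e i)"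
      using touch ch_inj[of e "Suc i" c j] arcs e neq i \<open>j < m\<close> by auto
    then show ?thesis using ch_step[OF i t, of e] by simp
  qed
  define C where "C = ch e ` {Suc i..<m} \<union> (children b \<union> ch c ` {..<j})"
  have sub: "ch e ` {Suc i..<m} \<subseteq> children e" "ch c ` {..<j} \<subseteq> children c"
    using \<open>j < m\<close> by (auto simp: children_def)
  have disj: "children e \<inter> children b = {}" "children e \<inter> children c = {}" "children b \<inter> children c = {}"
    using children_disjoint e arcs neq by metis+
  have cyc: "cyclic C"
    unfolding cyclic_def
  proof (intro conjI allI)
    show "finite C" by (simp add: C_def)
    show "C \<subseteq> arcs" using sub children_arcs[OF e] children_arcs[OF arcs(1)] children_arcs[OF arcs(2)]
      by (auto simp: C_def)
    fix h
    have "arc_flux h C = arc_flux h (ch e ` {Suc i..<m}) + (arc_flux h (children b) + arc_flux h (ch c ` {..<j}))"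
      unfolding C_def using sub disj by (subst arc_flux_union; (subst arc_flux_union)?) auto
    also have "\<dots> = (h (z * head e) - h (pt e (Suc i))) + ((h (z * head b) - h (z * fst b))
        + (h (pt c j) - h (z * fst c)))"
      using arc_flux_ch[OF e, of "Suc i" m h] arc_flux_children[OF arcs(1), of h]
        arc_flux_ch[OF arcs(2), of 0 j h] \<open>j < m\<close> i by (simp add: atLeast0LessThan)
    also have "\<dots> = 0"
    proof -
      have "pt c j = pt e (Suc i)"
        using touch by (metis fst_ch head_ch turn_def fst_conv)
      moreover have "fst b = head e" "fst c = head b" by (simp_all add: b_def c_def turn_def)
      ultimately show ?thesis by simp
    qed
    finally show "arc_flux h C = 0" .
  qed
  have mem_e: "ch e l \<in> C \<longleftrightarrow> Suc i \<le> l" if "l < m" for l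
    using that ch_inj[of e l e] ch_mem_children[OF e arcs(1)] ch_mem_children[OF e arcs(2)] sub e neq
    unfolding C_def by (smt (verit, best) Un_iff atLeastLessThan_iff image_iff subsetD)
  have mem_b: "ch b l \<in> C" if "l < m" for l using that by (simp add: C_def children_def)
  have mem_d: "ch d l \<notin> C" if "l < m" for l
    using that ch_mem_children[OF arcs(3) e] ch_mem_children[OF arcs(3) arcs(1)]
      ch_mem_children[OF arcs(3) arcs(2)] neq sub unfolding C_def by blast
  have e_arc: "ch e i \<in> arcs" "ch e (Suc i) \<in> arcs" using e i ch_arc by auto
  let ?w = "winding C"
  have "?w (face t (ch b i)) = ?w (face t (ch b 0))"
    using mem_b \<open>i < m\<close> by (intro winding_along[OF cyc arcs(1) t, of 0 i True]) auto
  also have "\<dots> = ?w (face t (ch e (m - Suc 0)))" using face_join[OF t, of e] by (simp add: b_def)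
  also have "\<dots> = ?w (face t (ch e (Suc i)))"
    using mem_e i by (intro winding_along[OF cyc e t, of "Suc i" _ True]) auto
  also have "\<dots> = ?w (face (- t) (ch e (Suc i))) + orientation t"
    using winding_jump'[OF cyc e_arc(2) t] mem_e[OF i] by simp
  also have "face (- t) (ch e (Suc i)) = face (- t) (ch e i)"
    using next_i face_turn[OF mt] by simp
  also have "?w (face (- t) (ch e i)) = ?w (face t (ch e i))"
    using winding_jump'[OF cyc e_arc(1) t] mem_e[OF \<open>i < m\<close>] by simp
  also have "\<dots> = ?w (face t (ch e 0))"
    using mem_e i by (intro winding_along[OF cyc e t, of 0 _ False]) auto
  also have "\<dots> = ?w (face t (ch d (m - Suc 0)))" using face_join[OF t, of d] td by simp
  also have "\<dots> = ?w (face t (ch d 0))"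
    using mem_d two_le by (intro winding_along[OF cyc arcs(3) t, of 0 _ False]) auto
  also have "\<dots> = ?w (face t (ch d j))"
    using mem_d \<open>j < m\<close> by (intro winding_along[OF cyc arcs(3) t, of 0 _ False, symmetric]) auto
  \<comment> \<open>The rotated touching point.\<close>
  also have "face t (ch d j) = face t (ch b i)"
  proof -
    have "face t c = face t e" using face_turn[OF t] by (simp add: b_def c_def)
    moreover have "face t (ch c j) = face t (ch e i)" using touch face_turn[OF t] by metis
    ultimately show ?thesis
      using ch_turn_spin[OF t, of c j] ch_turn_spin[OF t, of e i] face_spin
      by (simp add: b_def d_def)
  qed
  finally show False by (simp add: orientation_def split: if_splits)
qed

lemma adjacent_parents:
  assumes "e \<in> arcs" "e' \<in> arcs" "a \<in> children e" "turn t a \<in> children e'"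
    "t \<in> quarter_turns" "e \<noteq> e'"
  shows "e' = turn t e \<or> e = turn t e'"
proof -
  obtain i j where ij: "a = ch e i" "turn t a = ch e' j" "i < m" "j < m"
    using assms(3,4) by (auto simp: children_def)
  then have "face t (ch e i) = face t (ch e' j)" using face_turn[OF assms(5)] by metis
  then have "face t e = face t e'" using face_parent assms ij by blast
  then have "e' \<in> {e, turn t e, turn t (turn t e), turn t (turn t (turn t e))}"
    using face_eq_cases assms by blast
  moreover have "e' \<noteq> turn t (turn t e)"
    using children_no_opposite_corner[of e i j t] ij assms by auto
  ultimately show ?thesis using turn4[OF assms(5), of e] assms(6) by auto
qed

end

section \<open>Every side is replaced by half as many sides as there are boundary points\<close>

context grid_substitution begin

definition simple_turns :: "complex \<Rightarrow> nat set" where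
  "simple_turns t = {j \<in> simple_vertices. 0 < j \<and> j < m \<and> \<delta> j = t * \<delta> (j - 1)}"

lemma finite_simple_vertices [simp]: "finite simple_vertices"
  by (rule finite_subset[of _ "{..m}"]) (auto simp: simple_vertices_def)

text \<open>
  At a point of the scaled grid the outgoing arcs are the first arcs of the images that start
  there, so no image passes through such a point in its interior.
\<close>

lemma path_avoids_ends:
  assumes "f \<in> arcs" "e \<in> arcs" "k < m" "fst (ch e k) = z * head f"
  shows "k = 0"
proof -
  have "head (ch f (m - Suc 0)) = fst (ch e k)" using assms head_ch by simp
  then have "ch e k = turn \<i> (ch f (m - Suc 0)) \<or> ch e k = turn (- \<i>) (ch f (m - Suc 0))"
    using successor_arc ch_arc assms by simp
  then obtain t where "t \<in> quarter_turns" "ch e k = ch (turn t f) 0"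
    unfolding quarter_turns_def using ch_join by auto
  then show ?thesis using ch_inj[of e k "turn t f" 0] assms turn_arc by simp
qed

lemma v_interior_not_end:
  assumes "0 < k" "k < m"
  shows "v k \<noteq> 0" "v k \<noteq> z"
proof -
  let ?e = "(0, 1) :: arc" and ?f = "(- \<i>, \<i>) :: arc"
  have "?f \<in> arcs" using even_point_unit[of "- \<i>"] by (simp add: arcs_def units_def unit_distinct)
  moreover have "fst (ch ?e k) = v k" by (simp add: fst_ch pt_def)
  ultimately show "v k \<noteq> 0" "v k \<noteq> z"
    using path_avoids_ends[of ?f ?e k] path_avoids_ends[of ?e ?e k] exists_arc assms
    by (auto simp: head_def)
qed

lemma v_reflect: "j \<le> m \<Longrightarrow> v (m - j) = z - v j"
proof (induction j)
  case (Suc j)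
  then have "v (m - j) = v (m - Suc j) + \<delta> (m - Suc j)" using v_Suc[of "m - Suc j"] by (simp add: Suc_diff_Suc)
  moreover have "\<delta> (m - Suc j) = \<delta> j" using palindrome[of j] Suc by simp
  ultimately show ?case using Suc by (simp add: v_Suc algebra_simps)
qed simp

lemma simple_vertices_reflect: "j \<in> simple_vertices \<Longrightarrow> m - j \<in> simple_vertices"
  unfolding simple_vertices_def
proof (clarsimp)
  fix k assume "j \<le> m" "\<forall>k\<le>m. v k = v j \<longrightarrow> k = j" "k \<le> m" "v k = v (m - j)"
  then have "v (m - k) = v j" using v_reflect[of j] v_reflect[of k] by simp
  then have "m - k = j" using \<open>\<forall>k\<le>m. _\<close> by simp
  then show "k = m - j" using \<open>k \<le> m\<close> by simp
qed

lemma simple_turns_reflect: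
  assumes "t \<in> quarter_turns" "j \<in> simple_turns t"
  shows "m - j \<in> simple_turns (- t)"
proof -
  have j: "0 < j" "j < m" "\<delta> j = t * \<delta> (j - 1)" "j \<in> simple_vertices"
    using assms by (auto simp: simple_turns_def)
  have "\<delta> (m - j) = \<delta> (j - 1)" using palindrome[of "j - 1"] j by simp
  moreover have "\<delta> (m - j - 1) = \<delta> j" using palindrome[of j] j by (simp add: diff_commute)
  moreover have "\<delta> (j - 1) = - t * \<delta> j"
    using j(3) quarter_turn_square[OF assms(1)] by (simp flip: mult.assoc)
  ultimately show ?thesis using j simple_vertices_reflect by (auto simp: simple_turns_def)
qed

lemma finite_simple_turns [simp]: "finite (simple_turns t)"
  by (rule finite_subset[of _ simple_vertices]) (auto simp: simple_turns_def)

text \<open>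
  The end points are visited once. Reversing the path exchanges left and right turns and
  preserves the simple vertices, so these are equally many for both turns.
\<close>

lemma card_simple_turns:
  assumes "t \<in> quarter_turns"
  shows "card simple_vertices = 2 + 2 * card (simple_turns t)"
proof -
  have mt: "- t \<in> quarter_turns" using assms by (rule quarter_turn_minus)
  have "bij_betw (\<lambda>j. m - j) (simple_turns t) (simple_turns (- t))"
    using simple_turns_reflect[OF assms] simple_turns_reflect[OF mt]
    by (intro bij_betwI[where g = "\<lambda>j. m - j"]) (auto simp: simple_turns_def)
  then have eq: "card (simple_turns (- t)) = card (simple_turns t)" by (simp add: bij_betw_same_card)
  have "0 \<in> simple_vertices"
    using v_interior_not_end(1) z_nonzero by (fastforce simp: simple_vertices_def)
  then have ends: "0 \<in> simple_vertices" "m \<in> simple_vertices"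
    using simple_vertices_reflect[of 0] by auto
  have "simple_vertices = {0, m} \<union> (simple_turns t \<union> simple_turns (- t))"
  proof (intro equalityI subsetI)
    fix j assume j: "j \<in> simple_vertices"
    show "j \<in> {0, m} \<union> (simple_turns t \<union> simple_turns (- t))"
    proof (cases "j = 0 \<or> j = m")
      case False
      then have "0 < j" "j < m" using j by (auto simp: simple_vertices_def)
      then have "\<delta> j = t * \<delta> (j - 1) \<or> \<delta> j = - t * \<delta> (j - 1)"
        using dir_turn[of "j - 1"] assms by (auto simp: quarter_turns_def)
      then show ?thesis using j \<open>0 < j\<close> \<open>j < m\<close> by (auto simp: simple_turns_def)
    qed auto
  qed (use ends in \<open>auto simp: simple_turns_def\<close>)
  moreover have "simple_turns t \<inter> simple_turns (- t) = {}"
  proof -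
    have False if "j \<in> simple_turns t" "j \<in> simple_turns (- t)" for j
    proof -
      have "t * \<delta> (j - 1) = - t * \<delta> (j - 1)" "j - 1 < m" using that by (auto simp: simple_turns_def)
      then show False
        using unit_nonzero[OF dir_unit[of "j - 1"]] quarter_turn_nonzero[OF assms] by simp
    qed
    then show ?thesis by blast
  qed
  moreover have "{0, m} \<inter> (simple_turns t \<union> simple_turns (- t)) = {}" by (auto simp: simple_turns_def)
  ultimately have "card simple_vertices = card {0, m} + (card (simple_turns t) + card (simple_turns (- t)))"
    by (simp add: card_Un_disjoint)
  then show ?thesis using eq m_pos by simp
qed

text \<open>
  Half the number of boundary points; every side will be replaced by this many sides.
\<close>

definition side_count :: nat where
  "side_count = card simple_vertices div 2"

lemma card_simple_vertices: "card simple_vertices = 2 * side_count"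
  using card_simple_turns[of \<i>] by (simp add: side_count_def quarter_turns_def)

lemma side_count_pos: "1 \<le> side_count"
  using card_simple_turns[of \<i>] by (simp add: side_count_def quarter_turns_def)

lemma side_count_less: "side_count < m"
proof -
  have "card simple_vertices \<le> card {..m}" by (intro card_mono) (auto simp: simple_vertices_def)
  then show ?thesis using card_simple_vertices two_le by simp
qed

text \<open>
  Continuing arc \<open>j\<close> of the image with the turn \<open>t\<close> stays in the image
  if the path itself does so, or if it turns the other way and returns to this vertex later or
  earlier: the two arcs that start at a vertex are the two continuations. So the continuation
  leaves the image at the once-visited vertices with turn \<open>- t\<close> and at the end
  point.
\<close>

lemma card_outward_turns:
  assumes e: "e \<in> arcs" and t: "t \<in> quarter_turns"
  shows "card {j \<in> {..<m}. turn t (ch e j) \<notin> children e} = side_count"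
proof -
  have mt: "- t \<in> quarter_turns" using t by (rule quarter_turn_minus)
  have snd: "snd e \<noteq> 0" using arcsD(3)[OF e] .
  have key: "turn t (ch e j) \<in> children e \<longleftrightarrow> Suc j \<notin> simple_turns (- t)" if j: "Suc j < m" for j
  proof (cases "ch e (Suc j) = turn t (ch e j)")
    case True
    then have "snd e * \<delta> (Suc j) = t * (snd e * \<delta> j)" by (simp add: turn_def prod_eq_iff snd_ch)
    then have "\<delta> (Suc j) = t * \<delta> j" using snd by (simp add: mult.left_commute)
    then have "Suc j \<notin> simple_turns (- t)"
      using dir_unit[of j] unit_nonzero j quarter_turn_nonzero[OF t] by (auto simp: simple_turns_def)
    moreover have "ch e (Suc j) \<in> children e" using j by (simp add: children_def)
    ultimately show ?thesis using True by simp
  next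
    case False
    then have nxt: "ch e (Suc j) = turn (- t) (ch e j)" using ch_step[OF j t, of e] by simp
    then have "snd e * \<delta> (Suc j) = - t * (snd e * \<delta> j)" by (simp add: turn_def prod_eq_iff snd_ch)
    then have "snd e * \<delta> (Suc j) = snd e * (- t * \<delta> j)" by (simp add: algebra_simps)
    then have dir: "\<delta> (Suc j) = - t * \<delta> j" using snd by (simp only: mult_cancel_left) simp
    have start: "fst (ch e (Suc j)) = head (ch e j)" by (simp add: fst_ch head_ch)
    have "turn t (ch e j) \<in> children e \<longleftrightarrow> Suc j \<notin> simple_vertices"
    proof
      assume "turn t (ch e j) \<in> children e"
      then obtain k where k: "k < m" "turn t (ch e j) = ch e k" by (auto simp: children_def)
      then have "fst (ch e k) = fst (ch e (Suc j))" using start by (metis turn_def fst_conv)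
      then have "v k = v (Suc j)" using snd by (simp add: fst_ch pt_def)
      moreover have "k \<noteq> Suc j" using False k by auto
      ultimately show "Suc j \<notin> simple_vertices"
        using k less_imp_le unfolding simple_vertices_def by blast
    next
      assume "Suc j \<notin> simple_vertices"
      then obtain k where k: "k \<le> m" "v k = v (Suc j)" "k \<noteq> Suc j"
        using j by (auto simp: simple_vertices_def)
      then have "k < m" using v_interior_not_end(2)[of "Suc j"] j by (cases "k = m") auto
      have "head (ch e j) = fst (ch e k)" using k start by (simp add: fst_ch pt_def)
      then have "ch e k = turn \<i> (ch e j) \<or> ch e k = turn (- \<i>) (ch e j)"
        using successor_arc ch_arc e j \<open>k < m\<close> by simp
      then have "ch e k = turn t (ch e j) \<or> ch e k = turn (- t) (ch e j)"
        using t by (auto simp: quarter_turns_def)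
      moreover have "ch e k \<noteq> ch e (Suc j)" using ch_inj[of e k e "Suc j"] e k \<open>k < m\<close> j by auto
      ultimately have "turn t (ch e j) = ch e k" using nxt by auto
      then show "turn t (ch e j) \<in> children e" using \<open>k < m\<close> by (simp add: children_def)
    qed
    then show ?thesis using dir j by (simp add: simple_turns_def)
  qed
  have last: "turn t (ch e (m - Suc 0)) \<notin> children e"
    using ch_join[of t e] ch_mem_children[of "turn t e" e 0] turn_arc[OF e t] e turn_neq[OF e t] by simp
  have "{j \<in> {..<m}. turn t (ch e j) \<notin> children e} = insert (m - Suc 0) ((\<lambda>i. i - 1) ` simple_turns (- t))"
  proof (intro equalityI subsetI)
    fix j assume "j \<in> {j \<in> {..<m}. turn t (ch e j) \<notin> children e}"
    then have j: "j < m" "turn t (ch e j) \<notin> children e" by auto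
    show "j \<in> insert (m - Suc 0) ((\<lambda>i. i - 1) ` simple_turns (- t))"
    proof (cases "Suc j < m")
      case True
      then have "Suc j \<in> simple_turns (- t)" using key j by blast
      then show ?thesis by (force intro: rev_image_eqI)
    qed (use j in auto)
  next
    fix j assume "j \<in> insert (m - Suc 0) ((\<lambda>i. i - 1) ` simple_turns (- t))"
    then consider "j = m - Suc 0" | i where "i \<in> simple_turns (- t)" "j = i - 1" by auto
    then show "j \<in> {j \<in> {..<m}. turn t (ch e j) \<notin> children e}"
    proof cases
      case 1
      then show ?thesis using last by simp
    next
      case 2
      then have "i = Suc j" "Suc j < m" by (auto simp: simple_turns_def)
      then show ?thesis using 2 key[of j] by auto
    qed
  qed
  moreover have "m - Suc 0 \<notin> (\<lambda>i. i - 1) ` simple_turns (- t)" by (auto simp: simple_turns_def)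
  moreover have "inj_on (\<lambda>i. i - 1) (simple_turns (- t))" by (auto simp: inj_on_def simple_turns_def)
  ultimately have "card {j \<in> {..<m}. turn t (ch e j) \<notin> children e} = Suc (card (simple_turns (- t)))"
    by (simp add: card_image)
  then show ?thesis using card_simple_turns[OF mt] card_simple_vertices by simp
qed

text \<open>
  The pair \<open>(e, t)\<close> stands for the corner of a unit face between \<open>e\<close>
  and \<open>turn t e\<close>. At each vertex two arcs come in and two go out, so every corner
  of a face is listed exactly once.
\<close>

definition corners :: "(arc \<times> complex) set" where
  "corners = arcs \<times> quarter_turns"

text \<open>
  The corners between the image of \<open>e\<close> and the image of \<open>turn t e\<close>, in
  either order.
\<close>

definition child_corners :: "arc \<times> complex \<Rightarrow> (arc \<times> complex) set" where
  "child_corners = (\<lambda>(e, t). {(a, t) | a.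
     a \<in> children e \<and> turn t a \<in> children (turn t e) \<or>
     a \<in> children (turn t e) \<and> turn t a \<in> children e})"

lemma mem_child_corners:
  "(a, s) \<in> child_corners (e, t) \<longleftrightarrow> s = t \<and>
     (a \<in> children e \<and> turn t a \<in> children (turn t e) \<or>
      a \<in> children (turn t e) \<and> turn t a \<in> children e)"
  unfolding child_corners_def by blast

definition sides :: "arc set \<Rightarrow> (arc \<times> complex) set" where
  "sides A = {(a, t) \<in> corners. a \<in> A \<longleftrightarrow> turn t a \<notin> A}"

definition subst :: "arc set \<Rightarrow> arc set" where
  "subst A = (\<Union>e\<in>A. children e)"

definition subst_corners :: "(arc \<times> complex) set \<Rightarrow> (arc \<times> complex) set" where
  "subst_corners X = (\<Union>c\<in>X. child_corners c)"

lemma children_turn: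
  assumes "t \<in> quarter_turns" "face t g = face t e"
  shows "turn t (ch (turn t e) j) \<in> children (turn t g) \<longleftrightarrow> turn t (ch e j) \<in> children g"
proof -
  let ?s = "spin t (z * face t e)"
  have "ch (turn t g) k = ?s (ch g k)" for k using ch_turn_spin[OF assms(1), of g k] assms(2) by simp
  then have "children (turn t g) = ?s ` children g" by (auto simp: children_def)
  moreover have "turn t (ch (turn t e) j) = ?s (turn t (ch e j))"
    using ch_turn_spin[OF assms(1), of e j] spin_turn by simp
  ultimately show ?thesis using spin_inj[OF quarter_turn_nonzero[OF assms(1)]] by (auto simp: image_iff)
qed

text \<open>
  An arc of the image of \<open>e\<close> whose continuation with turn \<open>t\<close> leaves
  the image goes over to the image of the successor \<open>turn t e\<close> or of the
  predecessor \<open>e3\<close> of \<open>e\<close> around the face. The former are the first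
  kind of child corners; the latter correspond, by rotation about the face, to the second kind.
\<close>

lemma card_child_corners:
  assumes "c \<in> corners"
  shows "card (child_corners c) = side_count"
proof -
  obtain e t where c: "c = (e, t)" and e: "e \<in> arcs" and t: "t \<in> quarter_turns"
    using assms by (auto simp: corners_def)
  define e3 where "e3 = turn t (turn t (turn t e))"
  have e3: "e3 \<in> arcs" "turn t e3 = e" "face t e3 = face t e" "e3 \<noteq> turn t e" "e3 \<noteq> e" "turn t e \<noteq> e"
    using e t turn_arc turn4[OF t, of e] face_turn[OF t] turn_neq[OF e t] turn_neq[OF turn_arc[OF e t] t]
    by (auto simp: e3_def)
  have te: "turn t e \<in> arcs" using e t turn_arc by simp
  define P where "P = {j \<in> {..<m}. turn t (ch e j) \<in> children (turn t e)}"
  define Q where "Q = {j \<in> {..<m}. turn t (ch e j) \<in> children e3}"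
  have "{j \<in> {..<m}. turn t (ch e j) \<notin> children e} = P \<union> Q"
  proof (intro equalityI subsetI)
    fix j assume j: "j \<in> {j \<in> {..<m}. turn t (ch e j) \<notin> children e}"
    then obtain e' k where e': "e' \<in> arcs" "k < m" "turn t (ch e j) = ch e' k"
      using ch_surj[of "turn t (ch e j)"] turn_arc ch_arc e t by auto
    then have "turn t (ch e j) \<in> children e'" "e' \<noteq> e" using j by (auto simp: children_def)
    then have "e' = turn t e \<or> e = turn t e'"
      using adjacent_parents[of e e' "ch e j" t] e e' j t by (auto simp: children_def)
    moreover have "e' = e3" if "e = turn t e'"
      using that e3(2) turn_inj[OF quarter_turn_nonzero[OF t]] by metis
    ultimately show "j \<in> P \<union> Q" using \<open>turn t (ch e j) \<in> children e'\<close> j by (auto simp: P_def Q_def)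
  next
    fix j assume "j \<in> P \<union> Q"
    then show "j \<in> {j \<in> {..<m}. turn t (ch e j) \<notin> children e}"
      using children_disjoint[OF te e] children_disjoint[OF e3(1) e] e3 by (auto simp: P_def Q_def)
  qed
  moreover have "P \<inter> Q = {}"
    using children_disjoint[OF te e3(1)] e3 by (auto simp: P_def Q_def)
  ultimately have PQ: "card P + card Q = side_count"
    using card_outward_turns[OF e t] card_Un_disjoint[of P Q] by (simp add: P_def Q_def)
  have Q: "j \<in> Q \<longleftrightarrow> j < m \<and> turn t (ch (turn t e) j) \<in> children e" for j
    using children_turn[OF t, of e3 e j] e3 by (simp add: Q_def)
  have "child_corners c = (\<lambda>j. (ch e j, t)) ` P \<union> (\<lambda>j. (ch (turn t e) j, t)) ` Q"
  proof (intro equalityI subsetI)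
    fix x assume "x \<in> child_corners c"
    then obtain a where a: "x = (a, t)" "a \<in> children e \<and> turn t a \<in> children (turn t e) \<or>
        a \<in> children (turn t e) \<and> turn t a \<in> children e"
      by (auto simp: child_corners_def c)
    then consider i where "i < m" "a = ch e i" "turn t a \<in> children (turn t e)"
      | i where "i < m" "a = ch (turn t e) i" "turn t a \<in> children e"
      unfolding children_def by blast
    then show "x \<in> (\<lambda>j. (ch e j, t)) ` P \<union> (\<lambda>j. (ch (turn t e) j, t)) ` Q"
      by cases (use Q a(1) in \<open>auto simp: P_def\<close>)
  next
    fix x assume "x \<in> (\<lambda>j. (ch e j, t)) ` P \<union> (\<lambda>j. (ch (turn t e) j, t)) ` Q"
    then show "x \<in> child_corners c"
    proof
      assume "x \<in> (\<lambda>j. (ch e j, t)) ` P"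
      then obtain j where "j < m" "turn t (ch e j) \<in> children (turn t e)" "x = (ch e j, t)"
        by (auto simp: P_def)
      moreover from this(1) have "ch e j \<in> children e" by (simp add: children_def)
      ultimately show ?thesis unfolding c child_corners_def by blast
    next
      assume "x \<in> (\<lambda>j. (ch (turn t e) j, t)) ` Q"
      then obtain j where "j < m" "turn t (ch (turn t e) j) \<in> children e" "x = (ch (turn t e) j, t)"
        using Q by auto
      moreover from this(1) have "ch (turn t e) j \<in> children (turn t e)" by (simp add: children_def)
      ultimately show ?thesis unfolding c child_corners_def by blast
    qed
  qed
  moreover have "card ((\<lambda>j. (ch e j, t)) ` P) = card P"
    using ch_inj e by (intro card_image inj_onI) (auto simp: P_def)
  moreover have "card ((\<lambda>j. (ch (turn t e) j, t)) ` Q) = card Q"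
    using ch_inj te by (intro card_image inj_onI) (auto simp: Q_def)
  moreover have "(\<lambda>j. (ch e j, t)) ` P \<inter> (\<lambda>j. (ch (turn t e) j, t)) ` Q = {}"
  proof -
    have no: "ch e i \<noteq> ch (turn t e) j" if "i < m" "j < m" for i j
      using ch_inj[of e i "turn t e" j] e te e3(6) that by auto
    have "i < m" if "i \<in> P" for i using that by (simp add: P_def)
    moreover have "j < m" if "j \<in> Q" for j using that by (simp add: Q_def)
    ultimately show ?thesis using no by blast
  qed
  ultimately show ?thesis using PQ by (simp add: card_Un_disjoint P_def Q_def)
qed

lemma child_corners_corners: "c \<in> corners \<Longrightarrow> child_corners c \<subseteq> corners"
proof (cases c)
  case (Pair e t)
  moreover assume "c \<in> corners"
  ultimately have "e \<in> arcs" "turn t e \<in> arcs" "t \<in> quarter_turns"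
    using turn_arc by (auto simp: corners_def)
  then show ?thesis using children_arcs[of e] children_arcs[of "turn t e"] Pair
    by (auto simp: corners_def child_corners_def)
qed

lemma child_corners_disjoint:
  assumes "c \<in> corners" "c' \<in> corners" "x \<in> child_corners c" "x \<in> child_corners c'"
  shows "c = c'"
proof -
  obtain e t e' t' a where c: "c = (e, t)" "c' = (e', t')" "x = (a, t)" and t: "t' = t" "t \<in> quarter_turns"
    and e: "e \<in> arcs" "e' \<in> arcs"
    using assms by (auto simp: corners_def child_corners_def)
  have te: "turn t e \<in> arcs" "turn t e' \<in> arcs" using e t turn_arc by auto
  have parent: "g = g'" if "g \<in> arcs" "g' \<in> arcs" "b \<in> children g" "b \<in> children g'" for b g g'
    using children_disjoint[OF that(1,2)] that by blast
  have "a \<in> children e \<and> turn t a \<in> children (turn t e) \<or> a \<in> children (turn t e) \<and> turn t a \<in> children e"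
    "a \<in> children e' \<and> turn t a \<in> children (turn t e') \<or> a \<in> children (turn t e') \<and> turn t a \<in> children e'"
    using assms c t by (auto simp: child_corners_def)
  then have "e = e' \<or> (e = turn t e' \<and> turn t e = e')"
    using parent e te by metis
  then show ?thesis using turn_neq(2)[OF e(2) t(2)] c t by auto
qed

lemma subst_arcs: "A \<subseteq> arcs \<Longrightarrow> subst A \<subseteq> arcs"
  using children_arcs by (auto simp: subst_def)

lemma mem_subst: "A \<subseteq> arcs \<Longrightarrow> e \<in> arcs \<Longrightarrow> a \<in> children e \<Longrightarrow> a \<in> subst A \<longleftrightarrow> e \<in> A"
  using children_disjoint unfolding subst_def by blast

lemma sides_subst:
  assumes A: "A \<subseteq> arcs"
  shows "sides (subst A) = subst_corners (sides A)"
proof (intro equalityI subsetI)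
  fix x assume x: "x \<in> sides (subst A)"
  then obtain a t where at: "x = (a, t)" "a \<in> arcs" "t \<in> quarter_turns" "turn t a \<in> arcs"
    "a \<in> subst A \<longleftrightarrow> turn t a \<notin> subst A"
    using turn_arc by (auto simp: sides_def corners_def)
  obtain e where e: "e \<in> arcs" "a \<in> children e" by (rule ch_surj[OF at(2)]) (simp add: children_def)
  obtain e' where e': "e' \<in> arcs" "turn t a \<in> children e'" by (rule ch_surj[OF at(4)]) (simp add: children_def)
  have AA: "e \<in> A \<longleftrightarrow> e' \<notin> A" using at(5) mem_subst[OF A] e e' by blast
  then have "e' = turn t e \<or> e = turn t e'" using adjacent_parents[OF e(1) e'(1) e(2) e'(2) at(3)] by auto
  then have "(e, t) \<in> sides A \<and> x \<in> child_corners (e, t) \<or> (e', t) \<in> sides A \<and> x \<in> child_corners (e', t)"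
    using AA e e' at unfolding sides_def corners_def at(1) mem_child_corners by fast
  then show "x \<in> subst_corners (sides A)" by (auto simp: subst_corners_def)
next
  fix x assume "x \<in> subst_corners (sides A)"
  then obtain e t where et: "e \<in> arcs" "t \<in> quarter_turns" "e \<in> A \<longleftrightarrow> turn t e \<notin> A" "x \<in> child_corners (e, t)"
    by (auto simp: subst_corners_def sides_def corners_def)
  then obtain a where a: "x = (a, t)" "a \<in> children e \<and> turn t a \<in> children (turn t e) \<or> a \<in> children (turn t e) \<and> turn t a \<in> children e"
    by (auto simp: child_corners_def)
  have te: "turn t e \<in> arcs" using et turn_arc by simp
  have "a \<in> arcs" using a children_arcs[OF et(1)] children_arcs[OF te] by blast
  moreover have "a \<in> subst A \<longleftrightarrow> turn t a \<notin> subst A"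
    using a et(3) mem_subst[OF A et(1)] mem_subst[OF A te] by blast
  ultimately show "x \<in> sides (subst A)" using a et by (auto simp: sides_def corners_def)
qed

lemma subst_pow_arcs: "A \<subseteq> arcs \<Longrightarrow> (subst ^^ n) A \<subseteq> arcs"
  by (induction n) (auto intro!: subst_arcs)

lemma sides_subst_pow: "A \<subseteq> arcs \<Longrightarrow> sides ((subst ^^ n) A) = (subst_corners ^^ n) (sides A)"
  by (induction n) (auto simp: sides_subst subst_pow_arcs)

lemma card_subst_corners:
  assumes "finite X" "X \<subseteq> corners"
  shows "subst_corners X \<subseteq> corners \<and> finite (subst_corners X) \<and> card (subst_corners X) = side_count * card X"
proof -
  have fin: "finite (child_corners c)" if "c \<in> X" for c
    using card_child_corners[of c] side_count_pos that assms by (metis card.infinite not_one_le_zero subsetD)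
  have "card (subst_corners X) = (\<Sum>c\<in>X. card (child_corners c))"
    unfolding subst_corners_def
    by (intro card_UN_disjoint ballI impI) (use assms fin child_corners_disjoint in blast)+
  also have "\<dots> = (\<Sum>c\<in>X. side_count)" using card_child_corners assms by (intro sum.cong) auto
  finally have "card (subst_corners X) = side_count * card X" by simp
  moreover have "subst_corners X \<subseteq> corners"
    using child_corners_corners assms(2) unfolding subst_corners_def by blast
  moreover have "finite (subst_corners X)" using assms(1) fin by (simp add: subst_corners_def)
  ultimately show ?thesis by simp
qed

lemma card_subst_corners_pow:
  assumes "finite X" "X \<subseteq> corners"
  shows "(subst_corners ^^ n) X \<subseteq> corners \<and> finite ((subst_corners ^^ n) X) \<and> card ((subst_corners ^^ n) X) = side_count ^ n * card X"
  by (induction n) (use assms card_subst_corners in auto)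

lemma card_subst:
  assumes "finite A" "A \<subseteq> arcs"
  shows "finite (subst A) \<and> card (subst A) = m * card A"
proof -
  have "card (children e) = m" if "e \<in> A" for e
  proof -
    have "e \<in> arcs" using that assms by blast
    then have "inj_on (ch e) {..<m}" using ch_inj[of e _ e] by (intro inj_onI) simp
    then show ?thesis by (simp add: children_def card_image)
  qed
  moreover have "card (subst A) = (\<Sum>e\<in>A. card (children e))"
    unfolding subst_def
    by (intro card_UN_disjoint ballI impI) (simp_all add: assms(1), metis assms(2) children_disjoint subset_iff)
  ultimately show ?thesis using assms by (simp add: subst_def)
qed

lemma card_subst_pow:
  assumes "finite A" "A \<subseteq> arcs"
  shows "finite ((subst ^^ n) A) \<and> card ((subst ^^ n) A) = m ^ n * card A"
  by (induction n) (use assms card_subst subst_pow_arcs in auto)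

lemma subst_pow_Union: "(subst ^^ n) (\<Union>i\<in>I. A i) = (\<Union>i\<in>I. (subst ^^ n) (A i))"
  by (induction n) (auto simp: subst_def)

lemma subst_corners_pow_Union: "(subst_corners ^^ n) (\<Union>i\<in>I. A i) = (\<Union>i\<in>I. (subst_corners ^^ n) (A i))"
  by (induction n) (auto simp: subst_corners_def)

end

section \<open>Growth of the images and the scaling factor\<close>

lemma exp_beats_square: "(1::real) < x \<Longrightarrow> 0 < M \<Longrightarrow> \<exists>n. 4 * (2 * M * real n + 1) ^ 2 < x ^ n"
proof -
  assume "1 < x" "0 < M"
  then have "eventually (\<lambda>n. 4 * (2 * M * real n + 1) ^ 2 < x ^ n) at_top" by real_asymp
  then show ?thesis by (auto simp: eventually_at_top_linorder)
qed

definition near :: "complex \<Rightarrow> real \<Rightarrow> arc set" where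
  "near c \<rho> = {a \<in> arcs. cmod (fst a - c) \<le> \<rho>}"

text \<open>
  A square of side \<open>2\<rho>\<close> contains at most \<open>(2\<rho> + 1)^2\<close> grid
  points, each with at most four unit directions.
\<close>

lemma card_near:
  assumes "0 \<le> \<rho>"
  shows "finite (near c \<rho>)" "real (card (near c \<rho>)) \<le> 4 * (2 * \<rho> + 1) ^ 2"
proof -
  define I J where "I = {\<lceil>Re c - \<rho>\<rceil>..\<lfloor>Re c + \<rho>\<rfloor>}" and "J = {\<lceil>Im c - \<rho>\<rceil>..\<lfloor>Im c + \<rho>\<rfloor>}"
  have fin: "finite I" "finite J" "finite units" by (simp_all add: I_def J_def units_def)
  have sub: "near c \<rho> \<subseteq> (\<lambda>((i, j), d). (Complex (of_int i) (of_int j), d)) ` ((I \<times> J) \<times> units)"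
  proof
    fix a assume a: "a \<in> near c \<rho>"
    then have arc: "a \<in> arcs" and dist: "cmod (fst a - c) \<le> \<rho>" by (auto simp: near_def)
    obtain i j where ij: "fst a = Complex (of_int i) (of_int j)" using arcsD(1)[OF arc] grid_point_cases by blast
    have "\<bar>of_int i - Re c\<bar> \<le> \<rho>" "\<bar>of_int j - Im c\<bar> \<le> \<rho>"
      using abs_Re_le_cmod[of "fst a - c"] abs_Im_le_cmod[of "fst a - c"] dist ij by auto
    then have "i \<in> I" "j \<in> J" by (auto simp: I_def J_def ceiling_le_iff le_floor_iff)
    then show "a \<in> (\<lambda>((i, j), d). (Complex (of_int i) (of_int j), d)) ` ((I \<times> J) \<times> units)"
      using ij arcsD(2)[OF arc] by (intro image_eqI[where x = "((i, j), snd a)"]) (auto simp: prod_eq_iff)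
  qed
  then show "finite (near c \<rho>)" using fin by (auto intro: finite_subset)
  have "card (near c \<rho>) \<le> card ((I \<times> J) \<times> units)"
    using fin by (intro surj_card_le[OF _ sub]) auto
  also have "\<dots> \<le> card I * card J * 4"
    using card_insert_le_m1 by (simp add: card_cartesian_product units_def card_insert_if)
  finally have "real (card (near c \<rho>)) \<le> real (card I) * real (card J) * 4"
    by (metis of_nat_le_iff of_nat_mult of_nat_numeral)
  moreover have "real (card I) \<le> 2 * \<rho> + 1" "real (card J) \<le> 2 * \<rho> + 1"
    using assms unfolding I_def J_def by (simp_all, linarith+)
  then have "real (card I) * real (card J) \<le> (2 * \<rho> + 1) * (2 * \<rho> + 1)"
    by (intro mult_mono) auto
  ultimately show "real (card (near c \<rho>)) \<le> 4 * (2 * \<rho> + 1) ^ 2" by (simp add: power2_eq_square)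
qed

lemma card_near_ge:
  assumes "0 \<le> \<rho>"
  shows "(\<rho> / 2) ^ 2 \<le> real (card (near 0 \<rho>))"
proof -
  define I where "I = {0..\<lfloor>\<rho> / 2\<rfloor>}"
  define f where "f = (\<lambda>(i, j). (Complex (of_int i) (of_int j), if even (i + j) then 1 else \<i>))"
  have "f ` (I \<times> I) \<subseteq> near 0 \<rho>"
  proof
    fix x assume "x \<in> f ` (I \<times> I)"
    then obtain i j where ij: "i \<in> I" "j \<in> I" and x: "x = f (i, j)" by auto
    then have "0 \<le> i" "0 \<le> j" "real_of_int i \<le> \<rho> / 2" "real_of_int j \<le> \<rho> / 2" by (auto simp: I_def le_floor_iff)
    then have "cmod (Complex (of_int i) (of_int j)) \<le> \<rho>"
      using cmod_le[of "Complex (of_int i) (of_int j)"] by simp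
    then show "x \<in> near 0 \<rho>" by (auto simp: x near_def f_def arcs_def units_def unit_distinct)
  qed
  moreover have "inj_on f (I \<times> I)" by (auto simp: inj_on_def f_def)
  ultimately have "card (I \<times> I) \<le> card (near 0 \<rho>)"
    using card_near(1)[OF assms] card_inj_on_le by blast
  moreover have "\<rho> / 2 \<le> real (card I)" using assms unfolding I_def by simp
  then have "(\<rho> / 2) * (\<rho> / 2) \<le> real (card I) * real (card I)" using assms by (intro mult_mono) auto
  moreover have "real (card I) * real (card I) \<le> real (card (near 0 \<rho>))"
    using \<open>card (I \<times> I) \<le> card (near 0 \<rho>)\<close>
    by (metis card_cartesian_product of_nat_le_iff of_nat_mult)
  ultimately show ?thesis by (simp add: power2_eq_square)
qed

context grid_substitution begin

lemma norm_v: "j \<le> m \<Longrightarrow> cmod (v j) \<le> m"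
proof -
  assume "j \<le> m"
  have "cmod (v j) \<le> (\<Sum>l<j. cmod (\<delta> l))" by (simp add: turtle_def norm_sum)
  also have "\<dots> = (\<Sum>l<j. 1)" using dir_unit \<open>j \<le> m\<close> by (intro sum.cong) auto
  finally show ?thesis using \<open>j \<le> m\<close> by simp
qed

lemma children_near:
  assumes "e \<in> arcs" "a \<in> children e"
  shows "cmod (fst a - z * fst e) \<le> m"
proof -
  obtain j where "j < m" "a = ch e j" using assms by (auto simp: children_def)
  then have "cmod (fst a - z * fst e) = cmod (snd e) * cmod (v j)" by (simp add: fst_ch pt_def norm_mult)
  then show ?thesis using norm_v[of j] arcsD(4)[OF assms(1)] \<open>j < m\<close> by simp
qed

lemma subst_pow_Suc: "(subst ^^ Suc n) A = (\<Union>b\<in>(subst ^^ n) A. children b)"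
  by (simp add: subst_def[of "(subst ^^ n) A"])

text \<open>
  This form of the bound makes sense for every value of \<open>\<bar>z\<bar>\<close>; that
  \<open>\<bar>z\<bar> > 1\<close> is derived from it.
\<close>

lemma descendants_near':
  assumes "e \<in> arcs" "a \<in> (subst ^^ n) {e}"
  shows "cmod (fst a - z ^ n * fst e) \<le> m * (\<Sum>l<n. cmod z ^ l)"
  using assms(2)
proof (induction n arbitrary: a)
  case (Suc n)
  then obtain b where b: "b \<in> (subst ^^ n) {e}" "a \<in> children b"
    unfolding subst_pow_Suc by blast
  have "b \<in> arcs" using b(1) subst_pow_arcs[of "{e}" n] assms(1) by auto
  have "fst a - z ^ Suc n * fst e = (fst a - z * fst b) + z * (fst b - z ^ n * fst e)"
    by (simp add: algebra_simps)
  then have "cmod (fst a - z ^ Suc n * fst e) \<le> cmod (fst a - z * fst b) + cmod z * cmod (fst b - z ^ n * fst e)"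
    by (metis norm_mult norm_triangle_ineq)
  also have "\<dots> \<le> m + cmod z * (m * (\<Sum>l<n. cmod z ^ l))"
    using children_near[OF \<open>b \<in> arcs\<close> b(2)] Suc.IH[OF b(1)] by (intro add_mono mult_left_mono) auto
  also have "\<dots> = m * (\<Sum>l<Suc n. cmod z ^ l)"
    by (simp add: sum.lessThan_Suc_shift sum_distrib_left algebra_simps del: sum.lessThan_Suc)
  finally show ?case .
qed simp

lemma subst_all: "(subst ^^ n) arcs = arcs"
proof -
  have "subst arcs = arcs"
  proof
    show "arcs \<subseteq> subst arcs"
    proof
      fix a assume "a \<in> arcs"
      then show "a \<in> subst arcs" by (rule ch_surj) (auto simp: subst_def children_def)
    qed
  qed (simp add: subst_arcs)
  then show ?thesis by (induction n) auto
qed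

lemma ancestor:
  assumes "a \<in> (subst ^^ n) A"
  obtains e where "e \<in> A" "a \<in> (subst ^^ n) {e}"
  using assms subst_pow_Union[of n "\<lambda>e. {e}" A] by auto

lemma subst_pow_mono: "A \<subseteq> B \<Longrightarrow> (subst ^^ n) A \<subseteq> (subst ^^ n) B"
  by (induction n) (auto simp: subst_def)

lemma mem_subst_pow:
  assumes "A \<subseteq> arcs" "e \<in> arcs" "a \<in> (subst ^^ n) {e}"
  shows "a \<in> (subst ^^ n) A \<longleftrightarrow> e \<in> A"
  using assms(3)
proof (induction n arbitrary: a)
  case (Suc n)
  then obtain b where b: "b \<in> (subst ^^ n) {e}" "a \<in> children b"
    unfolding subst_pow_Suc by blast
  then have "b \<in> arcs" using subst_pow_arcs[of "{e}" n] assms(2) by auto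
  then show ?case using mem_subst[OF subst_pow_arcs[OF assms(1)] _ b(2)] Suc.IH[OF b(1)] by simp
qed auto

text \<open>
  The \<open>m^n\<close> descendants of one arc are distinct and lie in a disc of radius at most
  \<open>n m max(1,\<bar>z\<bar>)^n\<close>, and the number of arcs in a disc is at most of the
  order of the square of its radius.
\<close>

lemma norm_z_ge: "m \<le> cmod z ^ 2"
proof (rule ccontr)
  assume less: "\<not> m \<le> cmod z ^ 2"
  define c where "c = max 1 (cmod z)"
  have c: "1 \<le> c" "cmod z \<le> c" by (auto simp: c_def)
  have "c ^ 2 < m" using less two_le by (auto simp: c_def max_def)
  have bound: "(m / c ^ 2) ^ n \<le> 4 * (2 * m * real n + 1) ^ 2" for n
  proof -
    define \<rho> where "\<rho> = real m * (\<Sum>l<n. cmod z ^ l)"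
    have \<rho>: "0 \<le> \<rho>" by (simp add: \<rho>_def sum_nonneg)
    have "(\<Sum>l<n. cmod z ^ l) \<le> (\<Sum>l<n. c ^ n)"
    proof (intro sum_mono)
      fix l assume "l \<in> {..<n}"
      then have "cmod z ^ l \<le> c ^ l" "c ^ l \<le> c ^ n" using c by (auto intro!: power_mono power_increasing)
      then show "cmod z ^ l \<le> c ^ n" by linarith
    qed
    then have "\<rho> \<le> m * (n * c ^ n)" unfolding \<rho>_def by (intro mult_left_mono) auto
    moreover have "1 \<le> c ^ n" using c by simp
    ultimately have "2 * \<rho> + 1 \<le> (2 * m * real n + 1) * c ^ n" by (simp add: algebra_simps)
    then have sq: "(2 * \<rho> + 1) ^ 2 \<le> ((2 * m * real n + 1) * c ^ n) ^ 2" using \<rho> by (intro power_mono) auto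
    have e: "{(0, 1)} \<subseteq> arcs" using exists_arc by simp
    have "(subst ^^ n) {(0, 1)} \<subseteq> near 0 \<rho>"
    proof
      fix a assume a: "a \<in> (subst ^^ n) {(0, 1)}"
      then show "a \<in> near 0 \<rho>"
        using descendants_near'[OF exists_arc a] subst_pow_arcs[OF e, of n] by (auto simp: near_def \<rho>_def)
    qed
    then have "m ^ n \<le> card (near 0 \<rho>)"
      using card_subst_pow[OF _ e, of n] card_mono[OF card_near(1)[OF \<rho>], of "(subst ^^ n) {(0, 1)}" 0] by simp
    then have "real m ^ n \<le> 4 * (2 * \<rho> + 1) ^ 2"
      using card_near(2)[OF \<rho>, of 0] by (metis of_nat_le_iff of_nat_power order_trans)
    also have "\<dots> \<le> 4 * ((2 * m * real n + 1) * c ^ n) ^ 2" using sq by simp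
    also have "\<dots> = (4 * (2 * m * real n + 1) ^ 2) * (c ^ 2) ^ n"
      by (simp add: power_mult_distrib flip: power_mult) (simp add: mult.commute)
    finally have "real m ^ n \<le> (4 * (2 * m * real n + 1) ^ 2) * (c ^ 2) ^ n" .
    moreover have "0 < (c ^ 2) ^ n" using c by simp
    ultimately show ?thesis by (simp add: power_divide divide_le_eq)
  qed
  have "1 < m / c ^ 2" using \<open>c ^ 2 < m\<close> c by (simp add: less_divide_eq)
  then obtain n where "4 * (2 * m * real n + 1) ^ 2 < (m / c ^ 2) ^ n"
    using exp_beats_square[of "m / c ^ 2" m] by auto
  then show False using bound[of n] by simp
qed

text \<open>
  Descendants in step \<open>n\<close> stay within \<open>spread * \<bar>z\<bar>^n\<close> of
  the scaled ancestor.
\<close>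

definition spread :: real where
  "spread = m / (cmod z - 1)"

lemma norm_z_gt: "1 < cmod z"
proof -
  have "(2::real) \<le> m" using two_le by simp
  then have "1 ^ 2 < cmod z ^ 2" using norm_z_ge by simp
  then show ?thesis by (rule power_less_imp_less_base) simp
qed

lemma spread_pos: "0 < spread"
  using norm_z_gt by (simp add: spread_def)

lemma descendants_near:
  assumes "e \<in> arcs" "a \<in> (subst ^^ n) {e}"
  shows "cmod (fst a - z ^ n * fst e) \<le> spread * cmod z ^ n"
proof -
  have "(\<Sum>l<n. cmod z ^ l) = (cmod z ^ n - 1) / (cmod z - 1)"
    using norm_z_gt by (simp add: geometric_sum)
  also have "\<dots> \<le> cmod z ^ n / (cmod z - 1)" using norm_z_gt by (simp add: divide_right_mono)
  finally have "m * (\<Sum>l<n. cmod z ^ l) \<le> m * (cmod z ^ n / (cmod z - 1))" by (intro mult_left_mono) auto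
  then show ?thesis using descendants_near'[OF assms] by (simp add: spread_def)
qed

text \<open>
  Conversely, the arcs in a disc of radius \<open>\<bar>z\<bar>^n\<close> are of the order of
  \<open>\<bar>z\<bar>^(2n)\<close> many, and all of them descend from boundedly many arcs.
\<close>

lemma norm_z: "cmod z ^ 2 = m"
proof (rule ccontr)
  assume "cmod z ^ 2 \<noteq> m"
  then have "m < cmod z ^ 2" using norm_z_ge by simp
  define N where "N = near 0 (1 + spread)"
  have N: "finite N" "N \<subseteq> arcs" using card_near(1)[of "1 + spread" 0] spread_pos by (auto simp: N_def near_def)
  have bound: "(cmod z ^ 2 / m) ^ n \<le> 4 * card N" for n
  proof -
    have "near 0 (cmod z ^ n) \<subseteq> (subst ^^ n) N"
    proof
      fix a assume a: "a \<in> near 0 (cmod z ^ n)"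
      then have "a \<in> (subst ^^ n) arcs" by (simp add: subst_all near_def)
      then obtain e where e: "e \<in> arcs" "a \<in> (subst ^^ n) {e}" by (rule ancestor)
      have "cmod (z ^ n * fst e) \<le> cmod (fst a) + cmod (fst a - z ^ n * fst e)"
        by (metis add_diff_cancel_left' diff_diff_eq2 norm_minus_commute norm_triangle_sub)
      also have "\<dots> \<le> cmod z ^ n + spread * cmod z ^ n" using a descendants_near[OF e] by (simp add: near_def)
      finally have "cmod z ^ n * cmod (fst e) \<le> cmod z ^ n * (1 + spread)" by (simp add: norm_mult norm_power algebra_simps)
      then have "cmod (fst e) \<le> 1 + spread" using z_nonzero by simp
      then have "{e} \<subseteq> N" using e by (simp add: N_def near_def)
      then show "a \<in> (subst ^^ n) N" using e(2) subst_pow_mono by blast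
    qed
    then have "card (near 0 (cmod z ^ n)) \<le> m ^ n * card N"
      using card_subst_pow[OF N, of n] card_mono by metis
    then have "(cmod z ^ n / 2) ^ 2 \<le> real m ^ n * card N"
      using card_near_ge[of "cmod z ^ n"] by (smt (verit) norm_ge_zero of_nat_le_iff of_nat_mult of_nat_power zero_le_power)
    then have "(cmod z ^ 2) ^ n \<le> real m ^ n * (4 * card N)"
      by (simp add: power_divide power_mult_distrib flip: power_mult) (simp add: mult_ac)
    then show ?thesis using m_pos by (simp add: power_divide divide_le_eq mult.commute)
  qed
  have "1 < cmod z ^ 2 / m" using \<open>m < cmod z ^ 2\<close> m_pos by (simp add: less_divide_eq)
  then obtain n where "4 * card N < (cmod z ^ 2 / m) ^ n" using real_arch_pow by blast
  then show False using bound[of n] by simp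
qed

end

section \<open>Sides separate, and large images have interior\<close>

context grid_substitution begin

text \<open>
  Two opposite turns translate an arc diagonally. If a set is invariant under turns near
  \<open>p\<close>, membership can be followed along such translations.
\<close>

lemma move_diagonally:
  assumes inv: "\<And>a s. a \<in> arcs \<Longrightarrow> cmod (fst a - p) \<le> \<rho> \<Longrightarrow> s \<in> quarter_turns \<Longrightarrow> a \<in> A \<longleftrightarrow> turn s a \<in> A"
    and t: "t \<in> quarter_turns"
  shows "(q, d) \<in> arcs \<Longrightarrow> cmod (q - p) + 2 * real n \<le> \<rho> \<Longrightarrow>
    (q + of_nat n * ((1 + t) * d), d) \<in> arcs \<and>
    ((q, d) \<in> A \<longleftrightarrow> (q + of_nat n * ((1 + t) * d), d) \<in> A)"
proof (induction n)
  case (Suc n)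
  let ?q = "q + of_nat n * ((1 + t) * d)"
  note t2 = quarter_turn_twice[OF t]
  have IH: "(?q, d) \<in> arcs" "(q, d) \<in> A \<longleftrightarrow> (?q, d) \<in> A" using Suc by auto
  have d: "cmod d = 1" using arcsD(4)[OF IH(1)] by simp
  have "cmod (1 + t) \<le> 2" using norm_triangle_ineq[of 1 t] quarter_turn_unit[OF t] by simp
  then have "cmod (?q - q) \<le> 2 * real n" using d by (simp add: norm_mult mult_left_mono mult.commute)
  moreover have "cmod (?q - p) \<le> cmod (?q - q) + cmod (q - p)"
    using norm_triangle_ineq[of "?q - q" "q - p"] by (simp only: diff_add_cancel add_diff_eq)
  ultimately have dist: "cmod (?q - p) \<le> \<rho> - 2" using Suc.prems(2) by simp
  moreover have "cmod (?q + d - p) \<le> cmod (?q - p) + 1"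
    using norm_triangle_ineq[of "?q - p" d] d by (simp add: algebra_simps)
  ultimately have "(?q, d) \<in> A \<longleftrightarrow> turn (- t) (turn t (?q, d)) \<in> A"
    using inv[OF IH(1) _ t] inv[OF turn_arc[OF IH(1) t] _ quarter_turn_minus[OF t]]
    by (auto simp: turn_def head_def)
  moreover have "turn (- t) (turn t (?q, d)) = (q + of_nat (Suc n) * ((1 + t) * d), d)"
    using quarter_turn_square[OF t] by (simp add: turn_def head_def algebra_simps t2)
  moreover have "turn (- t) (turn t (?q, d)) \<in> arcs"
    using IH(1) t turn_arc quarter_turn_minus by blast
  ultimately show ?case using IH(2) by simp
qed simp

lemma move_diagonally_int:
  fixes p q d t :: complex and \<rho> :: real and A :: "arc set" and k :: int
  assumes inv: "\<And>a s. a \<in> arcs \<Longrightarrow> cmod (fst a - p) \<le> \<rho> \<Longrightarrow> s \<in> quarter_turns \<Longrightarrow> a \<in> A \<longleftrightarrow> turn s a \<in> A"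
    and t: "t \<in> quarter_turns"
    and "(q, d) \<in> arcs" "(q + complex_of_int k * ((1 + t) * d), d) \<in> arcs" "cmod (q - p) + 4 * \<bar>real_of_int k\<bar> \<le> \<rho>"
  shows "(q, d) \<in> A \<longleftrightarrow> (q + complex_of_int k * ((1 + t) * d), d) \<in> A"
proof (cases "0 \<le> k")
  case True
  then show ?thesis
    using move_diagonally[OF inv t, where q = q and d = d and n = "nat k"] assms(3,5) by (simp add: of_nat_nat)
next
  case False
  let ?q = "q + complex_of_int k * ((1 + t) * d)"
  have d: "cmod d = 1" using arcsD(4)[OF assms(3)] by simp
  have "cmod (1 + t) \<le> 2" using norm_triangle_ineq[of 1 t] quarter_turn_unit[OF t] by simp
  then have "cmod (?q - q) \<le> 2 * \<bar>real_of_int k\<bar>" using d by (simp add: norm_mult mult_left_mono mult.commute)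
  moreover have "cmod (?q - p) \<le> cmod (?q - q) + cmod (q - p)"
    using norm_triangle_ineq[of "?q - q" "q - p"] by (simp only: diff_add_cancel add_diff_eq)
  ultimately have dist: "cmod (?q - p) + 2 * real (nat (- k)) \<le> \<rho>" using assms(5) False by simp
  moreover have "?q + of_nat (nat (- k)) * ((1 + t) * d) = q" using False by (simp add: of_nat_nat)
  moreover have "(?q, d) \<in> A \<longleftrightarrow> (?q + of_nat (nat (- k)) * ((1 + t) * d), d) \<in> A"
    by (rule conjunct2[OF move_diagonally[OF inv t assms(4) dist]])
  ultimately show ?thesis by (simp only:)
qed

text \<open>
  Without sides near \<open>e\<close>, membership in \<open>A\<close> is invariant under turns
  there. Up to three left turns give \<open>e'\<close> the direction of \<open>e\<close>; the
  remaining displacement joins points of equal parity and hence is an integer combination of the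
  two diagonals. The constants in \<open>8 * R + 30\<close> only have to cover this walk.
\<close>

lemma side_near:
  assumes "e \<in> arcs" "e' \<in> arcs" "e \<in> A" "e' \<notin> A" "cmod (fst e' - fst e) \<le> R"
  shows "\<exists>a t. (a, t) \<in> sides A \<and> cmod (fst a - fst e) \<le> 8 * R + 30"
proof (rule ccontr)
  let ?\<rho> = "8 * R + 30"
  obtain p d where e: "e = (p, d)" by fastforce
  assume none: "\<not> ?thesis"
  have inv: "a \<in> A \<longleftrightarrow> turn s a \<in> A" if "a \<in> arcs" "cmod (fst a - p) \<le> ?\<rho>" "s \<in> quarter_turns" for a s
  proof -
    have "(a, s) \<notin> sides A" using none that(2) unfolding e fst_conv by blast
    then show ?thesis using that by (simp add: sides_def corners_def)
  qed
  have i: "\<i> \<in> quarter_turns" "- \<i> \<in> quarter_turns" by (auto simp: quarter_turns_def)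
  have R: "0 \<le> R" using assms(5) norm_ge_zero order_trans by blast
  have du: "d \<in> units" using arcsD(2)[OF assms(1)] e by simp
  have turn: "turn \<i> b \<in> arcs \<and> turn \<i> b \<notin> A \<and> cmod (fst (turn \<i> b) - p) \<le> B + 1"
    if "b \<in> arcs" "b \<notin> A" "cmod (fst b - p) \<le> B" "B \<le> R + 3" for b B
  proof -
    have "cmod (fst b - p + snd b) \<le> B + 1"
      using norm_triangle_ineq[of "fst b - p" "snd b"] arcsD(4)[OF that(1)] that(3) by simp
    then show ?thesis
      using inv[OF that(1) _ i(1)] that turn_arc[OF that(1) i(1)] R by (simp add: turn_def head_def algebra_simps)
  qed
  define b1 b2 b3 where "b1 = turn \<i> e'" and "b2 = turn \<i> b1" and "b3 = turn \<i> b2"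
  have b: "b1 \<in> arcs \<and> b1 \<notin> A \<and> cmod (fst b1 - p) \<le> R + 1"
    "b2 \<in> arcs \<and> b2 \<notin> A \<and> cmod (fst b2 - p) \<le> R + 2"
    "b3 \<in> arcs \<and> b3 \<notin> A \<and> cmod (fst b3 - p) \<le> R + 3"
  proof -
    show 1: "b1 \<in> arcs \<and> b1 \<notin> A \<and> cmod (fst b1 - p) \<le> R + 1"
      unfolding b1_def using turn[of e' R] assms e by simp
    show 2: "b2 \<in> arcs \<and> b2 \<notin> A \<and> cmod (fst b2 - p) \<le> R + 2"
      unfolding b2_def using turn[of b1 "R + 1"] 1 by simp
    show "b3 \<in> arcs \<and> b3 \<notin> A \<and> cmod (fst b3 - p) \<le> R + 3"
      unfolding b3_def using turn[of b2 "R + 2"] 2 by simp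
  qed
  have "snd e' \<in> units" using arcsD(2)[OF assms(2)] .
  then have "snd e' = d \<or> snd b1 = d \<or> snd b2 = d \<or> snd b3 = d"
    using du unfolding b1_def b2_def b3_def turn_def units_def
    by (elim insertE emptyE) (simp_all add: mult.assoc[symmetric])
  then obtain f where f: "f \<in> arcs" "f \<notin> A" "cmod (fst f - p) \<le> R + 3" "snd f = d"
    using b assms e by (smt (verit) fst_conv)
  define w where "w = (fst f - p) / d"
  have d0: "d \<noteq> 0" using du unit_nonzero by blast
  have "1 / d \<in> units" using du by (auto simp: units_def divide_simps)
  have pg: "p \<in> grid_points" "fst f \<in> grid_points" using arcsD(1) f assms(1) e by (metis fst_conv)+
  have w: "w = (1 / d) * (fst f - p)" by (simp add: w_def)
  have wg: "w \<in> grid_points" unfolding w using pg \<open>1 / d \<in> units\<close> units_grid by blast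
  then obtain x y :: int where xy: "w = Complex x y" using grid_point_cases by blast
  have "even_point p \<longleftrightarrow> even_point (fst f)" using arcsD(5)[OF f(1)] arcsD(5)[OF assms(1)] e f(4) by simp
  then have "even_point (fst f - p)"
    using even_point_add[of "fst f" "- p"] pg even_point_minus[of p] by simp
  then have "even_point w" unfolding w using even_point_mult pg \<open>1 / d \<in> units\<close> units_grid by blast
  then have "even (x + y)" using xy by simp
  then obtain j where j: "x + y = 2 * j" by (rule evenE)
  define k where "k = x - j"
  have "w = of_int j * (1 + \<i>) + of_int k * (1 + - \<i>)"
  proof -
    have "of_int y = 2 * (of_int j :: real) - of_int x" using j by (simp flip: of_int_add)
    then show ?thesis unfolding xy k_def complex_eq_iff by simp
  qed
  then have ff: "fst f = (p + of_int j * ((1 + \<i>) * d)) + of_int k * ((1 + - \<i>) * d)"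
    using d0 by (simp add: w_def field_simps)
  have cw: "cmod w \<le> R + 3" using f(3) du by (simp add: w_def norm_divide)
  then have "\<bar>real_of_int x\<bar> \<le> R + 3" "\<bar>real_of_int y\<bar> \<le> R + 3"
    using abs_Re_le_cmod[of w] abs_Im_le_cmod[of w] xy by auto
  moreover have "2 * real_of_int j = real_of_int x + real_of_int y" "2 * real_of_int k = real_of_int x - real_of_int y"
    proof -
    show j2: "2 * real_of_int j = real_of_int x + real_of_int y" using j by (simp flip: of_int_add)
    then show "2 * real_of_int k = real_of_int x - real_of_int y" unfolding k_def by simp
  qed
  ultimately have jk: "\<bar>real_of_int j\<bar> \<le> R + 3" "\<bar>real_of_int k\<bar> \<le> R + 3" by linarith+
  let ?q = "p + of_int j * ((1 + \<i>) * d)"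
  have "even_point ((1 + \<i>) * d)" "(1 + \<i>) * d \<in> grid_points"
    using du even_point_mult[of "1 + \<i>" d] units_grid even_point_add[of 1 \<i>] even_point_unit by (auto simp: units_def)
  then have "even_point (of_int j * ((1 + \<i>) * d))" "of_int j * ((1 + \<i>) * d) \<in> grid_points"
    using even_point_mult[of "of_int j" "(1 + \<i>) * d"] by auto
  then have q_arc: "(?q, d) \<in> arcs"
    using assms(1) e even_point_add[of p "of_int j * ((1 + \<i>) * d)"] pg by (auto simp: arcs_def)
  have "cmod (1 + \<i>) \<le> 2" using norm_triangle_ineq[of 1 \<i>] by simp
  then have "cmod (?q - p) \<le> 2 * \<bar>real_of_int j\<bar>" using du by (simp add: norm_mult mult_left_mono mult.commute)
  then have "cmod (?q - p) + 4 * \<bar>real_of_int k\<bar> \<le> ?\<rho>" using jk R by linarith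
  then have "(?q, d) \<in> A \<longleftrightarrow> (fst f, d) \<in> A"
    using move_diagonally_int[OF inv i(2) q_arc, where k = k] f(1,4) ff by (metis prod.collapse)
  moreover have "(p, d) \<in> A \<longleftrightarrow> (?q, d) \<in> A"
    using move_diagonally_int[OF inv i(1) _ q_arc] assms(1) e jk R by simp
  ultimately show False using assms(3) e f by (metis prod.collapse)
qed

lemma finite_sides_single: "finite (sides {e}) \<and> card (sides {e}) \<le> 4"
proof -
  let ?p = "\<lambda>t. (turn t (turn t (turn t e)), t)"
  have sub: "sides {e} \<subseteq> {(e, \<i>), (e, - \<i>), ?p \<i>, ?p (- \<i>)}"
  proof
    fix x assume "x \<in> sides {e}"
    then obtain a t where x: "x = (a, t)" "t \<in> quarter_turns" "a = e \<or> turn t a = e"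
      by (auto simp: sides_def corners_def)
    then show "x \<in> {(e, \<i>), (e, - \<i>), ?p \<i>, ?p (- \<i>)}"
      using turn4[OF x(2), of a] by (auto simp: quarter_turns_def)
  qed
  have "card {(e, \<i>), (e, - \<i>), ?p \<i>, ?p (- \<i>)} \<le> 4" by (simp add: card_insert_if)
  then show ?thesis using sub by (meson card_mono finite.emptyI finite.insertI finite_subset le_trans)
qed

text \<open>
  Descendants close to foreign arcs are close to a side of the image of \<open>e\<close> in step
  \<open>k\<close>. There are at most \<open>4 * side_count^k\<close> sides, each close to
  boundedly many arcs, but \<open>m^k\<close> descendants, and \<open>side_count < m\<close>.
\<close>

lemma interior_descendant:
  assumes "0 \<le> R"
  obtains k where "\<And>e. e \<in> arcs \<Longrightarrow>
    \<exists>f\<in>(subst ^^ k) {e}. \<forall>a\<in>arcs. cmod (fst a - fst f) \<le> R \<longrightarrow> a \<in> (subst ^^ k) {e}"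
proof -
  define \<rho> where "\<rho> = 8 * R + 30"
  define N where "N = 4 * (2 * \<rho> + 1) ^ 2"
  have "0 \<le> \<rho>" using assms by (simp add: \<rho>_def)
  have "1 < real m / real side_count" using side_count_less side_count_pos by (simp add: less_divide_eq)
  then obtain k where "4 * N < (real m / real side_count) ^ k" using real_arch_pow by blast
  then have k: "real side_count ^ k * 4 * N < real m ^ k"
    using side_count_pos by (simp add: power_divide less_divide_eq mult_ac)
  have "\<exists>f\<in>(subst ^^ k) {e}. \<forall>a\<in>arcs. cmod (fst a - fst f) \<le> R \<longrightarrow> a \<in> (subst ^^ k) {e}"
    if e: "e \<in> arcs" for e
  proof (rule ccontr)
    let ?E = "(subst ^^ k) {e}"
    assume none: "\<not> ?thesis"
    have E: "?E \<subseteq> arcs" using e by (intro subst_pow_arcs) simp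
    have S: "finite (sides ?E)" "card (sides ?E) \<le> side_count ^ k * 4"
    proof -
      have "sides {e} \<subseteq> corners" by (auto simp: sides_def)
      then have "finite ((subst_corners ^^ k) (sides {e})) \<and>
          card ((subst_corners ^^ k) (sides {e})) = side_count ^ k * card (sides {e})"
        using card_subst_corners_pow finite_sides_single by blast
      then show "finite (sides ?E)" "card (sides ?E) \<le> side_count ^ k * 4"
        using sides_subst_pow[of "{e}" k] e finite_sides_single[of e] by auto
    qed
    have "?E \<subseteq> (\<Union>x\<in>sides ?E. near (fst (fst x)) \<rho>)"
    proof
      fix f assume f: "f \<in> ?E"
      then obtain a where a: "a \<in> arcs" "cmod (fst a - fst f) \<le> R" "a \<notin> ?E" using none by blast
      then obtain b t where "(b, t) \<in> sides ?E" "cmod (fst b - fst f) \<le> \<rho>"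
        using side_near[of f a ?E R] f E unfolding \<rho>_def by blast
      then show "f \<in> (\<Union>x\<in>sides ?E. near (fst (fst x)) \<rho>)"
        using f E by (force simp: near_def norm_minus_commute)
    qed
    then have "card ?E \<le> card (\<Union>x\<in>sides ?E. near (fst (fst x)) \<rho>)"
      using S card_near(1)[OF \<open>0 \<le> \<rho>\<close>] by (intro card_mono) auto
    also have "\<dots> \<le> (\<Sum>x\<in>sides ?E. card (near (fst (fst x)) \<rho>))" by (rule card_UN_le[OF S(1)])
    finally have "real (card ?E) \<le> (\<Sum>x\<in>sides ?E. real (card (near (fst (fst x)) \<rho>)))"
      by (metis of_nat_le_iff of_nat_sum)
    also have "\<dots> \<le> (\<Sum>x\<in>sides ?E. N)" unfolding N_def using card_near(2)[OF \<open>0 \<le> \<rho>\<close>] by (intro sum_mono) auto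
    also have "\<dots> = real (card (sides ?E)) * N" by simp
    also have "\<dots> \<le> real (side_count ^ k * 4) * N" using S(2) by (intro mult_right_mono) (auto simp: N_def simp del: of_nat_mult)
    finally have "real m ^ k \<le> real side_count ^ k * 4 * N" using card_subst_pow[of "{e}" k] e by simp
    then show False using k by simp
  qed
  then show ?thesis using that by blast
qed

end

section \<open>The limit tile and its frontier\<close>

context grid_substitution begin

text \<open>
  The points that stay close to the arcs of every step. Descendants start near their scaled
  ancestors, so the tolerance \<open>spread / \<bar>z\<bar>^n\<close> is the one that makes all
  scaled starting points belong to the set.
\<close>

definition limit_tile :: "arc set \<Rightarrow> complex set" where
  "limit_tile A = {x. \<forall>n. \<exists>a\<in>(subst ^^ n) A. cmod (x - fst a / z ^ n) \<le> spread / cmod z ^ n}"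

lemma descendants_near_scaled:
  assumes "b \<in> arcs" "a \<in> (subst ^^ j) {b}"
  shows "cmod (fst a / z ^ (k + j) - fst b / z ^ k) \<le> spread / cmod z ^ k"
proof -
  have "fst a / z ^ (k + j) - fst b / z ^ k = (fst a - z ^ j * fst b) / z ^ (k + j)"
    using z_nonzero by (simp add: power_add field_simps)
  then have "cmod (fst a / z ^ (k + j) - fst b / z ^ k) \<le> spread * cmod z ^ j / cmod z ^ (k + j)"
    using descendants_near[OF assms] by (simp add: norm_divide norm_power divide_right_mono)
  then show ?thesis using z_nonzero by (simp add: power_add)
qed

lemma start_descendant: "a \<in> (subst ^^ n) A \<Longrightarrow> (z ^ j * fst a, snd a) \<in> (subst ^^ (n + j)) A"
proof (induction j)
  case (Suc j)
  have "ch (z ^ j * fst a, snd a) 0 = (z ^ Suc j * fst a, snd a)"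
    by (simp add: child_def first_dir)
  then have "(z ^ Suc j * fst a, snd a) \<in> children (z ^ j * fst a, snd a)"
    unfolding children_def by (metis image_eqI lessThan_iff m_pos)
  then show ?case using Suc unfolding add_Suc_right subst_pow_Suc by blast
qed simp

text \<open>
  The start of an arc is, up to scaling, also the start of its first child, so it persists in
  all later steps.
\<close>

lemma vertex_in_tile:
  assumes "A \<subseteq> arcs" "a \<in> (subst ^^ n) A"
  shows "fst a / z ^ n \<in> limit_tile A"
  unfolding limit_tile_def
proof (clarify)
  fix k
  show "\<exists>b\<in>(subst ^^ k) A. cmod (fst a / z ^ n - fst b / z ^ k) \<le> spread / cmod z ^ k"
  proof (cases "k \<le> n")
    case True
    then have "a \<in> (subst ^^ (n - k)) ((subst ^^ k) A)"
      using assms(2) by (metis comp_apply funpow_add le_add_diff_inverse2)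
    then obtain b where b: "b \<in> (subst ^^ k) A" "a \<in> (subst ^^ (n - k)) {b}" by (rule ancestor)
    then have "b \<in> arcs" using subst_pow_arcs[OF assms(1)] by blast
    then show ?thesis using descendants_near_scaled[OF _ b(2), of k] b(1) True by auto
  next
    case False
    then have k: "n + (k - n) = k" by simp
    have "(z ^ (k - n) * fst a, snd a) \<in> (subst ^^ k) A" using start_descendant[OF assms(2), of "k - n"] k by simp
    moreover have "z ^ k = z ^ n * z ^ (k - n)" using k by (metis power_add)
    then have "fst a / z ^ n = (z ^ (k - n) * fst a) / z ^ k" using z_nonzero by simp
    ultimately show ?thesis using spread_pos by (intro bexI) (auto simp: z_nonzero)
  qed
qed

lemma compact_limit_tile:
  assumes "finite A" "A \<subseteq> arcs"
  shows "compact (limit_tile A)"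
proof -
  have fin: "finite ((subst ^^ n) A)" for n using card_subst_pow assms by blast
  have eq: "limit_tile A = (\<Inter>n. \<Union>a\<in>(subst ^^ n) A. cball (fst a / z ^ n) (spread / cmod z ^ n))"
    by (auto simp: limit_tile_def dist_norm norm_minus_commute)
  have "compact (\<Union>a\<in>(subst ^^ n) A. cball (fst a / z ^ n) (spread / cmod z ^ n))" for n
    using fin by (intro compact_UN) auto
  then show ?thesis unfolding eq
    by (intro compact_Inter) auto
qed

lemma exists_near_arc:
  obtains f where "f \<in> arcs" "cmod (fst f - w) \<le> 2"
proof -
  let ?g = "Complex (of_int \<lfloor>Re w\<rfloor>) (of_int \<lfloor>Im w\<rfloor>)"
  let ?f = "(?g, if even_point ?g then 1 else \<i>)"
  have "?f \<in> arcs" by (auto simp: arcs_def units_def unit_distinct)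
  moreover have "\<bar>of_int \<lfloor>Re w\<rfloor> - Re w\<bar> \<le> 1" "\<bar>of_int \<lfloor>Im w\<rfloor> - Im w\<bar> \<le> 1" by linarith+
  then have "cmod (fst ?f - w) \<le> 2" using cmod_le[of "?g - w"] by simp
  ultimately show ?thesis using that by blast
qed

lemma norm_z_pow_pos [simp]: "0 < cmod z ^ n"
  using z_nonzero by simp

lemma norm_div_pow: "cmod (x / z ^ n - y / z ^ n) = cmod (x - y) / cmod z ^ n"
  by (simp add: norm_divide norm_power flip: diff_divide_distrib)

text \<open>
  Near \<open>x\<close> there is an arc of the set in step \<open>n\<close> and a point
  \<open>y\<close> outside the tile. Arcs of a late step \<open>k\<close> next to
  \<open>y\<close> do not belong to the set, so their ancestor in step \<open>n\<close> does not
  belong to it either. Between the two arcs of step \<open>n\<close> there is a side.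
\<close>

lemma frontier_near_side:
  assumes A: "finite A" "A \<subseteq> arcs" and x: "x \<in> frontier (limit_tile A)"
  shows "\<exists>a t. (a, t) \<in> sides ((subst ^^ n) A) \<and>
    cmod (x - fst a / z ^ n) \<le> (17 * spread + 54) / cmod z ^ n"
proof -
  let ?T = "limit_tile A" and ?E = "\<lambda>n. (subst ^^ n) A" and ?c = "cmod z ^ n"
  have T: "closed ?T" using compact_limit_tile[OF A] compact_imp_closed by blast
  have E: "?E k \<subseteq> arcs" for k using A by (rule_tac subst_pow_arcs)
  have "x \<in> ?T" using x T frontier_subset_eq by blast
  then obtain e where e: "e \<in> ?E n" "cmod (x - fst e / z ^ n) \<le> spread / ?c"
    unfolding limit_tile_def by blast
  have "x \<in> closure (- ?T)" using x by (simp add: frontier_closures)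
  then obtain y where y: "y \<notin> ?T" "dist y x < 1 / ?c"
    using closure_approachable[of x "- ?T"] norm_z_pow_pos[of n] by (metis ComplD zero_less_divide_1_iff)
  obtain \<epsilon> where \<epsilon>: "0 < \<epsilon>" "ball y \<epsilon> \<subseteq> - ?T"
    using T y(1) by (metis ComplI open_Compl open_contains_ball)
  obtain k0 where k0: "2 / \<epsilon> < cmod z ^ k0" using real_arch_pow norm_z_gt by blast
  define k where "k = n + k0"
  have "1 \<le> ?c" using norm_z_gt by (simp add: one_le_power)
  then have kk: "cmod z ^ k0 \<le> cmod z ^ k" "?c \<le> cmod z ^ k"
    using norm_z_gt by (auto simp: k_def intro: power_increasing)
  have small: "2 / cmod z ^ k < \<epsilon>"
  proof -
    have "2 / \<epsilon> < cmod z ^ k" using k0 kk by linarith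
    then show ?thesis using \<epsilon>(1) by (simp add: field_simps)
  qed
  obtain f where f: "f \<in> arcs" "cmod (fst f - z ^ k * y) \<le> 2" by (rule exists_near_arc)
  have fy: "cmod (fst f / z ^ k - y) \<le> 2 / cmod z ^ k"
    using f(2) norm_div_pow[of "fst f" k "z ^ k * y"] z_nonzero by (simp add: divide_right_mono)
  have "fst f / z ^ k \<notin> ?T" 
  proof -
    have "fst f / z ^ k \<in> ball y \<epsilon>" using fy small by (simp add: dist_norm norm_minus_commute)
    then show ?thesis using \<epsilon>(2) by blast
  qed
  then have fE: "f \<notin> ?E k" using vertex_in_tile[OF A(2)] by blast
  obtain e' where e': "e' \<in> arcs" "f \<in> (subst ^^ k0) {e'}"
    using f(1) subst_all[of k0] ancestor by metis
  have "?E k = (subst ^^ k0) (?E n)" by (simp add: k_def add.commute[of n] funpow_add)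
  then have e'E: "e' \<notin> ?E n" using mem_subst_pow[OF E e'] fE by simp
  have ef: "cmod (fst f / z ^ k - fst e' / z ^ n) \<le> spread / ?c"
    using descendants_near_scaled[OF e', of n] by (simp add: k_def)
  have "2 / cmod z ^ k \<le> 2 / ?c" using kk(2) by (intro divide_left_mono) (auto simp: z_nonzero)
  then have "cmod (y - fst e' / z ^ n) \<le> spread / ?c + 2 / ?c"
    using ef fy norm_triangle_ineq[of "y - fst f / z ^ k" "fst f / z ^ k - fst e' / z ^ n"]
    by (simp add: norm_minus_commute)
  moreover have "cmod (x - y) \<le> 1 / ?c" using y(2) by (simp add: dist_norm norm_minus_commute)
  ultimately have xe': "cmod (x - fst e' / z ^ n) \<le> (spread + 3) / ?c"
    using norm_triangle_ineq[of "x - y" "y - fst e' / z ^ n"] by (simp add: add_divide_distrib)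
  then have "cmod (fst e' / z ^ n - fst e / z ^ n) \<le> (spread + 3) / ?c + spread / ?c"
    using e(2) norm_triangle_ineq4[of "x - fst e / z ^ n" "x - fst e' / z ^ n"] by simp
  then have "cmod (fst e' - fst e) / ?c \<le> (2 * spread + 3) / ?c"
    by (simp only: norm_div_pow) (simp add: add_divide_distrib)
  then have "cmod (fst e' - fst e) \<le> 2 * spread + 3" using norm_z_pow_pos[of n] by (simp add: divide_le_cancel)
  then obtain a t where a: "(a, t) \<in> sides (?E n)" "cmod (fst a - fst e) \<le> 8 * (2 * spread + 3) + 30"
    using side_near[of e e' "?E n"] e(1) E e'(1) e'E by blast
  have "cmod (fst a / z ^ n - fst e / z ^ n) \<le> (16 * spread + 54) / ?c"
    unfolding norm_div_pow using a(2) by (intro divide_right_mono) auto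
  then have "cmod (x - fst a / z ^ n) \<le> (17 * spread + 54) / ?c"
    using e(2) norm_triangle_ineq4[of "x - fst e / z ^ n" "fst a / z ^ n - fst e / z ^ n"]
    by (simp add: add_divide_distrib)
  then show ?thesis using a(1) by blast
qed

text \<open>
  One arc of the side starts in the tile. The descendants of the other arc are foreign to the
  set; one of them is surrounded by relatives so widely that its start lies outside the tile.
  The segment between the two points meets the frontier.
\<close>

lemma side_near_frontier:
  assumes A: "finite A" "A \<subseteq> arcs" and side: "(a, t) \<in> sides ((subst ^^ n) A)"
  shows "\<exists>x\<in>frontier (limit_tile A). cmod (x - fst a / z ^ n) \<le> (spread + 2) / cmod z ^ n"
proof -
  let ?T = "limit_tile A" and ?E = "\<lambda>n. (subst ^^ n) A" and ?c = "cmod z ^ n"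
  have E: "?E k \<subseteq> arcs" for k using A by (rule_tac subst_pow_arcs)
  obtain k where interior: "\<And>e. e \<in> arcs \<Longrightarrow>
      \<exists>f\<in>(subst ^^ k) {e}. \<forall>a\<in>arcs. cmod (fst a - fst f) \<le> spread \<longrightarrow> a \<in> (subst ^^ k) {e}"
    using interior_descendant[of spread] spread_pos by auto
  have a: "a \<in> arcs" "t \<in> quarter_turns" "a \<in> ?E n \<longleftrightarrow> turn t a \<notin> ?E n"
    using side by (auto simp: sides_def corners_def)
  have ta: "turn t a \<in> arcs" using a turn_arc by simp
  have "cmod (fst (turn t a) - fst a) = 1" using arcsD(4)[OF a(1)] by (simp add: turn_def head_def)
  then obtain g g' where g: "g \<in> ?E n" "g' \<notin> ?E n" "g' \<in> arcs"
    "cmod (fst g - fst g') \<le> 1" "cmod (fst g - fst a) \<le> 1"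
  proof (cases "a \<in> ?E n")
    case True
    then show ?thesis using that[of a "turn t a"] a ta \<open>cmod _ = 1\<close> by (simp add: norm_minus_commute)
  next
    case False
    then show ?thesis using that[of "turn t a" a] a ta \<open>cmod _ = 1\<close> by simp
  qed
  let ?p = "fst g / z ^ n"
  have p: "?p \<in> ?T" using vertex_in_tile[OF A(2) g(1)] .
  obtain f where f: "f \<in> (subst ^^ k) {g'}"
    "\<And>b. b \<in> arcs \<Longrightarrow> cmod (fst b - fst f) \<le> spread \<Longrightarrow> b \<in> (subst ^^ k) {g'}"
    using interior[OF g(3)] by blast
  define y where "y = fst f / z ^ (n + k)"
  have "y \<notin> ?T"
  proof
    assume "y \<in> ?T"
    then obtain b where b: "b \<in> ?E (n + k)" "cmod (y - fst b / z ^ (n + k)) \<le> spread / cmod z ^ (n + k)"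
      unfolding limit_tile_def by blast
    then have "cmod (fst f - fst b) \<le> spread"
      unfolding y_def norm_div_pow using norm_z_pow_pos[of "n + k"] by (simp add: divide_le_cancel)
    then have "b \<in> (subst ^^ k) {g'}" using f(2)[of b] subsetD[OF E b(1)] by (simp add: norm_minus_commute)
    moreover have "b \<in> (subst ^^ k) (?E n)" using b(1) by (simp add: add.commute[of n] funpow_add)
    ultimately show False using mem_subst_pow[OF E g(3)] g(2) by blast
  qed
  then have "closed_segment ?p y \<inter> ?T \<noteq> {}" "closed_segment ?p y - ?T \<noteq> {}" using p by auto
  then obtain x where x: "x \<in> closed_segment ?p y" "x \<in> frontier ?T"
    using connected_Int_frontier[OF connected_segment(1)] by blast
  have "cmod (y - fst g' / z ^ n) \<le> spread / ?c"
    using descendants_near_scaled[OF g(3) f(1), of n] by (simp add: y_def)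
  moreover have "cmod (?p - fst g' / z ^ n) \<le> 1 / ?c"
    unfolding norm_div_pow using g(4) by (intro divide_right_mono) auto
  ultimately have "cmod (y - ?p) \<le> (spread + 1) / ?c"
    using norm_triangle_ineq4[of "y - fst g' / z ^ n" "?p - fst g' / z ^ n"] by (simp add: add_divide_distrib)
  moreover have "cmod (x - ?p) \<le> cmod (y - ?p)" using segment_bound(1)[OF x(1)] .
  moreover have "cmod (?p - fst a / z ^ n) \<le> 1 / ?c"
    unfolding norm_div_pow using g(5) by (intro divide_right_mono) auto
  ultimately have "cmod (x - fst a / z ^ n) \<le> (spread + 1) / ?c + 1 / ?c"
    using norm_triangle_ineq[of "x - ?p" "?p - fst a / z ^ n"] by simp
  then have "cmod (x - fst a / z ^ n) \<le> (spread + 2) / ?c" by (simp add: add_divide_distrib)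
  then show ?thesis using x(2) by blast
qed

lemma subst_corners_pow_Suc: "(subst_corners ^^ Suc n) X = (\<Union>c\<in>(subst_corners ^^ n) X. child_corners c)"
  by (simp add: subst_corners_def[of "(subst_corners ^^ n) X"])

lemma corner_descendants:
  assumes "(a, s) \<in> (subst_corners ^^ j) {(e, t)}"
  shows "s = t \<and> a \<in> (subst ^^ j) {e, turn t e} \<and> turn t a \<in> (subst ^^ j) {e, turn t e}"
  using assms
proof (induction j arbitrary: a s)
  case (Suc j)
  then obtain b r where b: "(b, r) \<in> (subst_corners ^^ j) {(e, t)}" "(a, s) \<in> child_corners (b, r)"
    unfolding subst_corners_pow_Suc by fast
  then have "r = t" "b \<in> (subst ^^ j) {e, turn t e}" "turn t b \<in> (subst ^^ j) {e, turn t e}"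
    using Suc.IH by auto
  moreover have "s = r" "a \<in> children b \<union> children (turn r b)" "turn r a \<in> children b \<union> children (turn r b)"
    using b(2) unfolding mem_child_corners by auto
  ultimately show ?case unfolding subst_pow_Suc by blast
qed simp

text \<open>
  A side of step \<open>n\<close> descends from a side of step \<open>k\<close> close to it.
  Near a given disc of radius \<open>\<bar>z\<bar>^(-k)\<close> there are only boundedly many of
  the latter, and each of them has \<open>side_count^(n - k)\<close> descendants.
\<close>

lemma card_close_sides:
  assumes A: "finite A" "A \<subseteq> arcs" and "0 \<le> C"
    and close: "\<And>s. s \<in> sides ((subst ^^ n) A) \<Longrightarrow> cmod (x s - fst (fst s) / z ^ n) \<le> C / cmod z ^ n"
    and "k \<le> n"
  shows "card {s \<in> sides ((subst ^^ n) A). cmod (x s - c) \<le> 1 / cmod z ^ k}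
    \<le> 8 * (2 * (spread + 2 + C) + 1) ^ 2 * side_count ^ (n - k)"
proof -
  let ?E = "\<lambda>n. (subst ^^ n) A"
  have E: "?E k \<subseteq> arcs" using A by (rule_tac subst_pow_arcs)
  define \<rho> where "\<rho> = spread + 2 + C"
  have "0 \<le> \<rho>" using spread_pos \<open>0 \<le> C\<close> by (simp add: \<rho>_def)
  define N where "N = near (z ^ k * c) \<rho>"
  have N: "finite N" "card N \<le> 4 * (2 * \<rho> + 1) ^ 2" using card_near[OF \<open>0 \<le> \<rho>\<close>] by (auto simp: N_def)
  define X where "X = {s \<in> sides (?E k). fst s \<in> N}"
  have "X \<subseteq> N \<times> {\<i>, - \<i>}" by (auto simp: X_def sides_def corners_def quarter_turns_def)
  then have X: "finite X" "card X \<le> card (N \<times> {\<i>, - \<i>})" "X \<subseteq> corners"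
    using N(1) card_mono[of "N \<times> {\<i>, - \<i>}" X] finite_subset[of X "N \<times> {\<i>, - \<i>}"]
    by (auto simp: X_def sides_def)
  have "card (N \<times> {\<i>, - \<i>}) = 2 * card N" by (simp add: card_cartesian_product unit_distinct)
  then have cardX: "card X \<le> 8 * (2 * \<rho> + 1) ^ 2" using X(2) N(2) by simp
  have sub: "{s \<in> sides (?E n). cmod (x s - c) \<le> 1 / cmod z ^ k} \<subseteq> (subst_corners ^^ (n - k)) X"
  proof
    fix s assume s: "s \<in> {s \<in> sides (?E n). cmod (x s - c) \<le> 1 / cmod z ^ k}"
    have "?E n = (subst ^^ (n - k)) (?E k)"
      using \<open>k \<le> n\<close> by (metis comp_apply funpow_add le_add_diff_inverse2)
    then have "s \<in> (subst_corners ^^ (n - k)) (\<Union>c\<in>sides (?E k). {c})" using s sides_subst_pow[OF E] by simp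
    then obtain q where q: "q \<in> sides (?E k)" "s \<in> (subst_corners ^^ (n - k)) {q}"
      unfolding subst_corners_pow_Union by blast
    obtain e t a r where eq: "q = (e, t)" "s = (a, r)" by fastforce
    have e: "e \<in> arcs" "t \<in> quarter_turns" "turn t e \<in> arcs"
      using q(1) eq turn_arc by (auto simp: sides_def corners_def)
    have "a \<in> (subst ^^ (n - k)) {e, turn t e}" using corner_descendants q(2) eq by blast
    then obtain b where b: "b \<in> {e, turn t e}" "a \<in> (subst ^^ (n - k)) {b}" by (rule ancestor)
    have "cmod (fst b - fst e) \<le> 1" using b(1) arcsD(4)[OF e(1)] by (auto simp: turn_def head_def)
    then have 1: "cmod (fst b / z ^ k - fst e / z ^ k) \<le> 1 / cmod z ^ k"
      unfolding norm_div_pow by (intro divide_right_mono) auto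
    have "b \<in> arcs" using b(1) e by auto
    then have 2: "cmod (fst a / z ^ n - fst b / z ^ k) \<le> spread / cmod z ^ k"
      using descendants_near_scaled[OF _ b(2), of k] \<open>k \<le> n\<close> by simp
    have "cmod z ^ k \<le> cmod z ^ n" using \<open>k \<le> n\<close> norm_z_gt by (intro power_increasing) auto
    then have "C / cmod z ^ n \<le> C / cmod z ^ k"
      using \<open>0 \<le> C\<close> by (intro divide_left_mono) (auto simp: z_nonzero)
    then have 3: "cmod (x s - fst a / z ^ n) \<le> C / cmod z ^ k" using close[of s] s eq by auto
    have 4: "cmod (x s - c) \<le> 1 / cmod z ^ k" using s by simp
    have split: "cmod (fst e / z ^ k - c) = cmod ((x s - c) - (x s - fst a / z ^ n) - (fst a / z ^ n - fst b / z ^ k)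
        - (fst b / z ^ k - fst e / z ^ k))" by simp
    have "cmod (fst e / z ^ k - c) \<le> cmod (x s - c) + cmod (x s - fst a / z ^ n)
        + cmod (fst a / z ^ n - fst b / z ^ k) + cmod (fst b / z ^ k - fst e / z ^ k)"
      unfolding split
      using norm_triangle_ineq4[of "x s - c" "x s - fst a / z ^ n"]
        norm_triangle_ineq4[of "(x s - c) - (x s - fst a / z ^ n)" "fst a / z ^ n - fst b / z ^ k"]
        norm_triangle_ineq4[of "(x s - c) - (x s - fst a / z ^ n) - (fst a / z ^ n - fst b / z ^ k)"
          "fst b / z ^ k - fst e / z ^ k"] by linarith
    then have "cmod (fst e / z ^ k - c) \<le> \<rho> / cmod z ^ k"
      using 1 2 3 4 by (simp add: \<rho>_def add_divide_distrib)
    moreover have "cmod (fst e / z ^ k - c) = cmod (fst e - z ^ k * c) / cmod z ^ k"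
      using norm_div_pow[of "fst e" k "z ^ k * c"] z_nonzero by simp
    ultimately have "cmod (fst e - z ^ k * c) \<le> \<rho>"
      using norm_z_pow_pos[of k] by (simp add: divide_le_cancel)
    then have "q \<in> X" using q(1) e eq by (simp add: X_def N_def near_def)
    then have "s \<in> (\<Union>c\<in>X. (subst_corners ^^ (n - k)) {c})" using q(2) by blast
    then show "s \<in> (subst_corners ^^ (n - k)) X"
      unfolding subst_corners_pow_Union[symmetric] by simp
  qed
  have "card {s \<in> sides (?E n). cmod (x s - c) \<le> 1 / cmod z ^ k} \<le> side_count ^ (n - k) * card X"
    using card_subst_corners_pow[OF X(1,3), of "n - k"] card_mono[OF _ sub] by metis
  then have "real (card {s \<in> sides (?E n). cmod (x s - c) \<le> 1 / cmod z ^ k}) \<le> real (side_count ^ (n - k)) * real (card X)"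
    by (simp only: of_nat_le_iff flip: of_nat_mult)
  also have "\<dots> \<le> real (side_count ^ (n - k)) * (8 * (2 * \<rho> + 1) ^ 2)" using cardX by (intro mult_left_mono) auto
  finally show ?thesis by (simp add: \<rho>_def mult.commute)
qed

end

context grid_substitution begin

definition arcs_curve :: "arc set \<Rightarrow> complex set" where
  "arcs_curve A = (\<Union>a\<in>A. closed_segment (fst a) (head a))"

text \<open>
  Scaled starting points belong to both sets, and each set lies within a constant times
  \<open>\<bar>z\<bar>^(-n)\<close> of them.
\<close>

lemma hausdorff_limit_limit_tile:
  assumes A: "finite A" "A \<subseteq> arcs" "A \<noteq> {}"
  shows "hausdorff_limit (\<lambda>n. (\<lambda>x. x / z ^ n) ` arcs_curve ((subst ^^ n) A)) (limit_tile A)"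
    and "\<And>n. compact ((\<lambda>x. x / z ^ n) ` arcs_curve ((subst ^^ n) A))"
    and "\<And>n. (\<lambda>x. x / z ^ n) ` arcs_curve ((subst ^^ n) A) \<noteq> {}"
proof -
  let ?T = "limit_tile A" and ?E = "\<lambda>n. (subst ^^ n) A" and ?X = "\<lambda>n. (\<lambda>x. x / z ^ n) ` arcs_curve ((subst ^^ n) A)"
  have E: "finite (?E n)" "?E n \<noteq> {}" "?E n \<subseteq> arcs" for n
  proof -
    have "finite (?E n)" "card (?E n) = m ^ n * card A" using card_subst_pow[OF A(1,2), of n] by auto
    then show "finite (?E n)" by simp
    have "card A \<noteq> 0" using A by simp
    then have "card (?E n) \<noteq> 0" unfolding \<open>card (?E n) = m ^ n * card A\<close> using m_pos by simp
    then show "?E n \<noteq> {}" by fastforce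
    show "?E n \<subseteq> arcs" using A(2) by (rule subst_pow_arcs)
  qed
  show X: "compact (?X n)" for n
    using E(1)[of n] z_nonzero unfolding arcs_curve_def
    by (intro compact_continuous_image compact_UN continuous_intros) auto
  show Xne: "?X n \<noteq> {}" for n using E(2)[of n] by (auto simp: arcs_curve_def)
  have start: "fst a / z ^ n \<in> ?X n" if "a \<in> ?E n" for a n using that by (auto simp: arcs_curve_def)
  have T: "compact ?T" using compact_limit_tile A by blast
  have Tne: "?T \<noteq> {}" using vertex_in_tile[OF A(2), of _ 0] A(3) by auto
  have bound: "0 \<le> hausdorff_dist (?X n) ?T" "hausdorff_dist (?X n) ?T \<le> (spread + 1) * (1 / cmod z) ^ n" for n
  proof -
    have eq: "(spread + 1) * (1 / cmod z) ^ n = (spread + 1) / cmod z ^ n" by (simp add: power_one_over)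
    have 1: "infdist x ?T \<le> (spread + 1) / cmod z ^ n" if x: "x \<in> ?X n" for x
    proof -
      obtain a y where a: "a \<in> ?E n" "x = y / z ^ n" "y \<in> closed_segment (fst a) (head a)"
        using x by (auto simp: arcs_curve_def)
      have "a \<in> arcs" using a(1) E(3) by blast
      then have "cmod (head a - fst a) = 1" using arcsD(4) by (simp add: head_def)
      then have "cmod (y - fst a) \<le> 1" using segment_bound(1)[OF a(3)] by simp
      then have "cmod (x - fst a / z ^ n) \<le> 1 / cmod z ^ n"
        unfolding a(2) norm_div_pow by (intro divide_right_mono) auto
      also have "\<dots> \<le> (spread + 1) / cmod z ^ n" using spread_pos by (intro divide_right_mono) auto
      finally show ?thesis
        using infdist_le2[OF vertex_in_tile[OF A(2) a(1)], of x] by (simp add: dist_norm)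
    qed
    have 2: "infdist y (?X n) \<le> (spread + 1) / cmod z ^ n" if y: "y \<in> ?T" for y
    proof -
      obtain a where a: "a \<in> ?E n" "cmod (y - fst a / z ^ n) \<le> spread / cmod z ^ n"
        using y unfolding limit_tile_def by blast
      note a(2)
      also have "spread / cmod z ^ n \<le> (spread + 1) / cmod z ^ n" by (intro divide_right_mono) auto
      finally show ?thesis using infdist_le2[OF start[OF a(1)], of y] by (simp add: dist_norm)
    qed
    show "hausdorff_dist (?X n) ?T \<le> (spread + 1) * (1 / cmod z) ^ n"
      unfolding hausdorff_dist_def eq using 1 2 Xne[of n] Tne by (intro max.boundedI cSUP_least) auto
    obtain y where "y \<in> ?T" using Tne by blast
    then have "0 \<le> (SUP y\<in>?T. infdist y (?X n))"
      using infdist_nonneg bdd_aboveI2[OF 2] by (intro cSUP_upper2[where x = y]) auto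
    then show "0 \<le> hausdorff_dist (?X n) ?T" by (simp add: hausdorff_dist_def)
  qed
  have "(\<lambda>n. (spread + 1) * (1 / cmod z) ^ n) \<longlonglongrightarrow> 0"
  proof -
    have "1 / cmod z < 1" using norm_z_gt z_nonzero by (simp add: divide_less_eq)
    then show ?thesis using LIMSEQ_power_zero[of "1 / cmod z"] by (intro tendsto_mult_right_zero) auto
  qed
  note lim = this
  have "(\<lambda>n. hausdorff_dist (?X n) ?T) \<longlonglongrightarrow> 0"
  proof (rule tendsto_sandwich[OF _ _ tendsto_const lim])
    show "\<forall>\<^sub>F n in sequentially. 0 \<le> hausdorff_dist (?X n) ?T" using bound(1) by (intro always_eventually) blast
    show "\<forall>\<^sub>F n in sequentially. hausdorff_dist (?X n) ?T \<le> (spread + 1) * (1 / cmod z) ^ n"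
      using bound(2) by (intro always_eventually) blast
  qed
  then show "hausdorff_limit ?X ?T" using T Tne by (simp add: hausdorff_limit_def)
qed

end

section \<open>Hausdorff measure by counting\<close>

text \<open>
  The \<open>n\<close>-th cover contributes at most a constant times \<open>(h / Z^t)^n\<close>,
  where \<open>h < Z^t\<close> by assumption.
\<close>

lemma hausdorff_measure_eq_0_by_balls:
  fixes F :: "'a::metric_space set" and Z C c h t :: real
  assumes "1 < Z" "0 < C" "0 < c" "ln h < t * ln Z" "0 < t" "0 < h"
    and cover: "\<And>n::nat. \<exists>P. finite P \<and> card P \<le> c * h ^ n \<and> F \<subseteq> (\<Union>p\<in>P. cball p (C / Z ^ n))"
  shows "hausdorff_measure t F = 0"
proof -
  have "hausdorff_premeasure t \<delta> F = 0" if "0 < \<delta>" for \<delta>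
  proof -
    define q where "q = h / Z powr t"
    have "h < Z powr t"
    proof -
      have "exp (ln h) < exp (t * ln Z)" using assms(4) by simp
      then show ?thesis using assms(1,6) by (simp add: powr_def)
    qed
    then have q: "0 \<le> q" "q < 1" using assms by (auto simp: q_def)
    have lim1: "(\<lambda>n. 2 * C * (1 / Z) ^ n) \<longlonglongrightarrow> 0"
      using LIMSEQ_power_zero[of "1 / Z"] assms(1) by (intro tendsto_mult_right_zero) auto
    have lim2: "(\<lambda>n. c * (2 * C) powr t * q ^ n) \<longlonglongrightarrow> 0"
      using LIMSEQ_power_zero[of q] q by (intro tendsto_mult_right_zero) auto
    have le: "hausdorff_premeasure t \<delta> F \<le> ennreal \<epsilon>" if "0 < \<epsilon>" for \<epsilon>
    proof -
      have "eventually (\<lambda>n. 2 * C * (1 / Z) ^ n < \<delta>) sequentially"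
        "eventually (\<lambda>n. c * (2 * C) powr t * q ^ n < \<epsilon>) sequentially"
        using order_tendstoD(2)[OF lim1 \<open>0 < \<delta>\<close>] order_tendstoD(2)[OF lim2 \<open>0 < \<epsilon>\<close>] by auto
      then obtain n where n: "2 * C * (1 / Z) ^ n < \<delta>" "c * (2 * C) powr t * q ^ n < \<epsilon>"
        by (metis (mono_tags, lifting) eventually_conj eventually_happens sequentially_bot)
      define \<rho> where "\<rho> = C / Z ^ n"
      have "0 < \<rho>" using assms by (simp add: \<rho>_def)
      obtain P where P: "finite P" "card P \<le> c * h ^ n" "F \<subseteq> (\<Union>p\<in>P. cball p \<rho>)"
        using cover[of n] by (auto simp: \<rho>_def)
      obtain f where f: "bij_betw f {..<card P} P" using ex_bij_betw_nat_finite[OF P(1)] atLeast0LessThan by metis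
      define X where "X i = (if i < card P then cball (f i) \<rho> else {})" for i
      have diam: "diameter (cball p \<rho>) \<le> 2 * \<rho>" for p :: 'a
      proof (unfold diameter_def, simp add: \<open>0 < \<rho>\<close> less_imp_le, intro impI cSUP_least)
        fix y assume "y \<in> cball p \<rho> \<times> cball p \<rho>"
        then show "(case y of (y1, y2) \<Rightarrow> dist y1 y2) \<le> 2 * \<rho>"
          using dist_triangle3[of "fst y" "snd y" p] by (auto simp: split_beta)
      qed (use \<open>0 < \<rho>\<close> in auto)
      have "X \<in> delta_covers \<delta> F"
        unfolding delta_covers_def
      proof (intro CollectI conjI allI)
        have "(\<Union>i. X i) = (\<Union>i<card P. cball (f i) \<rho>)" by (auto simp: X_def split: if_splits)
        also have "\<dots> = (\<Union>p\<in>f ` {..<card P}. cball p \<rho>)" by simp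
        also have "\<dots> = (\<Union>p\<in>P. cball p \<rho>)" by (simp only: bij_betw_imp_surj_on[OF f])
        finally show "F \<subseteq> (\<Union>i. X i)" using P by simp
        fix i
        show "bounded (X i)" by (simp add: X_def)
        have "2 * \<rho> < \<delta>" using n(1) by (simp add: \<rho>_def power_one_over divide_inverse power_inverse)
        then show "diameter (X i) \<le> \<delta>" using diam[of "f i"] \<open>0 < \<delta>\<close> by (auto simp: X_def)
      qed
      then have "hausdorff_premeasure t \<delta> F \<le> (\<Sum>i. diam_power t (X i))"
        unfolding hausdorff_premeasure_def by (rule INF_lower)
      also have "\<dots> = (\<Sum>i<card P. diam_power t (X i))"
        by (intro suminf_finite) (auto simp: X_def diam_power_def)
      also have "\<dots> \<le> (\<Sum>i<card P. ennreal ((2 * \<rho>) powr t))"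
      proof (intro sum_mono)
        fix i
        have "diameter (cball (f i) \<rho>) powr t \<le> (2 * \<rho>) powr t"
          using diam \<open>0 < t\<close> by (intro powr_mono2) (auto simp: diameter_ge_0)
        then show "diam_power t (X i) \<le> ennreal ((2 * \<rho>) powr t)"
          using \<open>0 < t\<close> by (auto simp: diam_power_def X_def intro: ennreal_leI)
      qed
      also have "\<dots> = ennreal (card P * (2 * \<rho>) powr t)"
        by (simp add: ennreal_mult ennreal_of_nat_eq_real_of_nat)
      also have "\<dots> \<le> ennreal \<epsilon>"
      proof (rule ennreal_leI)
        have "(2 * \<rho>) powr t = (2 * C) powr t / (Z powr t) ^ n"
        proof -
          have "(Z ^ n) powr t = (Z powr t) ^ n" using assms(1) by (induction n) (simp_all add: powr_mult)
          then show ?thesis using assms by (simp add: \<rho>_def powr_divide powr_mult)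
        qed
        then have "card P * (2 * \<rho>) powr t \<le> (c * h ^ n) * ((2 * C) powr t / (Z powr t) ^ n)"
          using P(2) by (metis mult_right_mono powr_ge_zero)
        also have "\<dots> = c * (2 * C) powr t * q ^ n" by (simp add: q_def power_divide)
        finally show "card P * (2 * \<rho>) powr t \<le> \<epsilon>" using n(2) by simp
      qed
      finally show ?thesis .
    qed
    show ?thesis
      using le by (metis ennreal_0 ennreal_le_epsilon le_zero_eq add.left_neutral)
  qed
  then show ?thesis unfolding hausdorff_measure_def by (intro antisym SUP_least) auto
qed

text \<open>
  A mass distribution argument with counting instead of a measure. If \<open>t < ln h / ln
  Z\<close>, enlarge the sets of a cover with small \<open>\<Sum> diam^t\<close> to balls and
  choose a finite subcover. A ball of radius about \<open>Z^(-k)\<close> accounts for at most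
  \<open>M * h^(n-k)\<close> of the points of a late step \<open>n\<close>, and
  \<open>h^(-k)\<close> is at most a constant times the \<open>t\<close>-th power of the radius,
  so the balls cannot account for all \<open>c0 * h^n\<close> points.
\<close>

lemma hausdorff_measure_0_imp_dim_le:
  fixes F :: "'a::metric_space set" and x :: "nat \<Rightarrow> 'b \<Rightarrow> 'a"
    and Z h c0 M t :: real
  assumes F: "compact F" and Z: "1 < Z" and h: "1 \<le> h" and c0: "0 < c0" and M: "0 < M"
    and I: "\<And>n. finite (I n)" "\<And>n. c0 * h ^ n \<le> card (I n)"
    and x: "\<And>n s. s \<in> I n \<Longrightarrow> x n s \<in> F"
    and count: "\<And>n k c. k \<le> n \<Longrightarrow> card {s \<in> I n. dist (x n s) c \<le> 1 / Z ^ k} \<le> M * h ^ (n - k)"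
    and t: "0 \<le> t" and null: "hausdorff_measure t F = 0"
  shows "ln h / ln Z \<le> t"
proof (rule ccontr)
  define s where "s = ln h / ln Z"
  assume "\<not> ln h / ln Z \<le> t"
  then have ts: "t < s" by (simp add: s_def)
  have Zs: "Z powr s = h" using Z h by (simp add: s_def powr_def)
  \<comment> \<open>The first bound makes all radii at most 1, the second makes the final count fail by a factor of 2.\<close>
  define \<epsilon> where "\<epsilon> = min (1 / 2) (c0 / (4 * M * h))"
  have \<epsilon>: "0 < \<epsilon>" "\<epsilon> \<le> 1 / 2" "\<epsilon> \<le> c0 / (4 * M * h)" using c0 M h by (auto simp: \<epsilon>_def)
  have "hausdorff_premeasure t 1 F \<le> hausdorff_measure t F"
    unfolding hausdorff_measure_def by (rule SUP_upper) simp
  then have "hausdorff_premeasure t 1 F < ennreal \<epsilon>" using null \<epsilon>(1) by simp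
  then obtain X where X: "X \<in> delta_covers 1 F" "(\<Sum>i. diam_power t (X i)) < ennreal \<epsilon>"
    unfolding hausdorff_premeasure_def by (auto simp: INF_less_iff)
  have cover: "F \<subseteq> (\<Union>i. X i)" and bdd: "bounded (X i)" for i using X(1) by (auto simp: delta_covers_def)
  have fin_sum: "(\<Sum>i\<in>J. diam_power t (X i)) < ennreal \<epsilon>" if "finite J" for J
    using sum_le_suminf[OF summableI that, of "\<lambda>i. diam_power t (X i)"] X(2) by (auto intro: le_less_trans)
  have "0 < card (I 0)" using I(2)[of 0] c0 by (cases "card (I 0) = 0") auto
  then obtain s0 where "s0 \<in> I 0" by (metis card_gt_0_iff ex_in_conv)
  then have "F \<noteq> {}" using x by blast
  have "t \<noteq> 0"
  proof
    assume "t = 0"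
    obtain i where "X i \<noteq> {}" using \<open>F \<noteq> {}\<close> cover by blast
    then have "diam_power t (X i) = 1" by (simp add: diam_power_def \<open>t = 0\<close>)
    then have "ennreal 1 < ennreal \<epsilon>" using fin_sum[of "{i}"] by simp
    then show False using \<epsilon> by (simp add: ennreal_less_iff)
  qed
  then have "0 < t" using t by simp
  \<comment> \<open>Strictly larger than the diameter even for singletons, while the \<open>t\<close>-th powers grow by \<open>\<epsilon>\<close> in total.\<close>
  define r where "r i = (diameter (X i) powr t + \<epsilon> * (1 / 2) ^ Suc i) powr (1 / t)" for i
  have pos: "0 < diameter (X i) powr t + \<epsilon> * (1 / 2) ^ Suc i" for i
    using \<epsilon>(1) by (intro add_nonneg_pos) auto
  then have r_pos: "0 < r i" for i by (simp add: r_def less_imp_neq[symmetric])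
  have r_t: "r i powr t = diameter (X i) powr t + \<epsilon> * (1 / 2) ^ Suc i" for i
    using pos[of i] \<open>0 < t\<close> by (simp add: r_def powr_powr)
  have r_gt: "diameter (X i) < r i" for i
  proof -
    have "diameter (X i) powr t < r i powr t" using \<epsilon>(1) by (simp add: r_t)
    then show ?thesis using r_pos[of i] \<open>0 < t\<close> diameter_ge_0[OF bdd]
      by (meson linorder_not_le powr_mono2 less_imp_le)
  qed
  have sum_r: "(\<Sum>i\<in>J. r i powr t) \<le> 2 * \<epsilon>" if J: "finite J" "\<And>i. i \<in> J \<Longrightarrow> X i \<noteq> {}" for J
  proof -
    have sum_eq: "ennreal (\<Sum>i\<in>J. diameter (X i) powr t) = (\<Sum>i\<in>J. diam_power t (X i))"
      using J(2) \<open>0 < t\<close> by (subst sum_ennreal[symmetric]) (auto simp: diam_power_def intro!: sum.cong)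
    have "(\<Sum>i\<in>J. diameter (X i) powr t) < \<epsilon>"
    proof -
      have "ennreal (\<Sum>i\<in>J. diameter (X i) powr t) < ennreal \<epsilon>"
        unfolding sum_eq using fin_sum[OF J(1)] .
      moreover have "0 \<le> (\<Sum>i\<in>J. diameter (X i) powr t)" by (intro sum_nonneg) simp
      ultimately show ?thesis by (simp only: ennreal_less_iff)
    qed
    moreover have "(\<Sum>i\<in>J. (1 / 2 :: real) ^ Suc i) \<le> 1"
      using sum_le_suminf[OF sums_summable[OF power_half_series] J(1)] sums_unique[OF power_half_series] by simp
    then have "\<epsilon> * (\<Sum>i\<in>J. (1 / 2) ^ Suc i) \<le> \<epsilon>"
      using \<epsilon>(1) by (simp only: mult_left_le)
    then have "(\<Sum>i\<in>J. \<epsilon> * (1 / 2) ^ Suc i) \<le> \<epsilon>" by (simp only: sum_distrib_left)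
    ultimately show ?thesis unfolding r_t by (simp add: sum.distrib)
  qed
  define a where "a i = (SOME y. y \<in> X i)" for i
  define J0 where "J0 = {i. X i \<noteq> {}}"
  have "F \<subseteq> (\<Union>i\<in>J0. ball (a i) (r i))"
  proof
    fix y assume "y \<in> F"
    then obtain i where i: "y \<in> X i" using cover by blast
    then have "a i \<in> X i" unfolding a_def by (metis someI)
    then have "dist (a i) y \<le> diameter (X i)" using i bdd diameter_bounded_bound by blast
    then show "y \<in> (\<Union>i\<in>J0. ball (a i) (r i))" using i r_gt[of i] by (force simp: J0_def)
  qed
  then obtain J where J: "J \<subseteq> J0" "finite J" "F \<subseteq> (\<Union>i\<in>J. ball (a i) (r i))"
    using compactE_image[OF F, of J0 "\<lambda>i. ball (a i) (r i)"] by auto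
  have sumJ: "(\<Sum>i\<in>J. r i powr t) \<le> 2 * \<epsilon>" using sum_r J by (auto simp: J0_def)
  have r_le: "r i \<le> 1" if "i \<in> J" for i
  proof -
    have "r i powr t \<le> (\<Sum>i\<in>J. r i powr t)" using that J(2) by (intro member_le_sum) auto
    then have "r i powr t \<le> 1 powr t" using sumJ \<epsilon>(2) by simp
    then show ?thesis using r_pos[of i] \<open>0 < t\<close> by (metis linorder_not_le powr_less_mono2 zero_le_one)
  qed
  have "\<exists>k. 1 / Z ^ Suc k < r i \<and> r i \<le> 1 / Z ^ k" if "i \<in> J" for i
  proof -
    obtain k where "inverse (r i) < Z ^ k" using real_arch_pow[OF Z] by blast
    then have k: "1 / Z ^ k < r i" using r_pos[of i] Z by (simp add: field_simps)
    define l where "l = (LEAST k. 1 / Z ^ k < r i)"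
    have l: "1 / Z ^ l < r i" unfolding l_def using k by (rule LeastI)
    then have "l \<noteq> 0" using r_le[OF that] by (cases l) auto
    then obtain l' where "l = Suc l'" by (cases l) auto
    moreover have "\<not> 1 / Z ^ l' < r i" using \<open>l = Suc l'\<close> not_less_Least[of l' "\<lambda>k. 1 / Z ^ k < r i"] by (simp add: l_def)
    ultimately show ?thesis using l by (intro exI[of _ l']) auto
  qed
  then obtain k where k: "\<And>i. i \<in> J \<Longrightarrow> 1 / Z ^ Suc (k i) < r i \<and> r i \<le> 1 / Z ^ k i" by metis
  define n where "n = Max (insert 0 (k ` J))"
  have kn: "k i \<le> n" if "i \<in> J" for i using that J(2) by (auto simp: n_def)
  have "I n \<subseteq> (\<Union>i\<in>J. {s \<in> I n. dist (x n s) (a i) \<le> 1 / Z ^ k i})"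
  proof
    fix s assume s: "s \<in> I n"
    then have "x n s \<in> F" by (rule x)
    then obtain i where "i \<in> J" "dist (a i) (x n s) < r i" using J(3) by force
    then show "s \<in> (\<Union>i\<in>J. {s \<in> I n. dist (x n s) (a i) \<le> 1 / Z ^ k i})"
      using s k[of i] by (force simp: dist_commute)
  qed
  then have "card (I n) \<le> card (\<Union>i\<in>J. {s \<in> I n. dist (x n s) (a i) \<le> 1 / Z ^ k i})"
    using I(1) J(2) by (intro card_mono) auto
  also have "\<dots> \<le> (\<Sum>i\<in>J. card {s \<in> I n. dist (x n s) (a i) \<le> 1 / Z ^ k i})" by (rule card_UN_le[OF J(2)])
  finally have "real (card (I n)) \<le> (\<Sum>i\<in>J. real (card {s \<in> I n. dist (x n s) (a i) \<le> 1 / Z ^ k i}))"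
    by (simp flip: of_nat_sum)
  also have "\<dots> \<le> (\<Sum>i\<in>J. M * h * h ^ n * r i powr t)"
  proof (intro sum_mono)
    fix i assume i: "i \<in> J"
    have "(Z ^ l) powr s = h ^ l" for l
      using Z Zs by (induction l) (simp_all add: powr_mult)
    then have "1 / h ^ Suc (k i) = (1 / Z ^ Suc (k i)) powr s"
      using Z by (simp add: powr_divide del: power_Suc)
    also have "\<dots> \<le> r i powr s"
      using k[OF i] ts t Z by (intro powr_mono2) auto
    also have "\<dots> \<le> r i powr t" using ts r_pos[of i] r_le[OF i] by (intro powr_mono') auto
    finally have "1 \<le> h * h ^ k i * r i powr t" using h by (simp add: field_simps)
    moreover have "h ^ n = h ^ (n - k i) * h ^ k i" using kn[OF i] by (simp flip: power_add)
    ultimately have "M * h ^ (n - k i) * 1 \<le> M * h ^ (n - k i) * (h * h ^ k i * r i powr t)"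
      using M h by (intro mult_left_mono) auto
    then have "M * h ^ (n - k i) \<le> M * h * h ^ n * r i powr t"
      using \<open>h ^ n = _\<close> by (simp add: mult_ac)
    then show "real (card {s \<in> I n. dist (x n s) (a i) \<le> 1 / Z ^ k i}) \<le> M * h * h ^ n * r i powr t"
      using count[OF kn[OF i], of "a i"] by linarith
  qed
  also have "\<dots> = M * h * h ^ n * (\<Sum>i\<in>J. r i powr t)" by (simp add: sum_distrib_left)
  also have "\<dots> \<le> M * h * h ^ n * (2 * \<epsilon>)" using sumJ M h by (intro mult_left_mono) auto
  also have "\<dots> \<le> M * h * h ^ n * (2 * (c0 / (4 * M * h)))" using \<epsilon>(3) M h by (intro mult_left_mono) auto
  also have "\<dots> = c0 * h ^ n / 2" using M h by simp
  finally have "c0 * h ^ n \<le> c0 * h ^ n / 2" using I(2)[of n] by linarith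
  moreover have "0 < c0 * h ^ n" using c0 h by simp
  ultimately show False by linarith
qed

section \<open>Dimension of the frontier of a limit tile\<close>

context grid_substitution begin

lemma finite_sides: "finite A \<Longrightarrow> A \<subseteq> arcs \<Longrightarrow> finite (sides A)"
proof -
  assume A: "finite A" "A \<subseteq> arcs"
  have "sides A \<subseteq> (\<Union>e\<in>A. sides {e})"
  proof
    fix s assume "s \<in> sides A"
    then obtain a t where s: "s = (a, t)" "a \<in> arcs" "t \<in> quarter_turns" "a \<in> A \<longleftrightarrow> turn t a \<notin> A"
      by (auto simp: sides_def corners_def)
    have "s \<in> sides {a}" "s \<in> sides {turn t a}"
      using s turn_neq(1)[OF s(2,3)] by (auto simp: sides_def corners_def)
    then show "s \<in> (\<Union>e\<in>A. sides {e})" using s(4) by (cases "a \<in> A") auto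
  qed
  then show "finite (sides A)" using A(1) finite_sides_single by (meson finite_UN finite_subset)
qed

theorem hausdorff_dim_frontier_limit_tile:
  assumes A: "finite A" "A \<subseteq> arcs" and ne: "sides A \<noteq> {}"
  shows "hausdorff_dim (frontier (limit_tile A)) = ereal (ln side_count / ln (cmod z))"
proof -
  let ?F = "frontier (limit_tile A)" and ?S = "\<lambda>n. sides ((subst ^^ n) A)"
  have cardS: "finite (?S n)" "card (?S n) = side_count ^ n * card (sides A)" for n
    using card_subst_corners_pow[OF finite_sides[OF A], of n] sides_subst_pow[OF A(2), of n]
    by (auto simp: sides_def)
  have card_pos: "0 < card (sides A)" using finite_sides[OF A] ne by (simp add: card_gt_0_iff)
  have lnz: "0 < ln (cmod z)" by (rule ln_gt_zero[OF norm_z_gt])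
  have upper: "hausdorff_measure t ?F = 0" if "ln side_count / ln (cmod z) < t" for t
  proof (rule hausdorff_measure_eq_0_by_balls)
    show "1 < cmod z" by (rule norm_z_gt)
    show "0 < 17 * spread + 54" using spread_pos by simp
    show "0 < real (card (sides A))" using card_pos by simp
    show "ln side_count < t * ln (cmod z)" using that lnz by (simp add: divide_less_eq)
    have "0 \<le> ln side_count / ln (cmod z)" using side_count_pos lnz by simp
    then show "0 < t" using that by simp
    show "0 < real side_count" using side_count_pos by simp
    fix n
    let ?P = "(\<lambda>s. fst (fst s) / z ^ n) ` ?S n"
    have "card ?P \<le> card (sides A) * side_count ^ n" using card_image_le[OF cardS(1)] cardS(2) by (metis mult.commute)
    then have "real (card ?P) \<le> real (card (sides A)) * real side_count ^ n" by (simp flip: of_nat_mult of_nat_power)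
    moreover have "?F \<subseteq> (\<Union>p\<in>?P. cball p ((17 * spread + 54) / cmod z ^ n))"
    proof
      fix x assume "x \<in> ?F"
      then obtain a t where "(a, t) \<in> ?S n" "cmod (x - fst a / z ^ n) \<le> (17 * spread + 54) / cmod z ^ n"
        using frontier_near_side[OF A] by blast
      then show "x \<in> (\<Union>p\<in>?P. cball p ((17 * spread + 54) / cmod z ^ n))"
        by (force simp: dist_norm norm_minus_commute)
    qed
    ultimately show "\<exists>P. finite P \<and> card P \<le> card (sides A) * real side_count ^ n \<and>
        ?F \<subseteq> (\<Union>p\<in>P. cball p ((17 * spread + 54) / cmod z ^ n))"
      using cardS(1) by (intro exI[of _ ?P]) auto
  qed
  have "\<exists>x. x \<in> ?F \<and> cmod (x - fst (fst s) / z ^ n) \<le> (spread + 2) / cmod z ^ n" if "s \<in> ?S n" for n s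
    using side_near_frontier[OF A, of "fst s" "snd s" n] that by auto
  note ex = this
  define x where "x n s = (SOME x. x \<in> ?F \<and> cmod (x - fst (fst s) / z ^ n) \<le> (spread + 2) / cmod z ^ n)"
    for n and s :: "arc \<times> complex"
  have x: "x n s \<in> ?F \<and> cmod (x n s - fst (fst s) / z ^ n) \<le> (spread + 2) / cmod z ^ n"
    if "s \<in> ?S n" for n s
    unfolding x_def by (rule someI_ex[OF ex[OF that]])
  have lower: "ln side_count / ln (cmod z) \<le> t" if t: "0 \<le> t" "hausdorff_measure t ?F = 0" for t
  proof (rule hausdorff_measure_0_imp_dim_le[where F = ?F and I = ?S and x = x
        and ?c0.0 = "card (sides A)" and M = "8 * (2 * (spread + 2 + (spread + 2)) + 1) ^ 2"])
    show "compact ?F" using compact_limit_tile[OF A] compact_frontier by blast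
    show "1 < cmod z" by (rule norm_z_gt)
    show "1 \<le> real side_count" using side_count_pos by simp
    show "0 < real (card (sides A))" using card_pos by simp
    show "0 < 8 * (2 * (spread + 2 + (spread + 2)) + 1) ^ 2" using spread_pos by simp
    show "finite (?S n)" for n by (rule cardS)
    show "real (card (sides A)) * real side_count ^ n \<le> real (card (?S n))" for n by (simp add: cardS(2))
    show "x n s \<in> ?F" if "s \<in> ?S n" for n s using x that by blast
    show "real (card {s \<in> ?S n. dist (x n s) c \<le> 1 / cmod z ^ k})
        \<le> 8 * (2 * (spread + 2 + (spread + 2)) + 1) ^ 2 * real side_count ^ (n - k)" if "k \<le> n" for n k c
    proof -
      have "0 \<le> spread + 2" using spread_pos by simp
      moreover have "cmod (x n s - fst (fst s) / z ^ n) \<le> (spread + 2) / cmod z ^ n" if "s \<in> ?S n" for s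
        using x that by blast
      ultimately show ?thesis
        using card_close_sides[OF A, of "spread + 2" n "x n" k c] \<open>k \<le> n\<close> by (simp add: dist_norm)
    qed
  qed (fact t)+
  have le_t: "hausdorff_dim ?F \<le> ereal t" if "ln side_count / ln (cmod z) < t" for t
  proof -
    have "0 \<le> ln side_count / ln (cmod z)" using side_count_pos lnz by simp
    then show ?thesis unfolding hausdorff_dim_def using upper[OF that] that by (intro Inf_lower) auto
  qed
  have "hausdorff_dim ?F \<le> ereal (ln side_count / ln (cmod z)) + ereal e" if "0 < e" for e
    using le_t[of "ln side_count / ln (cmod z) + e"] that by simp
  then have "hausdorff_dim ?F \<le> ereal (ln side_count / ln (cmod z))" by (rule ereal_le_epsilon2)
  moreover have "ereal (ln side_count / ln (cmod z)) \<le> hausdorff_dim ?F"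
    unfolding hausdorff_dim_def using lower by (intro Inf_greatest) auto
  ultimately show ?thesis by simp
qed

end

section \<open>Planefilling self-avoiding curves give bijective substitutions\<close>

context folding_path begin

text \<open>
  Even points are exactly the translations that preserve the checkerboard orientation.
\<close>

lemma exists_even_near:
  obtains s where "s \<in> grid_points" "even_point s" "cmod (s - w) \<le> 4"
proof -
  let ?s = "Complex (of_int (2 * \<lfloor>Re w / 2\<rfloor>)) (of_int (2 * \<lfloor>Im w / 2\<rfloor>))"
  have "\<bar>of_int (2 * \<lfloor>x / 2\<rfloor>) - x\<bar> \<le> 2" for x :: real by (simp, linarith)
  then have "\<bar>Re (?s - w)\<bar> \<le> 2" "\<bar>Im (?s - w)\<bar> \<le> 2" by simp_all
  then have "cmod (?s - w) \<le> 4" using cmod_le[of "?s - w"] by linarith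
  moreover have "even_point ?s" by (simp only: even_point_Complex) simp
  moreover have "?s \<in> grid_points" by (rule Complex_in_grid)
  ultimately show ?thesis using that by blast
qed

lemma arcs_shift:
  assumes "s \<in> grid_points" "even_point s" "a \<in> arcs"
  shows "(fst a + s, snd a) \<in> arcs"
  using assms even_point_add[of "fst a" s] by (auto simp: arcs_def)

text \<open>
  The arcs of the curve are distinct, the image of the set of these arcs is the set itself, and
  it contains all arcs in certain arbitrarily large discs. Two arcs can be moved into such a
  disc by one even translation, where their images are disjoint. Likewise an arc can be moved
  into such a disc by an even translation in the scaled grid, where it is the child of an arc of
  the curve.
\<close>

lemma bij_betw_child:
  fixes \<alpha> :: "nat \<Rightarrow> arc"
  assumes inj: "inj \<alpha>"
    and self_similar: "\<And>n. \<alpha> n = ch (\<alpha> (n div m)) (n mod m)"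
    and fills: "\<And>B. \<exists>R>B. \<exists>c. \<forall>a\<in>arcs. fst a \<in> cball c R \<longrightarrow> a \<in> range \<alpha>"
    and range: "range \<alpha> \<subseteq> arcs"
  shows "bij_betw (\<lambda>(e, j). ch e j) (arcs \<times> {..<m}) arcs"
proof -
  have ch_shift: "ch (fst e + s, d) j = (fst (ch (fst e, d) j) + z * s, snd (ch (fst e, d) j))" for e :: arc and s d j
    by (simp add: child_def algebra_simps)
  have ch_\<alpha>: "ch (\<alpha> k) i = \<alpha> (k * m + i)" if "i < m" for k i
    using self_similar[of "k * m + i"] that by simp
  have "e = e' \<and> i = i'" if e: "e \<in> arcs" "e' \<in> arcs" "i < m" "i' < m" and eq: "ch e i = ch e' i'" for e e' i i'
  proof -
    obtain R c where R: "R > cmod (fst e' - fst e) + 4" "\<forall>a\<in>arcs. fst a \<in> cball c R \<longrightarrow> a \<in> range \<alpha>"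
      using fills by blast
    obtain s where s: "s \<in> grid_points" "even_point s" "cmod (s - (c - fst e)) \<le> 4" by (rule exists_even_near)
    have "dist c (fst e + s) = cmod (s - (c - fst e))" "dist c (fst e' + s) = cmod (fst e' + s - c)"
      by (simp_all add: dist_norm norm_minus_commute algebra_simps)
    note dist_eq = this
    have "fst e + s \<in> cball c R"
      using s(3) R(1) norm_ge_zero[of "fst e' - fst e"] unfolding mem_cball dist_eq by linarith
    moreover have "cmod (fst e' + s - c) \<le> cmod (s - (c - fst e)) + cmod (fst e' - fst e)"
      using norm_triangle_ineq[of "s - (c - fst e)" "fst e' - fst e"] by (simp add: algebra_simps)
    then have "fst e' + s \<in> cball c R" using s(3) R(1) unfolding mem_cball dist_eq by linarith
    ultimately have "(fst e + s, snd e) \<in> range \<alpha>" "(fst e' + s, snd e') \<in> range \<alpha>"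
      using R(2) arcs_shift[OF s(1,2)] e by auto
    then obtain k k' where k: "\<alpha> k = (fst e + s, snd e)" "\<alpha> k' = (fst e' + s, snd e')" by (metis rangeE)
    have "ch (\<alpha> k) i = ch (\<alpha> k') i'" unfolding k ch_shift using eq by simp
    then have "k * m + i = k' * m + i'" using ch_\<alpha> e inj by (simp add: inj_eq)
    then have "(k * m + i) div m = (k' * m + i') div m" "(k * m + i) mod m = (k' * m + i') mod m" by simp_all
    then have "k = k'" "i = i'" using e(3,4) by simp_all
    then show ?thesis using k by (auto simp: prod_eq_iff)
  qed
  moreover have "\<exists>e\<in>arcs. \<exists>j<m. a = ch e j" if a: "a \<in> arcs" for a
  proof -
    obtain R c where R: "R > 4 * cmod z" "\<forall>a\<in>arcs. fst a \<in> cball c R \<longrightarrow> a \<in> range \<alpha>"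
      using fills by blast
    obtain s where s: "s \<in> grid_points" "even_point s" "cmod (s - (c - fst a) / z) \<le> 4" by (rule exists_even_near)
    have "fst a + z * s - c = z * (s - (c - fst a) / z)" using z_nonzero by (simp add: field_simps)
    then have "cmod (fst a + z * s - c) \<le> cmod z * 4" using s(3) by (simp add: norm_mult mult_left_mono)
    then have "fst a + z * s \<in> cball c R" using R(1) by (simp add: dist_norm norm_minus_commute)
    moreover have zs: "z * s \<in> grid_points" "even_point (z * s)" using s z_grid even_point_mult by auto
    ultimately obtain n where n: "(fst a + z * s, snd a) = \<alpha> n" using R(2) arcs_shift[OF zs a] by auto
    let ?e = "\<alpha> (n div m)"
    have "?e \<in> arcs" using range by blast
    then have "(fst ?e + - s, snd ?e) \<in> arcs" using s even_point_minus by (intro arcs_shift) auto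
    moreover have "ch (fst ?e + - s, snd ?e) (n mod m) = a"
      unfolding ch_shift using self_similar[of n] n by (simp add: prod_eq_iff) (metis fst_conv snd_conv add_diff_cancel_right')
    ultimately show ?thesis using m_pos by (metis mod_less_divisor)
  qed
  ultimately have inj_ch: "\<And>e e' i i'. e \<in> arcs \<Longrightarrow> e' \<in> arcs \<Longrightarrow> i < m \<Longrightarrow> i' < m \<Longrightarrow> ch e i = ch e' i' \<Longrightarrow> e = e' \<and> i = i'"
    and surj_ch: "\<And>a. a \<in> arcs \<Longrightarrow> \<exists>e\<in>arcs. \<exists>j<m. a = ch e j" by blast+
  show ?thesis
    unfolding bij_betw_def
  proof
    show "inj_on (\<lambda>(e, j). ch e j) (arcs \<times> {..<m})"
proof (rule inj_onI)
      fix x y assume "x \<in> arcs \<times> {..<m}" "y \<in> arcs \<times> {..<m}" "(case x of (e, j) \<Rightarrow> ch e j) = (case y of (e, j) \<Rightarrow> ch e j)"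
      then have "fst x = fst y \<and> snd x = snd y"
        using inj_ch[of "fst x" "fst y" "snd x" "snd y"] by (simp add: split_beta mem_Times_iff)
      then show "x = y" by (simp add: prod_eq_iff)
    qed
    show "(\<lambda>(e, j). ch e j) ` (arcs \<times> {..<m}) = arcs"
    proof (intro equalityI subsetI)
      fix a assume "a \<in> arcs"
      then obtain e j where "e \<in> arcs" "j < m" "a = ch e j" using surj_ch by blast
      then show "a \<in> (\<lambda>(e, j). ch e j) ` (arcs \<times> {..<m})" by (intro image_eqI[of _ _ "(e, j)"]) auto
    next
      fix a assume "a \<in> (\<lambda>(e, j). ch e j) ` (arcs \<times> {..<m})"
      then obtain e j where "e \<in> arcs" "j < m" "a = ch e j" by fast
      then show "a \<in> arcs" using ch_arc by simp
    qed
  qed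
qed

end

section \<open>The curve of a symmetric folding string\<close>

lemma step_sigma: "step (sigma x) = \<i> * step x"
  by (cases x) auto

lemma step_inj: "step x = step y \<longleftrightarrow> x = y"
  by (cases x; cases y) (auto simp: complex_eq_iff)

lemma step_sigma_pow: "step (sigma_pow k x) = \<i> powi k * step x"
proof (induction k rule: int_induct[of _ 0])
  case base
  then show ?case by (simp add: sigma_pow_0)
next
  case (step1 i)
  then show ?case by (simp add: sigma_pow_add_1 step_sigma power_int_add_1')
next
  case (step2 i)
  have "step (sigma_pow (i - 1 + 1) x) = \<i> * step (sigma_pow (i - 1) x)"
    by (simp only: sigma_pow_add_1 step_sigma)
  moreover have "\<i> powi i = \<i> * \<i> powi (i - 1)"
    using power_int_add_1'[of \<i> "i - 1"] by simp
  ultimately show ?case using step2 by simp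
qed

lemma weight_append: "weight (S @ T) = weight S + weight T"
  by (simp add: weight_def)

lemma weight_bar: "weight (bar S) = - weight S"
proof -
  have "crease_weight (flip c) = - crease_weight c" for c by (cases c) auto
  then show ?thesis by (induction S) (auto simp: weight_def bar_def)
qed

lemma weight_take_Suc: "j < length S \<Longrightarrow> weight (take (Suc j) S) = weight (take j S) + crease_weight (S ! j)"
  by (simp add: take_Suc_conv_app_nth weight_append weight_def)

lemma weight_symmetric:
  assumes "bar S = S"
  shows "weight S = 0"
  using weight_bar[of S] assms by simp

lemma weight_take_symmetric:
  assumes "bar S = S" "j \<le> length S"
  shows "weight (take (length S - j) S) = weight (take j S)"
proof -
  have "drop (length S - j) S = drop (length S - j) (bar S)" using assms(1) by simp
  also have "\<dots> = bar (take j S)" using assms(2) by (simp add: bar_def drop_map rev_take)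
  finally have "weight (drop (length S - j) S) = - weight (take j S)" by (simp add: weight_bar)
  moreover have "weight (take (length S - j) S) + weight (drop (length S - j) S) = 0"
    using weight_append[of "take (length S - j) S" "drop (length S - j) S"] weight_symmetric[OF assms(1)] by simp
  ultimately show ?thesis by simp
qed

lemma bar_append: "bar (S @ T) = bar T @ bar S"
  by (simp add: bar_def)

lemma fold_conv_symmetric:
  assumes "bar A = A"
  shows "fold_conv A T = A @ concat (map (\<lambda>b. b # A) T)"
proof -
  have "map (\<lambda>i. T ! i # A) [0..<length T] = map (\<lambda>b. b # A) (map ((!) T) [0..<length T])"
    by (simp add: comp_def del: map_nth)
  then show ?thesis by (simp only: fold_conv_def assms if_cancel map_nth)
qed

text \<open>
  The letters of \<open>T\<close> separate copies of \<open>A\<close>, and may be attached to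
  the copy before or after them.
\<close>

lemma concat_shift: "A @ concat (map (\<lambda>b. b # A) T) = concat (map (\<lambda>b. A @ [b]) T) @ A"
  by (induction T) auto

lemma bar_fold_conv:
  assumes "bar A = A" "bar T = T"
  shows "bar (fold_conv A T) = fold_conv A T"
proof -
  have "bar (concat (map (\<lambda>b. b # A) T)) = concat (map (\<lambda>b. A @ [b]) (bar T))" for T
  proof (induction T)
    case (Cons b T)
    have "bar (b # A) = A @ [flip b]" using assms(1) by (simp add: bar_def)
    moreover have "bar (b # T) = bar T @ [flip b]" by (simp add: bar_def)
    ultimately show ?case using Cons by (simp add: bar_append[of "b # A", simplified])
  qed (simp add: bar_def)
  then show ?thesis
    using assms by (simp add: fold_conv_symmetric bar_append) (simp add: concat_shift)
qed

lemma conv_power_symmetric: "bar S = S \<Longrightarrow> bar (conv_power S n) = conv_power S n"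
  by (induction n) (simp_all add: bar_fold_conv, simp add: bar_def)

lemma nth_fold_conv:
  fixes A :: "crease list"
  defines "L \<equiv> Suc (length A)"
  shows "0 < k \<Longrightarrow> k < L * Suc (length T) \<Longrightarrow>
    (A @ concat (map (\<lambda>b. b # A) T)) ! (k - 1) = (if L dvd k then T ! (k div L - 1) else A ! (k mod L - 1))"
proof (induction T arbitrary: k)
  case Nil
  then show ?case by (auto simp: L_def dest: dvd_imp_le)
next
  case (Cons b T)
  consider "k < L" | "k = L" | "L < k" by linarith
  then show ?case
  proof cases
    case 1
    then have "\<not> L dvd k" using Cons.prems by (auto dest: dvd_imp_le)
    then show ?thesis using 1 Cons.prems by (auto simp: nth_append L_def)
  next
    case 2
    then show ?thesis by (simp add: nth_append L_def)
  next
    case 3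
    have "k - 1 = length (A @ [b]) + (k - L - 1)" using 3 by (simp add: L_def)
    then have "(A @ concat (map (\<lambda>b. b # A) (b # T))) ! (k - 1) = (A @ concat (map (\<lambda>b. b # A) T)) ! (k - L - 1)"
      using nth_append_length_plus[of "A @ [b]" "A @ concat (map (\<lambda>b. b # A) T)" "k - L - 1"] by simp
    also have "\<dots> = (if L dvd k - L then T ! ((k - L) div L - 1) else A ! ((k - L) mod L - 1))"
      using 3 Cons.prems by (intro Cons.IH) (auto simp: L_def)
    also have "L dvd k - L \<longleftrightarrow> L dvd k" using 3 by (simp add: dvd_minus_self)
    also have "(k - L) mod L = k mod L" using 3 by (simp add: mod_if[of k])
    also have "(k - L) div L = k div L - 1" using 3 div_add_self2[of L "k - L"] by (simp add: L_def)
    finally have eq: "(A @ concat (map (\<lambda>b. b # A) (b # T))) ! (k - 1)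
      = (if L dvd k then T ! (k div L - 1 - 1) else A ! (k mod L - 1))" .
    have "0 < k div L - 1" if dv: "L dvd k"
    proof -
      obtain q where "k = L * q" using dv by (rule dvdE)
      then have "1 < q" using 3 by (cases q; cases "q - 1") auto
      then show ?thesis using \<open>k = L * q\<close> by (simp add: L_def del: mult_Suc)
    qed
    then show ?thesis using eq by (auto simp: nth_Cons')
  qed
qed

lemma length_conv_power: "Suc (length (conv_power S n)) = Suc (length S) ^ n"
proof (induction n)
  case (Suc n)
  have "length (fold_conv A T) = length A + length T * Suc (length A)" for A T :: "crease list"
  proof -
    have "length (T ! i # (if even i then bar A else A)) = Suc (length A)" for i by (simp add: bar_def)
    then show ?thesis by (simp add: fold_conv_def length_concat comp_def sum_list_triv del: length_Cons)
  qed
  then have "Suc (length (conv_power S (Suc n))) = Suc (length S) * Suc (length (conv_power S n))" by simp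
  then show ?case unfolding Suc by simp
qed simp

text \<open>
  By definition, powers are built from the largest blocks downwards: the letters of the last
  factor separate copies of the previous power. For symmetric \<open>S\<close> the
  self-similarity at the smallest scale follows: positions not divisible by \<open>m\<close>
  repeat \<open>S\<close>, the others carry the previous power. Positions \<open>k\<close> count
  from 1.
\<close>

lemma conv_power_nth:
  assumes S: "bar S = S" and m: "m = Suc (length S)"
  shows "0 < k \<Longrightarrow> k < m ^ Suc n \<Longrightarrow>
    conv_power S (Suc n) ! (k - 1) =
      (if m dvd k then conv_power S n ! (k div m - 1) else S ! (k mod m - 1))"
proof (induction n arbitrary: k)
  case 0
  then have "\<not> m dvd k" "k mod m = k" by (auto dest: dvd_imp_le)
  then show ?case using conv_power_1 by simp
next
  case (Suc n)
  have unfold: "conv_power S (Suc l) ! (j - 1) =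
      (if m ^ l dvd j then S ! (j div m ^ l - 1) else conv_power S l ! (j mod m ^ l - 1))"
    if "0 < j" "j < m ^ Suc l" for j l
    using nth_fold_conv[of j "conv_power S l" S] that length_conv_power[of S l] m
    by (simp add: fold_conv_symmetric[OF conv_power_symmetric[OF S]] mult.commute)
  show ?case
  proof (cases "m ^ Suc n dvd k")
    case True
    then obtain q where q: "k = m ^ Suc n * q" by auto
    have mp: "0 < m" using m by simp
    have "m dvd k" "k div m = m ^ n * q" "k div m ^ Suc n = q" using q mp by auto
    moreover have "0 < m ^ n * q" "m ^ n * q < m ^ Suc n"
      using Suc.prems q mp by (auto simp: mult.assoc)
    ultimately show ?thesis using unfold[OF Suc.prems] unfold[of "m ^ n * q" n] True mp by simp
  next
    case False
    let ?j = "k mod m ^ Suc n"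
    have mp: "0 < m" using m by simp
    have j: "0 < ?j" "?j < m ^ Suc n" using False mp by (auto simp: dvd_eq_mod_eq_0)
    have "conv_power S (Suc (Suc n)) ! (k - 1) = conv_power S (Suc n) ! (?j - 1)"
      using unfold[OF Suc.prems] False by simp
    also have "\<dots> = (if m dvd ?j then conv_power S n ! (?j div m - 1) else S ! (?j mod m - 1))"
      by (rule Suc.IH[OF j])
    also have "m dvd ?j \<longleftrightarrow> m dvd k" by (simp add: dvd_mod_iff)
    also have "?j mod m = k mod m" by (simp add: mod_mod_cancel)
    finally have eq: "conv_power S (Suc (Suc n)) ! (k - 1)
      = (if m dvd k then conv_power S n ! (?j div m - 1) else S ! (k mod m - 1))" .
    show ?thesis
    proof (cases "m dvd k")
      case True
      then obtain q where q: "k = m * q" by auto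
      have "?j div m = q mod m ^ n" using mp by (simp add: q mult_mod_right[symmetric])
      moreover have "\<not> m ^ n dvd q" using False mp by (simp add: q)
      moreover have "0 < q" "q < m ^ Suc n" using Suc.prems mp by (auto simp: q)
      ultimately show ?thesis using eq True unfold[of q n] mp by (simp add: q)
    qed (use eq in simp)
  qed
qed

lemma conv_power_inf_nth:
  assumes S: "bar S = S" "S \<noteq> []" and m: "m = Suc (length S)" and k: "0 < k"
  shows "conv_power_inf S (k - 1) = (if m dvd k then conv_power_inf S (k div m - 1) else S ! (k mod m - 1))"
proof -
  have len: "length (conv_power S n) = m ^ n - 1" for n using length_conv_power[of S n] m by simp
  have "1 < m" using S(2) m by simp
  then have big: "k < m ^ k" using power_gt_expt[of m k] by simp
  then have big': "k < m ^ Suc k" by simp (metis \<open>1 < m\<close> less_trans nat_mult_1 mult_less_mono1 zero_less_iff_neq_zero not_less_zero)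
  have "conv_power_inf S (k - 1) = conv_power S (Suc k) ! (k - 1)"
    using big' k len[of "Suc k"] by (intro conv_power_inf_prefix[OF S(2)]) auto
  also have "\<dots> = (if m dvd k then conv_power S k ! (k div m - 1) else S ! (k mod m - 1))"
    by (rule conv_power_nth[OF S(1) m k big'])
  also have "conv_power S k ! (k div m - 1) = conv_power_inf S (k div m - 1)" if "m dvd k"
  proof -
    have "k div m \<le> k" by simp
    moreover have "0 < k div m" using that k by (auto simp: dvd_div_eq_0_iff)
    ultimately show ?thesis
      using big len[of k] by (intro conv_power_inf_prefix[OF S(2), symmetric]) linarith
  qed
  then have "(if m dvd k then conv_power S k ! (k div m - 1) else S ! (k mod m - 1))
     = (if m dvd k then conv_power_inf S (k div m - 1) else S ! (k mod m - 1))" by simp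
  finally show ?thesis .
qed

text \<open>
  The total turning before step \<open>n\<close> of the infinite curve.
\<close>

definition crease_weights :: "crease list \<Rightarrow> nat \<Rightarrow> int" where
  "crease_weights S n = weight (map (conv_power_inf S) [0..<n])"

lemma crease_weights_Suc: "crease_weights S (Suc n) = crease_weights S n + crease_weight (conv_power_inf S n)"
  by (simp add: crease_weights_def weight_append) (simp add: weight_def)

text \<open>
  Complete blocks \<open>S\<close> have weight 0.
\<close>

lemma crease_weights_div_mod:
  assumes S: "bar S = S" "S \<noteq> []" and m: "m = Suc (length S)"
  shows "crease_weights S n = crease_weights S (n div m) + weight (take (n mod m) S)"
proof (induction n)
  case 0
  then show ?case by (simp add: weight_def)
next
  case (Suc n)
  have mp: "0 < m" using m by simp
  show ?case
  proof (cases "m dvd Suc n")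
    case True
    then have "Suc n mod m = 0" by simp
    then have d: "Suc n div m = Suc (n div m)" "n mod m = length S"
      using mod_Suc[of n m] div_Suc[of n m] m by (auto split: if_splits)
    have "conv_power_inf S n = conv_power_inf S (n div m)"
      using conv_power_inf_nth[OF S m, of "Suc n"] True d by simp
    then have "crease_weights S (Suc n) = crease_weights S (Suc (n div m))"
      using Suc d weight_symmetric[OF S(1)] by (simp add: crease_weights_Suc)
    then show ?thesis using d \<open>Suc n mod m = 0\<close> by (simp add: weight_def)
  next
    case False
    then have d: "Suc n div m = n div m" "Suc n mod m = Suc (n mod m)"
      using mod_Suc[of n m] div_Suc[of n m] by (auto simp: dvd_eq_mod_eq_0 split: if_splits)
    then have "n mod m < length S" using m mod_less_divisor[OF mp, of "Suc n"] by simp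
    moreover have "conv_power_inf S n = S ! (n mod m)"
      using conv_power_inf_nth[OF S m, of "Suc n"] False d by simp
    ultimately show ?thesis using Suc d by (simp add: crease_weights_Suc weight_take_Suc)
  qed
qed

text \<open>
  The directions of the path of \<open>\<theta>(a)\<close> as complex units.
\<close>

definition dirs :: "crease list \<Rightarrow> nat \<Rightarrow> complex" where
  "dirs S j = \<i> powi weight (take j S)"

lemma direction_word_nth: "j \<le> length S \<Longrightarrow> step (direction_word S ! j) = dirs S j"
  by (simp add: direction_word_def dirs_def step_sigma_pow del: upt_Suc)

lemma length_direction_word: "length (direction_word S) = Suc (length S)"
  by (simp add: direction_word_def)

lemma powi_crease: "\<i> powi (k + crease_weight c) = (case c of D \<Rightarrow> \<i> | U \<Rightarrow> - \<i>) * \<i> powi k"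
  by (cases c) (simp_all add: power_int_add_1' power_int_diff)

lemma folding_path_dirs:
  assumes S: "bar S = S" "S \<noteq> []" and m: "m = Suc (length S)"
  shows "folding_path m (dirs S)"
proof
  show "2 \<le> m" using S(2) m by (cases S) auto
  show "dirs S 0 = 1" by (simp add: dirs_def weight_def)
  show "dirs S (Suc j) = \<i> * dirs S j \<or> dirs S (Suc j) = - \<i> * dirs S j" if "Suc j < m" for j
    using that m weight_take_Suc[of j S] powi_crease[of "weight (take j S)" "S ! j"]
    by (auto simp: dirs_def split: crease.splits)
  show "dirs S (m - 1 - j) = dirs S j" if "j < m" for j
    using weight_take_symmetric[OF S(1), of j] that m by (simp add: dirs_def)
qed

definition curve_arc :: "crease list \<Rightarrow> nat \<Rightarrow> arc" where
  "curve_arc S n = (inf_curve_vertex S n, \<i> powi crease_weights S n)"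

lemma inf_curve_vertex_0: "inf_curve_vertex S 0 = 0"
  by (simp add: inf_curve_vertex_def seq_vertex_def displacement_def)

lemma inf_curve_vertex_Suc: "inf_curve_vertex S (Suc n) = inf_curve_vertex S n + \<i> powi crease_weights S n"
  by (simp add: inf_curve_vertex_def seq_vertex_def displacement_def direction_seq_def
      step_sigma_pow crease_weights_def)

lemma curve_arc_Suc: "\<exists>t\<in>quarter_turns. curve_arc S (Suc n) = turn t (curve_arc S n)"
proof -
  let ?t = "case conv_power_inf S n of D \<Rightarrow> \<i> | U \<Rightarrow> - \<i>"
  have "?t \<in> quarter_turns" by (auto simp: quarter_turns_def split: crease.splits)
  moreover have "curve_arc S (Suc n) = turn ?t (curve_arc S n)"
    by (simp add: curve_arc_def turn_def head_def inf_curve_vertex_Suc crease_weights_Suc powi_crease)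
  ultimately show ?thesis by blast
qed

lemma curve_arc_in_arcs: "curve_arc S n \<in> arcs"
proof (induction n)
  case 0
  then show ?case
    by (simp add: curve_arc_def inf_curve_vertex_0 crease_weights_def weight_def arcs_def units_def)
next
  case (Suc n)
  then show ?case using curve_arc_Suc[of S n] turn_arc by metis
qed

lemma curve_arc_self_similar:
  assumes S: "bar S = S" "S \<noteq> []" and m: "m = Suc (length S)"
  shows "curve_arc S n = child (dirs S) m (curve_arc S (n div m)) (n mod m)"
proof -
  have dir: "\<i> powi crease_weights S n = \<i> powi crease_weights S (n div m) * dirs S (n mod m)" for n
    using crease_weights_div_mod[OF S m, of n] by (simp add: dirs_def power_int_add)
  have "inf_curve_vertex S n = turtle (dirs S) m * inf_curve_vertex S (n div m)
      + \<i> powi crease_weights S (n div m) * turtle (dirs S) (n mod m)"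
  proof (induction n)
    case 0
    then show ?case by (simp add: inf_curve_vertex_0 turtle_def)
  next
    case (Suc n)
    have v: "turtle (dirs S) (Suc j) = turtle (dirs S) j + dirs S j" for j by (simp add: turtle_def)
    have "inf_curve_vertex S (Suc n) = turtle (dirs S) m * inf_curve_vertex S (n div m)
      + \<i> powi crease_weights S (n div m) * turtle (dirs S) (Suc (n mod m))"
      using Suc dir[of n] by (simp add: inf_curve_vertex_Suc v algebra_simps)
    moreover have "Suc n div m = Suc (n div m) \<and> Suc (n mod m) = m \<and> Suc n mod m = 0
        \<or> Suc n div m = n div m \<and> Suc n mod m = Suc (n mod m)"
      using mod_Suc[of n m] div_Suc[of n m] by (auto split: if_splits)
    moreover have "turtle (dirs S) 0 = 0" by (simp add: turtle_def)
    ultimately show ?case by (auto simp: inf_curve_vertex_Suc algebra_simps)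
  qed
  then show ?thesis using dir[of n] by (simp add: curve_arc_def child_def)
qed

lemma curve_arc_inj:
  assumes "self_avoiding S"
  shows "inj (curve_arc S)"
proof (rule injI)
  fix i j assume eq: "curve_arc S i = curve_arc S j"
  then have "inf_curve_vertex S i = inf_curve_vertex S j" "inf_curve_vertex S (Suc i) = inf_curve_vertex S (Suc j)"
    by (auto simp: curve_arc_def inf_curve_vertex_Suc)
  then have "closed_segment (inf_curve_vertex S i) (inf_curve_vertex S (Suc i))
    = closed_segment (inf_curve_vertex S j) (inf_curve_vertex S (Suc j))" by (simp only:)
  then show "i = j" using assms unfolding self_avoiding_def inj_def by blast
qed

text \<open>
  A grid point that is visited twice has two different outgoing arcs on the curve, and there are
  only two arcs that start there.
\<close>

lemma curve_arc_fills:
  assumes "self_avoiding S" "planefilling S"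
  shows "\<exists>R>B. \<exists>c. \<forall>a\<in>arcs. fst a \<in> cball c R \<longrightarrow> a \<in> range (curve_arc S)"
proof -
  obtain R c where R: "R > max B 1" "\<forall>g\<in>grid_points \<inter> cball c R. card {j. inf_curve_vertex S j = g} = 2"
    using assms(2) unfolding planefilling_def by (metis less_max_iff_disj zero_less_one)
  have "a \<in> range (curve_arc S)" if a: "a \<in> arcs" "fst a \<in> cball c R" for a
  proof -
    have "card {j. inf_curve_vertex S j = fst a} = 2" using R(2) a arcsD(1) by blast
    then obtain i j where ij: "{j. inf_curve_vertex S j = fst a} = {i, j}" "i \<noteq> j" by (meson card_2_iff)
    let ?a = "curve_arc S i" and ?b = "curve_arc S j"
    have start: "fst ?a = fst a" "fst ?b = fst a" using ij(1) by (auto simp: curve_arc_def)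
    have "?a \<noteq> ?b" using curve_arc_inj[OF assms(1)] ij(2) by (auto simp: inj_eq)
    then have ne: "snd ?a \<noteq> snd ?b" using start by (simp add: prod_eq_iff)
    have same: "snd ?a \<in> {1, - 1} \<longleftrightarrow> snd a \<in> {1, - 1}" "snd ?b \<in> {1, - 1} \<longleftrightarrow> snd a \<in> {1, - 1}"
      using arcsD(5)[OF curve_arc_in_arcs[of S i]] arcsD(5)[OF curve_arc_in_arcs[of S j]] arcsD(5)[OF a(1)] start by auto
    have "snd ?a \<in> units" "snd ?b \<in> units" "snd a \<in> units"
      using arcsD(2) curve_arc_in_arcs a(1) by auto
    then have "snd a = snd ?a \<or> snd a = snd ?b"
      using ne same unfolding units_def by (elim insertE emptyE) (simp_all add: unit_distinct)
    then have "a = ?a \<or> a = ?b" using start by (auto simp: prod_eq_iff)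
    then show ?thesis by blast
  qed
  then show ?thesis using R(1) by (intro exI[of _ R] conjI exI[of _ c]) auto
qed

section \<open>The tile of a folding string\<close>

text \<open>
  Applied in both directions, this makes Hausdorff limits unique.
\<close>

lemma hausdorff_limit_subset:
  fixes X :: "nat \<Rightarrow> 'a::heine_borel set"
  assumes X: "\<And>n. compact (X n)" "\<And>n. X n \<noteq> {}"
    and T: "hausdorff_limit X T" "hausdorff_limit X T'"
  shows "T \<subseteq> T'"
proof
  fix y assume y: "y \<in> T"
  have c: "compact T" "T \<noteq> {}" "compact T'" "T' \<noteq> {}"
    "(\<lambda>n. hausdorff_dist (X n) T) \<longlonglongrightarrow> 0" "(\<lambda>n. hausdorff_dist (X n) T') \<longlonglongrightarrow> 0"
    using T by (auto simp: hausdorff_limit_def)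
  have bdd: "bdd_above ((\<lambda>x. infdist x B) ` A)" if "compact A" for A B :: "'a set"
    using that by (intro bounded_imp_bdd_above compact_imp_bounded compact_continuous_image continuous_intros)
  have le: "infdist y T' \<le> hausdorff_dist (X n) T + hausdorff_dist (X n) T'" for n
  proof -
    obtain x where x: "x \<in> X n" "infdist y (X n) = dist y x"
      using infdist_attains_inf[OF compact_imp_closed[OF X(1)] X(2)] by blast
    have "infdist y (X n) \<le> (SUP y\<in>T. infdist y (X n))" using y bdd[OF c(1)] by (intro cSUP_upper) auto
    moreover have "infdist x T' \<le> (SUP x\<in>X n. infdist x T')" using x bdd[OF X(1)] by (intro cSUP_upper) auto
    moreover have "infdist y T' \<le> infdist x T' + dist y x" by (rule infdist_triangle)
    ultimately show ?thesis unfolding hausdorff_dist_def x(2) by linarith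
  qed
  have "(\<lambda>n. hausdorff_dist (X n) T + hausdorff_dist (X n) T') \<longlonglongrightarrow> 0 + 0"
    by (intro tendsto_add c)
  then have "infdist y T' \<le> 0" using le by (intro LIMSEQ_le_const) auto
  then have "infdist y T' = 0" using infdist_nonneg[of y T'] by linarith
  then show "y \<in> T'" using in_closed_iff_infdist_zero[OF compact_imp_closed[OF c(3)] c(4)] by simp
qed

fun word_arcs :: "complex \<Rightarrow> letter list \<Rightarrow> arc set" where
  "word_arcs p [] = {}"
| "word_arcs p (x # u) = insert (p, step x) (word_arcs (p + step x) u)"

lemma displacement_simps [simp]:
  "displacement [] = 0" "displacement (x # u) = step x + displacement u"
  "displacement (u @ w) = displacement u + displacement w"
  by (simp_all add: displacement_def)

lemma vertex_simps: "vertex u 0 = 0" "vertex (x # u) (Suc j) = step x + vertex u j"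
  by (simp_all add: vertex_def)

lemma word_arcs_append: "word_arcs p (u @ w) = word_arcs p u \<union> word_arcs (p + displacement u) w"
  by (induction u arbitrary: p) (auto simp: add.assoc)

lemma word_arcs_nth: "word_arcs p u = (\<lambda>j. (p + vertex u j, step (u ! j))) ` {..<length u}"
proof (induction u arbitrary: p)
  case (Cons x u)
  have "{..<length (x # u)} = insert 0 (Suc ` {..<length u})" by (simp add: lessThan_Suc_eq_insert_0)
  then show ?case by (simp add: Cons vertex_simps image_image add.assoc)
qed simp

lemma vertex_Suc: "j < length u \<Longrightarrow> vertex u (Suc j) = vertex u j + step (u ! j)"
  by (simp add: vertex_def take_Suc_conv_app_nth)

lemma curve_word_arcs: "curve u = (\<Union>a\<in>word_arcs 0 u. closed_segment (fst a) (head a))"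
  by (auto simp: curve_def word_arcs_nth vertex_Suc head_def)

context
  fixes S :: "crease list" and m :: nat
  assumes sym: "bar S = S" and S_ne: "S \<noteq> []" and m: "m = Suc (length S)"
begin

interpretation folding_path m "dirs S"
  by (rule folding_path_dirs[OF sym S_ne m])

text \<open>
  Hence for symmetric \<open>S\<close> the morphism commutes with \<open>\<sigma>\<close> alone.
\<close>

lemma rev_direction_word: "rev (direction_word S) = direction_word S"
proof (rule nth_equalityI)
  fix j assume "j < length (rev (direction_word S))"
  then have j: "j < m" by (simp add: length_direction_word m)
  have "step (rev (direction_word S) ! j) = step (direction_word S ! (m - 1 - j))"
    using j by (simp add: rev_nth length_direction_word m)
  also have "\<dots> = dirs S (m - 1 - j)" using j m by (intro direction_word_nth) simp
  also have "\<dots> = dirs S j" by (rule palindrome[OF j])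
  also have "\<dots> = step (direction_word S ! j)" using j m by (simp add: direction_word_nth)
  finally show "rev (direction_word S) ! j = direction_word S ! j" by (simp only: step_inj)
qed simp

lemma theta_letter_nth:
  assumes "j < m"
  shows "length (theta_letter S x) = m" "step (theta_letter S x ! j) = step x * dirs S j"
proof -
  have pow: "step ((sigma ^^ k) x) = \<i> ^ k * step x" for k x
    by (induction k) (simp_all add: step_sigma)
  show len: "length (theta_letter S x) = m" by (cases x) (simp_all add: length_direction_word m)
  have "step (direction_word S ! j) = dirs S j" using assms m by (simp add: direction_word_nth)
  then show "step (theta_letter S x ! j) = step x * dirs S j"
    using assms by (cases x)
      (simp_all add: rev_direction_word length_direction_word m step_sigma pow
        power2_eq_square power3_eq_cube)
qed

lemma vertex_theta_letter: "j \<le> m \<Longrightarrow> vertex (theta_letter S x) j = step x * v j"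
proof (induction j)
  case (Suc j)
  then have "j < m" by simp
  then show ?case
    using Suc theta_letter_nth[OF \<open>j < m\<close>, of x] by (simp add: vertex_Suc v_Suc algebra_simps)
qed (simp add: vertex_def)

lemma displacement_theta_letter: "displacement (theta_letter S x) = z * step x"
  using vertex_theta_letter[of m x] theta_letter_nth(1)[OF m_pos, of x]
  by (simp add: vertex_def mult.commute)

lemma word_arcs_theta_letter: "word_arcs (z * p) (theta_letter S x) = child (dirs S) m (p, step x) ` {..<m}"
  unfolding word_arcs_nth theta_letter_nth(1)[OF m_pos]
  by (intro image_cong) (simp_all add: vertex_theta_letter theta_letter_nth child_def)

lemma word_arcs_theta: "word_arcs (z * p) (theta S u) = (\<Union>e\<in>word_arcs p u. child (dirs S) m e ` {..<m})"
proof (induction u arbitrary: p)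
  case (Cons x u)
  have "theta S (x # u) = theta_letter S x @ theta S u" by (simp add: theta_def)
  moreover have "z * p + z * step x = z * (p + step x)" by (simp add: algebra_simps)
  ultimately show ?case
    using Cons[of "p + step x"] by (simp add: word_arcs_append word_arcs_theta_letter displacement_theta_letter)
qed (simp add: theta_def)

lemma scaling_eq: "scaling S = z"
  using displacement_theta_letter[of La] by (simp add: scaling_def theta_def)

lemma card_boundary_points: "card (boundary_points S) = card simple_vertices"
proof -
  let ?u = "theta S [La]"
  have u: "?u = theta_letter S La" by (simp add: theta_def)
  have len: "length ?u = m" using theta_letter_nth(1)[OF m_pos] by (simp only: u)
  have vert: "vertex ?u j = v j" if "j \<le> m" for j
    unfolding u using vertex_theta_letter[OF that, of La] by simp
  have set_eq: "{j. j \<le> length ?u \<and> vertex ?u j = g} = {j. j \<le> m \<and> v j = g}" for g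
    using vert len by auto
  have "boundary_points S = v ` simple_vertices"
  proof (intro equalityI subsetI)
    fix g assume "g \<in> boundary_points S"
    then have "card {j. j \<le> m \<and> v j = g} = 1" by (simp add: boundary_points_def set_eq Let_def)
    then obtain j where j: "{j. j \<le> m \<and> v j = g} = {j}" by (rule card_1_singletonE)
    then have "j \<le> m" "v j = g" by blast+
    moreover have "k = j" if "k \<le> m" "v k = v j" for k using that j \<open>v j = g\<close> by blast
    ultimately show "g \<in> v ` simple_vertices" unfolding simple_vertices_def by blast
  next
    fix g assume "g \<in> v ` simple_vertices"
    then obtain j where j: "g = v j" "j \<le> m" "\<forall>k\<le>m. v k = v j \<longrightarrow> k = j"
      unfolding simple_vertices_def by blast
    then have "{j. j \<le> m \<and> v j = g} = {j}" by auto
    then have "card {j. j \<le> m \<and> v j = g} = 1" by simp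
    then show "g \<in> boundary_points S" using v_grid[OF j(2)] j(1) by (simp add: boundary_points_def set_eq Let_def)
  qed
  moreover have "inj_on v simple_vertices" by (auto simp: inj_on_def simple_vertices_def)
  ultimately show ?thesis by (simp add: card_image)
qed

lemma grid_substitution_dirs:
  assumes "self_avoiding S" "planefilling S"
  shows "grid_substitution m (dirs S)"
proof
  show "bij_betw (\<lambda>(e, j). child (dirs S) m e j) (arcs \<times> {..<m}) arcs"
    by (rule bij_betw_child[of "curve_arc S"])
      (use curve_arc_inj[OF assms(1)] curve_arc_fills[OF assms] curve_arc_self_similar[OF sym S_ne m]
        curve_arc_in_arcs in blast)+
qed

end

text \<open>
  The tile is the limit tile of the four arcs around a unit face. All arcs around that face
  belong to the set, while the right turn from the first arc leads to an arc that does not, so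
  there are sides; the dimension of the frontier is therefore \<open>ln (r/2) / ln
  \<bar>z\<bar>\<close> with \<open>\<bar>z\<bar>\<^sup>2 = m\<close>.
\<close>

theorem theorem7:
  fixes S :: "crease list" and m r :: nat
  assumes "folding_string S"
    and "m = length S + 1"
    and "self_avoiding S"
    and "planefilling S"
    and "symmetric_string S"
    and "r = card (boundary_points S)"
  shows "hausdorff_dim (frontier (tile S)) = ereal ((2 * ln (real r) - ln 4) / ln (real m))"
proof -
  have S: "bar S = S" "S \<noteq> []" "m = Suc (length S)"
    using assms by (auto simp: symmetric_string_def folding_string_def)
  interpret grid_substitution m "dirs S"
    by (rule grid_substitution_dirs[OF S assms(3,4)])
  define A :: "arc set" where "A = word_arcs 0 [La, Lb, Lc, Ld]"
  have A_eq: "A = {(0, 1), (1, \<i>), (1 + \<i>, - 1), (\<i>, - \<i>)}" by (auto simp: A_def)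
  have A_arcs: "A \<subseteq> arcs"
  proof -
    have "turn \<i> (0, 1) = (1, \<i>)" "turn \<i> (1, \<i>) = (1 + \<i>, - 1)" "turn \<i> (1 + \<i>, - 1) = (\<i>, - \<i>)"
      by (simp_all add: turn_def head_def)
    then show ?thesis
      using exists_arc turn_arc[of _ \<i>] unfolding A_eq quarter_turns_def
      by (metis empty_subsetI insertCI insert_subset)
  qed
  have A: "finite A" "A \<noteq> {}" by (auto simp: A_eq)
  have gen: "word_arcs 0 ((theta S ^^ n) [La, Lb, Lc, Ld]) = (subst ^^ n) A" for n
  proof (induction n)
    case (Suc n)
    then show ?case
      using word_arcs_theta[OF S, of 0 "(theta S ^^ n) [La, Lb, Lc, Ld]"]
      by (simp add: subst_def[of "(subst ^^ n) A"] children_def)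
  qed (simp add: A_def)
  have approx: "tile_approx S = (\<lambda>n. (\<lambda>x. x / z ^ n) ` arcs_curve ((subst ^^ n) A))"
    by (simp add: fun_eq_iff tile_approx_def curve_word_arcs gen arcs_curve_def scaling_eq[OF S])
  have limit: "hausdorff_limit (tile_approx S) (limit_tile A)"
    and cpt: "\<And>n. compact (tile_approx S n)" "\<And>n. tile_approx S n \<noteq> {}"
    unfolding approx using hausdorff_limit_limit_tile[OF A(1) A_arcs A(2)] by blast+
  have tile: "tile S = limit_tile A"
    unfolding tile_def
  proof (rule the_equality)
    show "hausdorff_limit (tile_approx S) (limit_tile A)" by (rule limit)
  next
    fix T assume "hausdorff_limit (tile_approx S) T"
    then show "T = limit_tile A" using hausdorff_limit_subset[where X = "tile_approx S", OF cpt] limit by blast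
  qed
  have "((0, 1), - \<i>) \<in> sides A"
    using exists_arc by (simp add: sides_def corners_def quarter_turns_def A_eq turn_def head_def complex_eq_iff)
  then have "hausdorff_dim (frontier (tile S)) = ereal (ln side_count / ln (cmod z))"
    unfolding tile by (intro hausdorff_dim_frontier_limit_tile[OF A(1) A_arcs]) blast
  moreover have "ln side_count / ln (cmod z) = (2 * ln (real r) - ln 4) / ln (real m)"
  proof -
    have "r = 2 * side_count"
      using card_boundary_points[OF S] assms(6) card_simple_vertices by simp
    then have "ln (real r) = ln 2 + ln side_count" using side_count_pos by (simp add: ln_mult)
    moreover have "ln (4 :: real) = 2 * ln 2" using ln_realpow[of 2 2] by simp
    moreover have "ln (real m) = 2 * ln (cmod z)"
      using ln_realpow[of "cmod z" 2] norm_z z_nonzero by simp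
    ultimately show ?thesis by simp
  qed
  ultimately show ?thesis by simp
qed

end
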